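(* Let $\mathbb F$ be a finite field with $q$ elements, $A=\mathbb F[t]$, and let $\phi:A\to A\{\tau\}$ be a Drinfeld model, with $\phi_t=t+g_1\tau+\cdots+g_r\tau^r$. Let $\mathfrak p$ be a place of $A$; if $q=2$, assume further that $\deg\mathfrak p>1$. (1) If $\phi$ is very small, then $v_{\mathfrak p}\big(L_{\mathfrak p}(\phi;1)\big)=c_{\mathfrak p}(\phi;1)$. In particular, in this case, $\mathfrak p$ is $\phi$-Wieferich in base $1$ if and only if $\mathfrak p$ divides $L_{\mathfrak p}(\phi;1)$ (i.e. $v_{\mathfrak p}(L_{\mathfrak p}(\phi;1))>0$). (2) If $\phi$ is small and $1$ is not a $\phi$-torsion point (i.e. there is no nonzero $a\in A$ with $\phi_a(1)=0$), then $v_{\mathfrak p}\big(L^*_{\mathfrak p}(\phi;1)\big)=c_{\mathfrak p}(\phi;1)$. In particular, in this case, $\mathfrak p$ is $\phi$-Wieferich in base $1$ if and only if $\mathfrak p$ divides $L^*_{\mathfrak p}(\phi;1)$.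
   Context: $K=\mathbb F(t)$. For a commutative $\mathbb F$-algebra $R$, $R\{\tau\}$ is the ring of twisted polynomials $\sum c_i\tau^i$ ($c_i\in R$) with $\tau c=c^q\tau$; it acts on $R$ by $(\sum c_i\tau^i)(x)=\sum c_ix^{q^i}$. A Drinfeld model (of rank $r\ge1$) is an $\mathbb F$-algebra homomorphism $\phi:A\to A\{\tau\}$, $a\mapsto\phi_a$, such that $\phi_t=t+g_1\tau+\cdots+g_r\tau^r$ with $g_i\in A$, $g_r\neq0$. It is small (resp. very small) if $\deg_t g_i\le q^i$ (resp. $\deg_t g_i<q^i$) for all $i$. A place is a monic irreducible $\mathfrak p\in A$; $v_{\mathfrak p}$ is the $\mathfrak p$-adic valuation, $K_{\mathfrak p}$ the $\mathfrak p$-adic completion of $K$. For $x\in A$ and an ideal $I$ of $A$, $\pi_x(\phi;I)=\{a\in A:\phi_a(x)\in I\}$. The place $\mathfrak p$ is $\phi$-Wieferich in base $x$ if $\pi_x(\phi;\mathfrak p)=\pi_x(\phi;\mathfrak p^2)$, and $c_{\mathfrak p}(\phi;x)$ is the largest $c\in\{0,1,\dots,\infty\}$ with $\pi_x(\phi;\mathfrak p^{c+1})=\pi_x(\phi;\mathfrak p)$. $L$-series: let $T$ be an indeterminate; the $T$-twisted form $\phi^\sim:A\to A[T]\{\tau\}$ is the $\mathbb F$-algebra homomorphism with $\phi^\sim_t=t+g_1T\tau+\cdots+g_rT^r\tau^r$ ($\tau$ commuting with $T$). For an $A$-algebra $S$, $S[T]$ is an $A[T]$-module via $\phi^\sim$,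 $\tau$ acting by $\sum c_jT^j\mapsto\sum c_j^qT^j$. For a place $\mathfrak p$ with $\mathbb F_{\mathfrak p}=A/\mathfrak p$, set $|\phi^\sim(\mathbb F_{\mathfrak p})|:=\det_{A[T]}\big(t-\phi^\sim_t\mid A\otimes_{\mathbb F}\mathbb F_{\mathfrak p}[T]\big)\in A[T]$ (with $t$ acting on the factor $A$ and $\phi^\sim_t$ on the factor $\mathbb F_{\mathfrak p}[T]$), $P_{\mathfrak p}(\phi;T):=\mathfrak p^{-1}|\phi^\sim(\mathbb F_{\mathfrak p})|\in 1+TK[T]$, $L(\phi;T):=\prod_{\mathfrak q}P_{\mathfrak q}(\phi;T)^{-1}\in K[[T]]$ (product over all places) and $L_{\mathfrak p}(\phi;T):=P_{\mathfrak p}(\phi;T)L(\phi;T)$. It is known that $L_{\mathfrak p}(\phi;T)$ converges $\mathfrak p$-adically on the closed unit disc, so it defines an element of the Tate algebra $K_{\mathfrak p}\langle T\rangle$ that can be evaluated at $T=1$, giving $L_{\mathfrak p}(\phi;1)\in K_{\mathfrak p}$; writing $L_{\mathfrak p}(\phi;T)=(T-1)^kL^*_{\mathfrak p}(\phi;T)$ with $L^*_{\mathfrak p}(\phi;1)\ne0$ defines the special value $L^*_{\mathfrak p}(\phi;1)$. *)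

theory Defs
  imports
    "HOL-Library.Cardinality"
    "HOL-Library.Extended_Real"
    "HOL-Library.Extended_Nat"
    "HOL-Computational_Algebra.Computational_Algebra"
    "HOL-Algebra.QuotRing"
    "Jordan_Normal_Form.Determinant"
begin

text \<open>
  Throughout, the finite field \<open>\<bbbF>\<close> is a type \<open>'f :: finite_field\<close>, \<open>q = CARD('f)\<close>,
  \<open>A = \<bbbF>[t]\<close> is the type \<open>'f poly\<close> with \<open>t = [:0, 1:]\<close>, and \<open>K = \<bbbF>(t)\<close> is \<open>'f poly fract\<close>.
  The ring \<open>A[T]\<close> is \<open>'f poly poly\<close>: the outer variable is \<open>T\<close>, the inner one is \<open>t\<close>.
\<close>


section \<open>Twisted polynomials\<close>

text \<open>
  For a ring \<open>R\<close> with endomorphism \<open>\<sigma>\<close>, the ring \<open>R{\<tau>}\<close> with \<open>\<tau> c = \<sigma>(c) \<tau>\<close> has the same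
  additive group as \<open>'r poly\<close> (the coefficient of \<open>\<tau>\<^sup>i\<close> being \<open>coeff P i\<close>), but the
  product below. We need \<open>\<sigma> = frob\<close> on \<open>A\<close>, and its \<open>T\<close>-linear extension \<open>map_poly frob\<close> on \<open>A[T]\<close>.
\<close>

definition skew_mult :: "('r \<Rightarrow> 'r) \<Rightarrow> 'r::comm_ring_1 poly \<Rightarrow> 'r poly \<Rightarrow> 'r poly" where
  "skew_mult \<sigma> P Q =
     (\<Sum>i\<le>degree P. \<Sum>j\<le>degree Q. monom (coeff P i * (\<sigma> ^^ i) (coeff Q j)) (i + j))"

definition skew_act :: "('r \<Rightarrow> 'r) \<Rightarrow> 'r::comm_ring_1 poly \<Rightarrow> 'r \<Rightarrow> 'r" where
  "skew_act \<sigma> P x = (\<Sum>i\<le>degree P. coeff P i * (\<sigma> ^^ i) x)"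

definition frob :: "'f::finite_field poly \<Rightarrow> 'f poly" where
  "frob x = x ^ CARD('f)"

lemma frob_funpow: "(frob ^^ i) (x :: 'f::finite_field poly) = x ^ (CARD('f) ^ i)"
  by (induction i) (simp_all add: frob_def power_mult [symmetric] mult.commute)

lemma skew_act_frob:
  "skew_act frob P (x :: 'f::finite_field poly) =
     (\<Sum>i\<le>degree P. coeff P i * x ^ (CARD('f) ^ i))"
  by (simp add: skew_act_def frob_funpow)


section \<open>Drinfeld models\<close>

definition drinfeld_model :: "nat \<Rightarrow> ('f::finite_field poly \<Rightarrow> 'f poly poly) \<Rightarrow> bool" where
  "drinfeld_model r \<phi> \<longleftrightarrow>
     (\<forall>a b. \<phi> (a + b) = \<phi> a + \<phi> b) \<and>
     (\<forall>a b. \<phi> (a * b) = skew_mult frob (\<phi> a) (\<phi> b)) \<and>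
     (\<forall>c. \<phi> [:c:] = [:[:c:]:]) \<and>
     r \<ge> 1 \<and> coeff (\<phi> [:0, 1:]) 0 = [:0, 1:] \<and> degree (\<phi> [:0, 1:]) = r"

definition small_model :: "nat \<Rightarrow> ('f::finite_field poly \<Rightarrow> 'f poly poly) \<Rightarrow> bool" where
  "small_model r \<phi> \<longleftrightarrow> (\<forall>i\<in>{1..r}. degree (coeff (\<phi> [:0, 1:]) i) \<le> CARD('f) ^ i)"

definition very_small_model :: "nat \<Rightarrow> ('f::finite_field poly \<Rightarrow> 'f poly poly) \<Rightarrow> bool" where
  "very_small_model r \<phi> \<longleftrightarrow> (\<forall>i\<in>{1..r}. degree (coeff (\<phi> [:0, 1:]) i) < CARD('f) ^ i)"

definition torsion_point :: "('f::finite_field poly \<Rightarrow> 'f poly poly) \<Rightarrow> 'f poly \<Rightarrow> bool" where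
  "torsion_point \<phi> x \<longleftrightarrow> (\<exists>a. a \<noteq> 0 \<and> skew_act frob (\<phi> a) x = 0)"

definition place :: "'f::finite_field poly \<Rightarrow> bool" where
  "place p \<longleftrightarrow> lead_coeff p = 1 \<and> irreducible p"


section \<open>Wieferich places\<close>

definition transporter ::
    "('f::finite_field poly \<Rightarrow> 'f poly poly) \<Rightarrow> 'f poly \<Rightarrow> 'f poly set \<Rightarrow> 'f poly set" where
  "transporter \<phi> x I = {a. skew_act frob (\<phi> a) x \<in> I}"

definition principal_ideal :: "'f::finite_field poly \<Rightarrow> 'f poly set" where
  "principal_ideal a = {b. a dvd b}"

definition wieferich ::
    "('f::finite_field poly \<Rightarrow> 'f poly poly) \<Rightarrow> 'f poly \<Rightarrow> 'f poly \<Rightarrow> bool" where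
  "wieferich \<phi> x p \<longleftrightarrow>
     transporter \<phi> x (principal_ideal p) = transporter \<phi> x (principal_ideal (p ^ 2))"

text \<open>
  The set below is nonempty and downward closed, so its supremum in \<open>enat\<close> is its
  maximum, or \<open>\<infinity>\<close> if the equality holds for all \<open>c\<close>; in the latter case the equality
  also holds for the zero ideal, the intersection of all the powers of \<open>p\<close>.
\<close>

definition wieferich_exponent ::
    "('f::finite_field poly \<Rightarrow> 'f poly poly) \<Rightarrow> 'f poly \<Rightarrow> 'f poly \<Rightarrow> enat" where
  "wieferich_exponent \<phi> x p =
     Sup (enat ` {c. transporter \<phi> x (principal_ideal (p ^ (c + 1))) =
                     transporter \<phi> x (principal_ideal p)})"


section \<open>The completion of \<open>K\<close> at a place\<close>

definition padic_val :: "'f::finite_field poly \<Rightarrow> 'f poly fract \<Rightarrow> ereal" where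
  "padic_val p x =
     (if x = 0 then \<infinity>
      else ereal (of_int (THE v. \<exists>a b. \<not> p dvd a \<and> \<not> p dvd b \<and>
                                   x = to_fract p powi v * Fract a b)))"

lemma padic_val_unique:
  fixes p :: "'f::finite_field poly"
  assumes p: "place p"
    and a: "\<not> p dvd a" and b: "\<not> p dvd b"
  shows "padic_val p (to_fract p powi v * Fract a b) = ereal (of_int v)"
proof -
  from p have prime: "prime_elem p"
    by (simp add: place_def field_poly_irreducible_imp_prime)
  then have p0: "to_fract p \<noteq> 0"
    by (simp add: prime_elem_def)
  have to_fract_power: "to_fract (p ^ n) = to_fract p ^ n" for n
    by (induction n) simp_all
  have le: "w \<le> v"
    if "to_fract p powi v * Fract a b = to_fract p powi w * Fract c d"
      "\<not> p dvd a" "\<not> p dvd b" "\<not> p dvd c" "\<not> p dvd d" for a b c d v w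
  proof (rule ccontr)
    assume "\<not> w \<le> v"
    then have w: "w = v + int (nat (w - v))" and pos: "nat (w - v) > 0"
      by auto
    have "to_fract p powi w = to_fract p powi v * to_fract p ^ nat (w - v)"
      by (subst w, subst power_int_add) (use p0 in \<open>simp_all add: power_int_def\<close>)
    with that(1) p0 have "Fract a b = to_fract (p ^ nat (w - v)) * Fract c d"
      by (simp add: mult.assoc to_fract_power)
    then have "Fract a b = Fract (p ^ nat (w - v) * c) d"
      by (simp add: to_fract_def)
    moreover have "b \<noteq> 0" "d \<noteq> 0"
      using that by auto
    ultimately have "a * d = p ^ nat (w - v) * c * b"
      by (simp add: eq_fract)
    with pos have "p dvd a * d"
      by (simp add: dvd_power dvd_mult2)
    with prime that show False
      by (simp add: prime_elem_dvd_mult_iff)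
  qed
  have "(THE v'. \<exists>c d. \<not> p dvd c \<and> \<not> p dvd d \<and>
           to_fract p powi v * Fract a b = to_fract p powi v' * Fract c d) = v"
  proof (rule the_equality)
    show "\<exists>c d. \<not> p dvd c \<and> \<not> p dvd d \<and>
           to_fract p powi v * Fract a b = to_fract p powi v * Fract c d"
      using a b by blast
  next
    fix w
    assume "\<exists>c d. \<not> p dvd c \<and> \<not> p dvd d \<and>
           to_fract p powi v * Fract a b = to_fract p powi w * Fract c d"
    then obtain c d where "\<not> p dvd c" "\<not> p dvd d"
      "to_fract p powi v * Fract a b = to_fract p powi w * Fract c d" by blast
    with a b show "w = v"
      using le by (metis antisym)
  qed
  moreover have "a \<noteq> 0" "b \<noteq> 0"
    using a b by auto
  then have "Fract a b \<noteq> 0"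
    by (simp add: Zero_fract_def eq_fract)
  ultimately show ?thesis
    using p0 by (simp add: padic_val_def)
qed

definition padic_cauchy :: "'f::finite_field poly \<Rightarrow> (nat \<Rightarrow> 'f poly fract) \<Rightarrow> bool" where
  "padic_cauchy p X \<longleftrightarrow>
     (\<forall>M::real. \<exists>N. \<forall>m\<ge>N. \<forall>n\<ge>N. ereal M \<le> padic_val p (X m - X n))"

definition cauchy_ring :: "'f::finite_field poly \<Rightarrow> (nat \<Rightarrow> 'f poly fract) ring" where
  "cauchy_ring p =
     \<lparr>carrier = {X. padic_cauchy p X}, mult = (\<lambda>X Y n. X n * Y n), one = (\<lambda>_. 1),
      zero = (\<lambda>_. 0), add = (\<lambda>X Y n. X n + Y n)\<rparr>"

definition null_seqs :: "'f::finite_field poly \<Rightarrow> (nat \<Rightarrow> 'f poly fract) set" where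
  "null_seqs p = {X. (\<lambda>n. padic_val p (X n)) \<longlonglongrightarrow> \<infinity>}"

definition completion :: "'f::finite_field poly \<Rightarrow> (nat \<Rightarrow> 'f poly fract) set ring" where
  "completion p = cauchy_ring p Quot null_seqs p"

definition to_completion ::
    "'f::finite_field poly \<Rightarrow> 'f poly fract \<Rightarrow> (nat \<Rightarrow> 'f poly fract) set" where
  "to_completion p x = null_seqs p +>\<^bsub>cauchy_ring p\<^esub> (\<lambda>_. x)"

text \<open>The valuation of a class is the limit of the valuations along any representative.\<close>

definition completion_val ::
    "'f::finite_field poly \<Rightarrow> (nat \<Rightarrow> 'f poly fract) set \<Rightarrow> ereal" where
  "completion_val p \<xi> = (THE v. \<forall>X\<in>\<xi>. (\<lambda>n. padic_val p (X n)) \<longlonglongrightarrow> v)"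


section \<open>The Tate algebra\<close>

text \<open>Power series \<open>\<Sum> f\<^sub>n T\<^sup>n\<close> over \<open>K\<^sub>p\<close> are given by their coefficient sequences.\<close>

definition tate_algebra ::
    "'f::finite_field poly \<Rightarrow> (nat \<Rightarrow> (nat \<Rightarrow> 'f poly fract) set) set" where
  "tate_algebra p =
     {f. (\<forall>n. f n \<in> carrier (completion p)) \<and> (\<lambda>n. completion_val p (f n)) \<longlonglongrightarrow> \<infinity>}"

definition tate_eval_1 ::
    "'f::finite_field poly \<Rightarrow> (nat \<Rightarrow> (nat \<Rightarrow> 'f poly fract) set) \<Rightarrow> (nat \<Rightarrow> 'f poly fract) set" where
  "tate_eval_1 p f =
     (THE s. s \<in> carrier (completion p) \<and>
        (\<lambda>N. completion_val p (s \<ominus>\<^bsub>completion p\<^esub> (\<Oplus>\<^bsub>completion p\<^esub>n\<in>{..<N}. f n))) \<longlonglongrightarrow> \<infinity>)"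

text \<open>Multiplication of a power series by \<open>T - 1\<close>.\<close>

definition times_T_minus_1 :: "('c, 'm) ring_scheme \<Rightarrow> (nat \<Rightarrow> 'c) \<Rightarrow> (nat \<Rightarrow> 'c)" where
  "times_T_minus_1 R f = (\<lambda>n. (if n = 0 then \<zero>\<^bsub>R\<^esub> else f (n - 1)) \<ominus>\<^bsub>R\<^esub> f n)"

definition special_value_1 ::
    "'f::finite_field poly \<Rightarrow> (nat \<Rightarrow> (nat \<Rightarrow> 'f poly fract) set) \<Rightarrow> (nat \<Rightarrow> 'f poly fract) set" where
  "special_value_1 p f =
     (THE s. \<exists>k g. g \<in> tate_algebra p \<and> f = (times_T_minus_1 (completion p) ^^ k) g \<and>
               s = tate_eval_1 p g \<and> s \<noteq> \<zero>\<^bsub>completion p\<^esub>)"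


section \<open>The \<open>L\<close>-series\<close>

text \<open>
  The map \<open>\<Sum> c\<^sub>i \<tau>\<^sup>i \<mapsto> \<Sum> c\<^sub>i T\<^sup>i \<tau>\<^sup>i\<close> from \<open>A{\<tau>}\<close> to \<open>A[T]{\<tau>}\<close> is a ring homomorphism, so
  the \<open>T\<close>-twisted form of \<open>\<phi>\<close> is \<open>a \<mapsto> T_twist (\<phi> a)\<close>.
\<close>

definition T_twist :: "'f::finite_field poly poly \<Rightarrow> 'f poly poly poly" where
  "T_twist P = (\<Sum>i\<le>degree P. monom (monom (coeff P i) i) i)"

lemma coeff_T_twist: "coeff (T_twist P) i = monom (coeff P i) i"
  by (auto simp: T_twist_def coeff_sum coeff_eq_0 if_distrib cong: if_cong)

lemma T_twist_add: "T_twist (P + Q) = T_twist P + T_twist Q"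
  by (rule poly_eqI) (simp add: coeff_T_twist add_monom)

lemma T_twist_skew_mult:
  "T_twist (skew_mult frob P Q) = skew_mult (map_poly frob) (T_twist P) (T_twist Q)"
proof -
  have degree: "degree (T_twist P) = degree P" for P :: "'a poly poly"
  proof (rule antisym)
    show "degree (T_twist P) \<le> degree P"
      by (rule degree_le) (simp add: coeff_T_twist coeff_eq_0)
    show "degree P \<le> degree (T_twist P)"
    proof (cases "P = 0")
      case False
      then show ?thesis
        by (intro le_degree) (simp add: coeff_T_twist)
    qed simp
  qed
  have frob_0: "frob (0 :: 'a poly) = 0"
    by (simp add: frob_def)
  have frob_monom: "(map_poly frob ^^ i) (monom b j) = monom ((frob ^^ i) b) j"
    for i j and b :: "'a poly"
    by (induction i) (simp_all add: map_poly_monom frob_0)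
  have T_twist_sum: "T_twist (sum g I) = (\<Sum>i\<in>I. T_twist (g i))"
    for I :: "nat set" and g :: "nat \<Rightarrow> 'a poly poly"
    by (rule poly_eqI) (simp add: coeff_T_twist coeff_sum monom_sum)
  have T_twist_monom: "T_twist (monom c n) = monom (monom c n) n" for c :: "'a poly" and n
    by (rule poly_eqI) (simp add: coeff_T_twist)
  show ?thesis
    by (simp add: skew_mult_def degree T_twist_sum T_twist_monom coeff_T_twist frob_monom mult_monom)
qed

text \<open>
  \<open>\<bbbF>\<^sub>p = A/p\<close> is represented by remainders modulo \<open>p\<close>, hence \<open>\<bbbF>\<^sub>p[T]\<close> by the polynomials in
  \<open>T\<close> whose coefficients are such remainders; the following is the action of \<open>\<phi>\<^sup>~\<^sub>t\<close> on it.
\<close>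

definition residue_T_action ::
    "('f::finite_field poly \<Rightarrow> 'f poly poly) \<Rightarrow> 'f poly \<Rightarrow> 'f poly poly \<Rightarrow> 'f poly poly" where
  "residue_T_action \<phi> p x =
     map_poly (\<lambda>c. c mod p) (skew_act (map_poly frob) (T_twist (\<phi> [:0, 1:])) x)"

text \<open>
  The \<open>A[T]\<close>-module \<open>A \<otimes> \<bbbF>\<^sub>p[T]\<close> (tensor product over \<open>\<bbbF>\<close>) is free with basis
  \<open>1 \<otimes> \<theta>\<^sup>j\<close>, \<open>j < deg p\<close>, where \<open>\<theta>\<close> is the class of \<open>t\<close> in \<open>\<bbbF>\<^sub>p\<close>. Entry \<open>(i, j)\<close> of the
  matrix of the \<open>A[T]\<close>-linear map \<open>t \<otimes> 1 - 1 \<otimes> \<phi>\<^sup>~\<^sub>t\<close> in this basis is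
  \<open>t \<delta>\<^sub>i\<^sub>j\<close> minus the \<open>\<theta>\<^sup>i\<close>-coordinate, in \<open>\<bbbF>[T] \<subseteq> A[T]\<close>, of \<open>\<phi>\<^sup>~\<^sub>t(\<theta>\<^sup>j)\<close>.
  Here \<open>[:monom 1 j:]\<close> is \<open>\<theta>\<^sup>j\<close> as a constant polynomial in \<open>T\<close>, and the scalar \<open>t\<close> of
  \<open>A[T]\<close> is \<open>[:[:0, 1:]:]\<close>.
\<close>

definition residue_char_det ::
    "('f::finite_field poly \<Rightarrow> 'f poly poly) \<Rightarrow> 'f poly \<Rightarrow> 'f poly poly" where
  "residue_char_det \<phi> p =
     det (mat (degree p) (degree p) (\<lambda>(i, j).
       (if i = j then [:[:0, 1:]:] else 0) -
       map_poly (\<lambda>c. [:coeff c i:]) (residue_T_action \<phi> p [:monom 1 j:])))"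

definition local_factor ::
    "('f::finite_field poly \<Rightarrow> 'f poly poly) \<Rightarrow> 'f poly \<Rightarrow> 'f poly fract fps" where
  "local_factor \<phi> p =
     fps_const (inverse (to_fract p)) * fps_of_poly (map_poly to_fract (residue_char_det \<phi> p))"

text \<open>
  The Euler product is the limit of its finite subproducts, in the \<open>T\<close>-adic
  topology that the library puts on \<open>K[[T]]\<close>.
\<close>

definition L_series :: "('f::finite_field poly \<Rightarrow> 'f poly poly) \<Rightarrow> 'f poly fract fps" where
  "L_series \<phi> =
     Lim (finite_subsets_at_top {q. place q}) (\<lambda>S. \<Prod>q\<in>S. inverse (local_factor \<phi> q))"

definition L_series_at ::
    "('f::finite_field poly \<Rightarrow> 'f poly poly) \<Rightarrow> 'f poly \<Rightarrow> 'f poly fract fps" where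
  "L_series_at \<phi> p = local_factor \<phi> p * L_series \<phi>"

definition L_tate ::
    "('f::finite_field poly \<Rightarrow> 'f poly poly) \<Rightarrow> 'f poly \<Rightarrow> nat \<Rightarrow> (nat \<Rightarrow> 'f poly fract) set" where
  "L_tate \<phi> p = (\<lambda>n. to_completion p (fps_nth (L_series_at \<phi> p) n))"

definition L_value ::
    "('f::finite_field poly \<Rightarrow> 'f poly poly) \<Rightarrow> 'f poly \<Rightarrow> (nat \<Rightarrow> 'f poly fract) set" where
  "L_value \<phi> p = tate_eval_1 p (L_tate \<phi> p)"

definition L_special_value ::
    "('f::finite_field poly \<Rightarrow> 'f poly poly) \<Rightarrow> 'f poly \<Rightarrow> (nat \<Rightarrow> 'f poly fract) set" where
  "L_special_value \<phi> p = special_value_1 p (L_tate \<phi> p)"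

end

theory Submission
  imports Defs "Jordan_Normal_Form.Char_Poly"
begin

text \<open>
  The twisted logarithm turns the action of \<open>\<phi>\<^sup>~\<close> into multiplication. Let \<open>Q\<^sub>p\<close> be the
  characteristic determinant at \<open>p\<close>; by Cayley--Hamilton \<open>Q\<^sub>p log(1)\<close> is the logarithm of a multiple
  of \<open>p\<close> in \<open>A[T]\<close>. For a large finite set \<open>S\<close> of places with product \<open>h\<close>, it follows that
  \<open>(\<Prod>\<^sub>S Q\<^sub>p / h) log(1)\<close> has coefficients in \<open>A\<close> modulo a high power of \<open>T\<close>; smallness makes
  them regular at \<open>\<infinity>\<close>, hence constant. This yields the class formula \<open>L = u log(1)\<close>
  with an explicit \<open>u \<in> \<bbbF>[T]\<close>, equal to \<open>1\<close> for very small models.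

  Consequently \<open>L\<^sub>p = u p\<^sup>-\<^sup>1 log(y)\<close> where \<open>p\<close> divides \<open>y\<close> and \<open>y(1) = \<phi>\<^sub>a(1)\<close> for
  \<open>a = Q\<^sub>p(1)\<close>. On multiples of \<open>p\<close> the logarithm preserves valuations, so the value at \<open>T = 1\<close>
  has the valuation of \<open>\<phi>\<^sub>a(1)/p\<close>. Finally \<open>a\<close> is a multiple, by a factor prime to \<open>p\<close>, of the
  generator of \<open>\<pi>\<^sub>1(\<phi>; p)\<close>, which identifies this valuation with the Wieferich exponent.
\<close>

section \<open>The Frobenius endomorphism of \<open>A\<close>\<close>

text \<open>The indeterminate \<open>T\<close> turns analysis at infinity into algebra: the
  logarithm is a formal series, and the class formula is checked coefficient by coefficient, where
  only finitely many brackets \<open>t - t^(q^k)\<close> occur as denominators. Smallness says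
  precisely that \<open>g_(n-i)^(q^i)\<close> has degree at most \<open>q^n\<close>, the degree of
  the bracket by which step \<open>n\<close> of the recursion for the logarithm divides; the top
  coefficients that survive at infinity assemble into \<open>u\<close>.

  At \<open>p\<close> the obstacle is that the coefficients of the logarithm may have denominators
  growing like \<open>p^n\<close>. On a multiple \<open>y = p w\<close>, however,
  \<open>\<tau>^n\<close> produces \<open>p^(q^n)\<close>, and after division by \<open>p\<close>
  the term of index \<open>n\<close> still has valuation at least \<open>n\<close>; this is where
  \<open>q = 2\<close> with \<open>p\<close> linear must be excluded. If \<open>w(1)\<close> is
  nonzero, the terms with \<open>n \<ge> 1\<close> then add up to something smaller than
  \<open>w(1)\<close>.

  The logarithm is injective on \<open>A[T]\<close>, so elements obtained in different ways, one
  known to be divisible by \<open>p\<close>, the other with known value at \<open>T = 1\<close>, can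
  be identified. A zero of \<open>u\<close> at \<open>T = 1\<close> costs only a power of
  \<open>T - 1\<close>: the value of the cofactor is a nonzero constant, a unit at
  \<open>p\<close>.\<close>

text \<open>Allowing the degree to reach \<open>card S\<close>, with vanishing coefficient there,
  suits differences of two monic polynomials of degree \<open>q\<close>.\<close>

lemma poly_eq_0_if_many_roots:
  fixes P :: "'a::idom poly"
  assumes "degree P \<le> card S" and "coeff P (card S) = 0" and "finite S"
    and "\<And>x. x \<in> S \<Longrightarrow> poly P x = 0"
  shows "P = 0"
proof (rule ccontr)
  assume "P \<noteq> 0"
  then have "degree P < card S"
    using eq_zero_or_degree_less assms by blast
  moreover have "card S \<le> card {x. poly P x = 0}"
    using assms \<open>P \<noteq> 0\<close> by (intro card_mono poly_roots_finite) auto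
  moreover have "card {x. poly P x = 0} \<le> degree P"
    using card_poly_roots_bound \<open>P \<noteq> 0\<close> by blast
  ultimately show False by simp
qed

lemma card_field_ge_2: "CARD('f::finite_field) \<ge> 2"
proof -
  have "card {0, 1 :: 'f} \<le> CARD('f)"
    by (intro card_mono) auto
  then show ?thesis by simp
qed

lemma prod_linear_factors:
  "(\<Prod>c\<in>UNIV. [:- c, 1:]) = (monom 1 CARD('f) - [:0, 1:] :: 'f::finite_field poly)" (is "?P = ?X")
proof -
  have monic: "degree ?P = CARD('f) \<and> coeff ?P CARD('f) = 1"
    using lead_coeff_prod[of "\<lambda>c. [:- c, 1:]" "UNIV :: 'f set"]
    by (simp add: degree_prod_eq_sum_degree)
  have "?X - ?P = 0"
  proof (rule poly_eq_0_if_many_roots[where S = UNIV])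
    show "degree (?X - ?P) \<le> CARD('f)"
      using monic card_field_ge_2[where 'f = 'f]
      by (intro degree_diff_le) (auto simp: degree_monom_eq)
    show "coeff (?X - ?P) CARD('f) = 0"
      using monic card_field_ge_2[where 'f = 'f] by (auto simp: coeff_pCons split: nat.splits)
    show "poly (?X - ?P) x = 0" for x
      by (auto simp: poly_monom poly_prod finite_field_power_card_eq_same)
  qed auto
  then show ?thesis by simp
qed

lemma pcompose_power: "pcompose (P ^ n) x = pcompose P (x :: 'a::comm_ring_1 poly) ^ n"
  by (induction n) (simp_all add: pcompose_mult pcompose_1)

text \<open>The left side is invariant under translation of \<open>x\<close> by constants, which
  yields the additivity of \<open>frob\<close>; at \<open>x = t\<close> it factors the first
  bracket, up to sign, into linear polynomials.\<close>

lemma prod_translates: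
  "(\<Prod>c\<in>UNIV. x - [:c:]) = x ^ CARD('f) - (x :: 'f::finite_field poly)"
proof -
  have "(\<Prod>c\<in>UNIV. x - [:c:]) = pcompose (\<Prod>c\<in>UNIV. [:- c, 1:]) x"
    by (simp add: pcompose_prod pcompose_pCons diff_conv_add_uminus add.commute)
  also have "\<dots> = x ^ CARD('f) - x"
    by (simp add: prod_linear_factors pcompose_diff pcompose_pCons monom_altdef pcompose_power)
  finally show ?thesis .
qed

text \<open>
  The polynomial \<open>(x + Y)\<^sup>q - x\<^sup>q - Y\<^sup>q\<close> in \<open>Y\<close> has degree less than \<open>q\<close> and, by invariance of the
  product of all translates, vanishes at the \<open>q\<close> constants. This avoids showing that \<open>q\<close> is a
  power of the characteristic.
\<close>

lemma frob_add: "frob (x + y) = frob x + frob (y :: 'f::finite_field poly)"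
proof -
  let ?q = "CARD('f)"
  define G where "G = [:x, 1:] ^ ?q - [:x ^ ?q:] - monom 1 ?q"
  have q: "?q \<ge> 2" by (rule card_field_ge_2)
  have card: "card ((\<lambda>c::'f. [:c:]) ` UNIV) = ?q"
    by (intro card_image) (auto simp: inj_on_def)
  have "G = 0"
  proof (rule poly_eq_0_if_many_roots)
    show "degree G \<le> card ((\<lambda>c::'f. [:c:]) ` UNIV)"
      unfolding G_def card
      by (intro degree_diff_le) (auto simp: degree_linear_power degree_monom_eq)
    have "coeff ([:x, 1:] ^ ?q) ?q = 1"
      using monic_power[of "[:x, 1:]" ?q] by (simp add: degree_linear_power)
    then show "coeff G (card ((\<lambda>c::'f. [:c:]) ` UNIV)) = 0"
      using q unfolding G_def card by (auto simp: coeff_pCons split: nat.splits)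
    fix z assume "z \<in> (\<lambda>c::'f. [:c:]) ` UNIV"
    then obtain c where z: "z = [:c:]" by auto
    have "(x + [:c:]) ^ ?q - (x + [:c:]) = (\<Prod>b\<in>UNIV. (x + [:c:]) - [:b:])"
      by (simp add: prod_translates)
    also have "\<dots> = (\<Prod>b\<in>UNIV. x - [:b:])"
      by (rule prod.reindex_bij_witness[of _ "\<lambda>b. b + c" "\<lambda>b. b - c"]) auto
    also have "\<dots> = x ^ ?q - x" by (rule prod_translates)
    finally have "(x + [:c:]) ^ ?q = x ^ ?q + [:c:]" by (simp add: algebra_simps)
    moreover have "z ^ ?q = [:c:]"
      by (simp add: z poly_const_pow finite_field_power_card_eq_same)
    ultimately show "poly G z = 0"
      by (simp add: G_def z poly_monom)
  qed simp
  then have "poly G y = 0" by simp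
  then show ?thesis by (simp add: G_def frob_def poly_monom algebra_simps)
qed

section \<open>Iterates of Frobenius as \<open>\<bbbF>\<close>-linear ring endomorphisms\<close>

lemma frob_0 [simp]: "frob 0 = (0 :: 'f::finite_field poly)"
  by (simp add: frob_def)

lemma frob_pow_0 [simp]: "(frob ^^ n) 0 = (0 :: 'f::finite_field poly)"
  by (induction n) auto

lemma frob_pow_add: "(frob ^^ n) (x + y) = (frob ^^ n) x + (frob ^^ n) (y :: 'f::finite_field poly)"
  by (induction n) (auto simp: frob_add)

lemma frob_pow_sum: "(frob ^^ n) (sum f I) = (\<Sum>i\<in>I. (frob ^^ n) (f i :: 'f::finite_field poly))"
  by (induction I rule: infinite_finite_induct) (auto simp: frob_pow_add)

lemma frob_pow_mult: "(frob ^^ n) (x * y) = (frob ^^ n) x * (frob ^^ n) (y :: 'f::finite_field poly)"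
  by (simp add: frob_funpow power_mult_distrib)

lemma frob_pow_const: "(frob ^^ n) [:c:] = [:c :: 'f::finite_field:]"
  by (simp add: frob_funpow poly_const_pow finite_field_power_card_power_eq_same)

lemma frob_pow_smult: "(frob ^^ n) (Polynomial.smult c x) = Polynomial.smult c ((frob ^^ n) (x :: 'f::finite_field poly))"
  using frob_pow_mult[of n "[:c:]" x] by (simp add: frob_pow_const)

lemma coeff_frob_map: "coeff ((map_poly frob ^^ i) x) n = (frob ^^ i) (coeff x n :: 'f::finite_field poly)"
  by (induction i) (auto simp: coeff_map_poly)

lemma frob_pow_dvd: "h dvd x \<Longrightarrow> h dvd (frob ^^ n) (x :: 'f::finite_field poly)"
  unfolding frob_funpow by (metis dvd_power dvd_trans zero_less_card_finite zero_less_power)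

section \<open>The twisted logarithm\<close>

definition emb :: "'f::finite_field poly poly \<Rightarrow> 'f poly fract fps" where
  "emb f = fps_of_poly (map_poly to_fract f)"

lemma emb_nth [simp]: "fps_nth (emb f) n = to_fract (coeff f n)"
  by (simp add: emb_def coeff_map_poly)

lemma emb_0 [simp]: "emb 0 = 0" and emb_1 [simp]: "emb 1 = 1"
  by (auto simp: fps_eq_iff)

lemma emb_add: "emb (f + g) = emb f + emb g"
  by (auto simp: fps_eq_iff)

lemma emb_diff: "emb (f - g) = emb f - emb g"
  by (auto simp: fps_eq_iff)

lemma emb_mult: "emb (f * g) = emb f * emb g"
  by (auto simp: fps_eq_iff coeff_mult fps_mult_nth atLeast0AtMost)

lemma emb_sum: "emb (sum f I) = (\<Sum>i\<in>I. emb (f i))"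
  by (induction I rule: infinite_finite_induct) (auto simp: emb_add)

lemma emb_prod: "emb (prod f I) = (\<Prod>i\<in>I. emb (f i))"
  by (induction I rule: infinite_finite_induct) (auto simp: emb_mult)

lemma emb_const: "emb [:a:] = fps_const (to_fract a)"
  by (auto simp: fps_eq_iff coeff_pCons split: nat.splits)

lemma emb_pCons: "emb (pCons a f) = fps_const (to_fract a) + fps_X * emb f"
  by (auto simp: fps_eq_iff coeff_pCons split: nat.splits)

text \<open>Up to sign the Carlitz bracket \<open>[n]\<close>, the product of the places whose
  degree divides \<open>n\<close>.\<close>

abbreviation carlitz_bracket :: "nat \<Rightarrow> 'f::finite_field poly" where
  "carlitz_bracket n \<equiv> [:0, 1:] - [:0, 1:] ^ (CARD('f) ^ n)"

text \<open>Solves \<open>log \<phi>_t = t log\<close> for the coefficient of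
  \<open>\<tau>^n\<close>: the term \<open>i = n\<close> on the left is \<open>l_n t^(q^n)\<close>,
  and moving it to the right leaves \<open>l_n\<close> times the bracket.\<close>

fun log_coeff :: "(nat \<Rightarrow> 'f::finite_field poly) \<Rightarrow> nat \<Rightarrow> 'f poly fract" where
  "log_coeff g n = (if n = 0 then 1 else
     (\<Sum>i<n. log_coeff g i * to_fract ((frob ^^ i) (g (n - i)))) / to_fract (carlitz_bracket n))"

declare log_coeff.simps [simp del]

lemma log_coeff_0 [simp]: "log_coeff g 0 = 1"
  by (simp add: log_coeff.simps)

lemma card_field_power_ge_2: "n > 0 \<Longrightarrow> CARD('f::finite_field) ^ n \<ge> 2"
  using card_field_ge_2[where 'f = 'f] by (cases n) (auto intro: order.trans)

lemma coeff_X_power: "coeff ([:0, 1:] ^ m) k = (if k = m then 1 else 0 :: 'a::comm_ring_1)"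
  using coeff_monom[of "1 :: 'a" m k] by (auto simp: monom_altdef)

lemma degree_X_power: "degree ([:0, 1 :: 'a::comm_ring_1:] ^ m) = m"
  using degree_monom_eq[of "1 :: 'a" m] by (simp add: monom_altdef)

lemma carlitz_bracket_coeffs:
  assumes "n > 0"
  shows "degree (carlitz_bracket n :: 'f::finite_field poly) = CARD('f) ^ n"
    and "coeff (carlitz_bracket n :: 'f::finite_field poly) (CARD('f) ^ n) = - 1"
proof -
  let ?b = "carlitz_bracket n :: 'f poly"
  have q: "CARD('f) ^ n \<ge> 2" using card_field_power_ge_2 assms .
  show c: "coeff ?b (CARD('f) ^ n) = - 1"
    using assms q by (auto simp: coeff_X_power coeff_pCons split: nat.splits)
  have "degree ?b \<le> CARD('f) ^ n"
    using assms q by (intro degree_diff_le) (auto simp: degree_X_power)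
  moreover have "degree ?b \<ge> CARD('f) ^ n"
    by (intro le_degree) (subst c, simp)
  ultimately show "degree ?b = CARD('f) ^ n" by simp
qed

lemma carlitz_bracket_nz: "n > 0 \<Longrightarrow> carlitz_bracket n \<noteq> (0 :: 'f::finite_field poly)"
  using carlitz_bracket_coeffs(2)[where 'f = 'f] by (metis coeff_0 neg_equal_0_iff_equal zero_neq_one)

text \<open>
  The logarithm \<open>\<Sum> l\<^sub>n T\<^sup>n \<tau>\<^sup>n\<close> of the twisted model, where \<open>g\<close> lists the coefficients of
  \<open>\<phi>\<^sub>t\<close> and \<open>log_coeff g n\<close> is \<open>l\<^sub>n\<close>.
\<close>

definition twisted_log :: "(nat \<Rightarrow> 'f::finite_field poly) \<Rightarrow> 'f poly poly \<Rightarrow> 'f poly fract fps" where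
  "twisted_log g x = Abs_fps (\<lambda>N. \<Sum>n\<le>N. log_coeff g n * to_fract ((frob ^^ n) (coeff x (N - n))))"

lemma twisted_log_nth:
  "fps_nth (twisted_log g x) N = (\<Sum>n\<le>N. log_coeff g n * to_fract ((frob ^^ n) (coeff x (N - n))))"
  by (simp add: twisted_log_def)

lemma twisted_log_0 [simp]: "twisted_log g 0 = 0"
  by (simp add: fps_eq_iff twisted_log_nth)

lemma twisted_log_add: "twisted_log g (x + y) = twisted_log g x + twisted_log g y"
  by (simp add: fps_eq_iff twisted_log_nth frob_pow_add sum.distrib algebra_simps)

lemma twisted_log_uminus: "twisted_log g (- x) = - twisted_log g x"
  using twisted_log_add[of g x "- x"] by (simp add: eq_neg_iff_add_eq_0 add.commute)

lemma twisted_log_diff: "twisted_log g (x - y) = twisted_log g x - twisted_log g y"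
  using twisted_log_add[of g x "- y"] by (simp add: twisted_log_uminus)

lemma twisted_log_sum: "twisted_log g (sum f I) = (\<Sum>i\<in>I. twisted_log g (f i))"
  by (induction I rule: infinite_finite_induct) (auto simp: twisted_log_add)

lemma twisted_log_smult:
  "twisted_log g (Polynomial.smult [:c:] x) = fps_const (to_fract [:c:]) * twisted_log g x"
  by (simp add: fps_eq_iff twisted_log_nth frob_pow_smult sum_distrib_left mult_ac
        flip: smult_conv_map_poly to_fract_mult)

lemma twisted_log_shift: "twisted_log g (pCons 0 x) = fps_X * twisted_log g x"
proof (rule fps_ext)
  fix N
  show "fps_nth (twisted_log g (pCons 0 x)) N = fps_nth (fps_X * twisted_log g x) N"
  proof (cases N)
    case (Suc M)
    have "(\<Sum>n\<le>M. log_coeff g n * to_fract ((frob ^^ n) (coeff (pCons 0 x) (Suc M - n)))) =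
      (\<Sum>n\<le>M. log_coeff g n * to_fract ((frob ^^ n) (coeff x (M - n))))"
      by (intro sum.cong) (auto simp: Suc_diff_le)
    then show ?thesis
      by (simp add: Suc twisted_log_nth)
  qed (simp add: twisted_log_nth)
qed

lemma twisted_log_nth_0: "fps_nth (twisted_log g x) 0 = to_fract (coeff x 0)"
  by (simp add: twisted_log_nth)

text \<open>As \<open>l_0 = 1\<close>, the coefficient of \<open>T^N\<close> is that of
  \<open>x\<close> plus contributions of lower coefficients of \<open>x\<close>, so the logarithm is
  unitriangular.\<close>

lemma twisted_log_eq_0D:
  assumes "twisted_log g x = 0" shows "x = 0"
proof -
  have "coeff x N = 0" for N
  proof (induction N rule: less_induct)
    case (less N)
    have "0 = fps_nth (twisted_log g x) N" using assms by simp
    also have "\<dots> = (\<Sum>n\<in>{0}. log_coeff g n * to_fract ((frob ^^ n) (coeff x (N - n))))"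
      unfolding twisted_log_nth
    proof (intro sum.mono_neutral_right ballI)
      fix n assume "n \<in> {..N} - {0}"
      then have "coeff x (N - n) = 0" by (intro less) auto
      then show "log_coeff g n * to_fract ((frob ^^ n) (coeff x (N - n))) = 0" by simp
    qed auto
    finally show ?case by simp
  qed
  then show ?thesis by (simp add: poly_eq_iff)
qed

lemma twisted_log_inj: "twisted_log g x = twisted_log g y \<Longrightarrow> x = y"
  using twisted_log_eq_0D[of g "x - y"] by (simp add: twisted_log_diff)

text \<open>The functional equation of the logarithm in each degree. With \<open>g 0 = t\<close> the
  term \<open>n = m\<close> is \<open>l_m t^(q^m)\<close>, which the bracket completes to
  \<open>t l_m\<close>.\<close>

lemma log_coeff_rec:
  assumes "g 0 = [:0, 1:]"
  shows "(\<Sum>n\<le>m. log_coeff g n * to_fract ((frob ^^ n) (g (m - n)))) =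
    to_fract [:0, 1:] * log_coeff g m"
proof (cases "m = 0")
  case False
  have "(\<Sum>n\<le>m. log_coeff g n * to_fract ((frob ^^ n) (g (m - n)))) =
    (\<Sum>n<m. log_coeff g n * to_fract ((frob ^^ n) (g (m - n)))) +
    log_coeff g m * to_fract ([:0, 1:] ^ (CARD('a) ^ m))"
    by (simp add: assms frob_funpow flip: lessThan_Suc_atMost)
  moreover have "(\<Sum>n<m. log_coeff g n * to_fract ((frob ^^ n) (g (m - n)))) =
    log_coeff g m * to_fract (carlitz_bracket m)"
    using False carlitz_bracket_nz[of m, where 'f = 'a] by (subst (2) log_coeff.simps) simp
  ultimately show ?thesis by (simp add: algebra_simps)
qed (simp add: assms)

lemma sum_triangle: "(\<Sum>n\<le>N. \<Sum>i\<le>N - n. f n i) = (\<Sum>m\<le>N. \<Sum>n\<le>m. f n (m - n :: nat))"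
proof -
  have "(\<Sum>n\<le>N. \<Sum>i\<le>N - n. f n i) = (\<Sum>(n, i)\<in>(SIGMA n:{..N}. {..N - n}). f n i)"
    by (rule sum.Sigma) auto
  also have "(SIGMA n:{..N}. {..N - n}) = {(n, i). n + i \<le> N}"
    by auto
  finally show ?thesis by (simp add: sum.triangle_reindex_eq)
qed

text \<open>Gathering the exponents of \<open>\<tau>\<close> into \<open>m = n + i\<close> makes the
  inner sum that of \<open>log_coeff_rec\<close>. The hypothesis on \<open>y\<close> is the
  coefficient form of the action of \<open>\<phi>^~_t\<close>.\<close>

lemma twisted_log_act:
  assumes "g 0 = [:0, 1:]"
    and y: "\<And>m. coeff y m = (\<Sum>i\<le>m. g i * (frob ^^ i) (coeff x (m - i)))"
  shows "twisted_log g y = fps_const (to_fract [:0, 1:]) * twisted_log g x"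
proof (rule fps_ext)
  fix N
  have "fps_nth (twisted_log g y) N = (\<Sum>n\<le>N. \<Sum>i\<le>N - n. log_coeff g n *
      (to_fract ((frob ^^ n) (g i)) * to_fract ((frob ^^ (n + i)) (coeff x (N - (n + i))))))"
    by (simp add: twisted_log_nth y frob_pow_sum frob_pow_mult funpow_add sum_distrib_left)
  also have "\<dots> = (\<Sum>m\<le>N. \<Sum>n\<le>m. log_coeff g n *
      (to_fract ((frob ^^ n) (g (m - n))) * to_fract ((frob ^^ m) (coeff x (N - m)))))"
    by (subst sum_triangle) (intro sum.cong, auto)
  also have "\<dots> = (\<Sum>m\<le>N. (\<Sum>n\<le>m. log_coeff g n * to_fract ((frob ^^ n) (g (m - n)))) *
       to_fract ((frob ^^ m) (coeff x (N - m))))"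
    by (simp add: sum_distrib_right sum_distrib_left mult_ac)
  also have "\<dots> = fps_nth (fps_const (to_fract [:0, 1:]) * twisted_log g x) N"
    by (simp add: log_coeff_rec assms(1) twisted_log_nth sum_distrib_left mult_ac)
  finally show "fps_nth (twisted_log g y) N = \<dots>" .
qed

section \<open>The action of \<open>A[T]\<close> on itself through the twisted model\<close>

locale drinfeld =
  fixes \<phi> :: "'f::finite_field poly \<Rightarrow> 'f poly poly" and r :: nat
  assumes model: "drinfeld_model r \<phi>"
begin

abbreviation g :: "nat \<Rightarrow> 'f poly" where "g \<equiv> coeff (\<phi> [:0, 1:])"
abbreviation LOG :: "'f poly poly \<Rightarrow> 'f poly fract fps" where "LOG \<equiv> twisted_log g"

lemma g_0: "g 0 = [:0, 1:]"
  using model by (simp add: drinfeld_model_def)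

definition act_t :: "'f poly poly \<Rightarrow> 'f poly poly" where
  "act_t x = skew_act (map_poly frob) (T_twist (\<phi> [:0, 1:])) x"

lemma coeff_act_t: "coeff (act_t x) m = (\<Sum>i\<le>m. g i * (frob ^^ i) (coeff x (m - i)))"
proof -
  let ?D = "degree (T_twist (\<phi> [:0, 1:]))"
  have z: "g i = 0" if "i > ?D" for i
    using that coeff_eq_0[of "T_twist (\<phi> [:0, 1:])" i] by (simp add: coeff_T_twist)
  have "coeff (act_t x) m = (\<Sum>i\<le>?D. if i \<le> m then g i * (frob ^^ i) (coeff x (m - i)) else 0)"
    unfolding act_t_def skew_act_def coeff_sum
    by (intro sum.cong) (auto simp: coeff_T_twist coeff_monom_mult coeff_frob_map)
  also have "\<dots> = (\<Sum>i\<in>{..max ?D m}. if i \<le> m then g i * (frob ^^ i) (coeff x (m - i)) else 0)"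
    by (intro sum.mono_neutral_left) (auto simp: z)
  also have "\<dots> = (\<Sum>i\<le>m. g i * (frob ^^ i) (coeff x (m - i)))"
    by (intro sum.mono_neutral_cong_right) auto
  finally show ?thesis .
qed

lemma LOG_act_t: "LOG (act_t x) = fps_const (to_fract [:0, 1:]) * LOG x"
  by (rule twisted_log_act[where g = g, OF g_0]) (rule coeff_act_t)

lemma act_t_dvd:
  assumes "[:h:] dvd x" shows "[:h:] dvd act_t x"
  using assms unfolding const_poly_dvd_iff coeff_act_t
  by (auto intro!: dvd_sum dvd_mult frob_pow_dvd)

end

section \<open>Evaluation of twisted polynomials and specialization at \<open>T = 1\<close>\<close>

lemma skew_act_bound:
  "degree P \<le> N \<Longrightarrow> skew_act \<sigma> P x = (\<Sum>i\<le>N. coeff P i * (\<sigma> ^^ i) x)"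
  unfolding skew_act_def by (intro sum.mono_neutral_left) (auto simp: coeff_eq_0)

lemma skew_act_0 [simp]: "skew_act \<sigma> 0 x = 0"
  by (simp add: skew_act_def)

lemma skew_act_add_left: "skew_act \<sigma> (P + Q) x = skew_act \<sigma> P x + skew_act \<sigma> Q x"
  using degree_add_le_max[of P Q]
  by (simp add: skew_act_bound[where N = "max (degree P) (degree Q)"] sum.distrib algebra_simps)

lemma skew_act_sum_left: "skew_act \<sigma> (sum f I) x = (\<Sum>i\<in>I. skew_act \<sigma> (f i) x)"
  by (induction I rule: infinite_finite_induct) (auto simp: skew_act_add_left)

lemma skew_act_monom: "skew_act \<sigma> (monom c n) x = c * (\<sigma> ^^ n) x"
  by (subst skew_act_bound[where N = n]) (auto simp: degree_monom_le sum.remove[of _ n])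

lemma skew_act_skew_mult:
  "skew_act frob (skew_mult frob P Q) x = skew_act frob P (skew_act frob Q (x :: 'f::finite_field poly))"
  by (simp add: skew_mult_def skew_act_sum_left skew_act_monom)
     (simp add: skew_act_def frob_pow_sum frob_pow_mult funpow_add sum_distrib_left mult.assoc)

text \<open>Frobenius is additive and fixes \<open>T = 1\<close>; hence evaluation there carries the
  twisted model to \<open>\<phi>\<close> itself.\<close>

lemma poly_frob_pow: "poly ((map_poly frob ^^ i) x) 1 = (frob ^^ i) (poly x (1 :: 'f::finite_field poly))"
proof -
  have "poly (map_poly frob x) 1 = frob (poly x (1 :: 'f poly))" for x
    by (induction x) (auto simp: map_poly_pCons frob_add)
  then show ?thesis by (induction i) auto
qed

context drinfeld
begin

abbreviation ev :: "'f poly \<Rightarrow> 'f poly \<Rightarrow> 'f poly" where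
  "ev a x \<equiv> skew_act frob (\<phi> a) x"

lemma ev_add_left: "ev (a + b) x = ev a x + ev b x"
  using model by (simp add: drinfeld_model_def skew_act_add_left)

lemma ev_mult: "ev (a * b) x = ev a (ev b x)"
  using model by (simp add: drinfeld_model_def skew_act_skew_mult)

lemma ev_const: "ev [:c:] x = Polynomial.smult c x"
  using model by (simp add: drinfeld_model_def skew_act_def)

lemma ev_0 [simp]: "ev 0 x = 0"
  using ev_const[of 0] by simp

lemma ev_pCons: "ev (pCons c a) x = Polynomial.smult c x + ev [:0, 1:] (ev a x)"
  using ev_add_left[of "[:c:]" "[:0, 1:] * a" x] by (simp add: ev_const flip: ev_mult)

lemma ev_t: "poly (act_t x) 1 = ev [:0, 1:] (poly x 1)"
proof -
  let ?D = "max (degree (\<phi> [:0, 1:])) (degree (T_twist (\<phi> [:0, 1:])))"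
  have "poly (act_t x) 1 = poly (\<Sum>i\<le>?D. coeff (T_twist (\<phi> [:0, 1:])) i * (map_poly frob ^^ i) x) 1"
    unfolding act_t_def by (subst skew_act_bound[where N = ?D]) auto
  also have "\<dots> = (\<Sum>i\<le>?D. g i * (frob ^^ i) (poly x 1))"
    by (simp add: poly_sum coeff_T_twist poly_monom poly_frob_pow)
  also have "\<dots> = ev [:0, 1:] (poly x 1)"
    by (subst skew_act_bound[where N = ?D]) auto
  finally show ?thesis .
qed

text \<open>Horner's rule in \<open>t\<close>. Injectivity of the logarithm makes \<open>y\<close>
  unique, so the first property already says that \<open>y\<close> is the result of acting by
  \<open>a\<close>; the others record stability of multiples and compatibility with
  \<open>T = 1\<close>.\<close>

lemma ex_act_const:
  "\<exists>y. LOG y = fps_const (to_fract a) * LOG x \<and> (\<forall>h. [:h:] dvd x \<longrightarrow> [:h:] dvd y) \<and>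
       poly y 1 = ev a (poly x 1)"
proof (induction a)
  case 0
  show ?case by (intro exI[of _ 0]) auto
next
  case (pCons c a)
  then obtain y where y: "LOG y = fps_const (to_fract a) * LOG x"
    "\<And>h. [:h:] dvd x \<Longrightarrow> [:h:] dvd y" "poly y 1 = ev a (poly x 1)"
    by blast
  have tf: "to_fract (pCons c a) = to_fract [:c:] + to_fract [:0, 1:] * to_fract a"
    by (simp flip: to_fract_mult to_fract_add)
  have "LOG (Polynomial.smult [:c:] x + act_t y) = fps_const (to_fract (pCons c a)) * LOG x"
    unfolding tf by (simp add: twisted_log_add twisted_log_smult LOG_act_t y algebra_simps
        flip: fps_const_add fps_const_mult)
  moreover have "poly (Polynomial.smult [:c:] x + act_t y) 1 = ev (pCons c a) (poly x 1)"
    by (simp add: ev_t y ev_pCons[of c a])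
  moreover have "[:h:] dvd Polynomial.smult [:c:] x + act_t y" if "[:h:] dvd x" for h
    using that by (intro dvd_add act_t_dvd y dvd_smult)
  ultimately show ?case by blast
qed

text \<open>
  \<open>y\<close> is the result of acting on \<open>x\<close> by \<open>f \<in> A[T]\<close> through \<open>\<phi>\<^sup>~\<close>. The logarithm turns this
  action into multiplication, and \<open>T = 1\<close> specializes it to the action of \<open>f(1)\<close> through \<open>\<phi>\<close>.
\<close>

lemma ex_act:
  "\<exists>y. LOG y = emb f * LOG x \<and> (\<forall>h. [:h:] dvd x \<longrightarrow> [:h:] dvd y) \<and>
       poly y 1 = ev (poly f 1) (poly x 1)"
proof (induction f)
  case 0
  show ?case by (intro exI[of _ 0]) auto
next
  case (pCons a f)
  then obtain y where y: "LOG y = emb f * LOG x"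
    "\<And>h. [:h:] dvd x \<Longrightarrow> [:h:] dvd y" "poly y 1 = ev (poly f 1) (poly x 1)"
    by blast
  obtain z where z: "LOG z = fps_const (to_fract a) * LOG x"
    "\<And>h. [:h:] dvd x \<Longrightarrow> [:h:] dvd z" "poly z 1 = ev a (poly x 1)"
    using ex_act_const by blast
  have "LOG (z + pCons 0 y) = emb (pCons a f) * LOG x"
    by (simp add: twisted_log_add twisted_log_shift emb_pCons y z algebra_simps)
  moreover have "poly (z + pCons 0 y) 1 = ev (poly (pCons a f) 1) (poly x 1)"
    by (simp add: y z ev_add_left)
  moreover have "[:h:] dvd z + pCons 0 y" if "[:h:] dvd x" for h
  proof -
    have "[:h:] dvd [:0, 1:] * y" using y(2) that by (intro dvd_mult)
    then show ?thesis using z(2) that by (intro dvd_add) auto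
  qed
  ultimately show ?case by blast
qed

end

section \<open>The local factors annihilate the reductions\<close>

text \<open>The polynomial \<open>char_poly\<close> over \<open>\<bbbF>[T]\<close> has
  \<open>t\<close> as its outer variable, whereas \<open>A[T]\<close> has \<open>T\<close> outside;
  this isomorphism mediates.\<close>

definition swap_vars :: "'a::comm_ring_1 poly poly \<Rightarrow> 'a poly poly" where
  "swap_vars F = (\<Sum>i\<le>degree F. map_poly (\<lambda>c. monom c i) (coeff F i))"

lemma coeff_swap_vars: "coeff (coeff (swap_vars F) n) i = coeff (coeff F i) n"
proof -
  have "coeff (coeff (swap_vars F) n) i = (\<Sum>k\<le>degree F. if k = i then coeff (coeff F i) n else 0)"
    by (auto simp: swap_vars_def coeff_sum coeff_map_poly intro!: sum.cong)
  then show ?thesis by (auto simp: coeff_eq_0)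
qed

lemma poly_poly_eqI: "(\<And>n i. coeff (coeff F n) i = coeff (coeff G n) i) \<Longrightarrow> F = G"
  by (simp add: poly_eq_iff)

lemma comm_ring_hom_swap_vars: "comm_ring_hom (swap_vars :: 'a::comm_ring_1 poly poly \<Rightarrow> _)"
proof
  fix F G :: "'a poly poly"
  show "swap_vars (F * G) = swap_vars F * swap_vars G"
    by (rule poly_poly_eqI) (simp add: coeff_swap_vars coeff_mult coeff_sum, rule sum.swap)
qed (auto intro!: poly_poly_eqI simp: coeff_swap_vars split: nat.splits simp: one_pCons coeff_pCons)

lemma eq_of_dvd_monic:
  fixes p x :: "'a::field poly"
  assumes "p dvd x" "lead_coeff p = 1" "degree x \<le> degree p" "coeff x (degree p) = 1"
  shows "x = p"
proof -
  obtain k where k: "x = p * k" using assms(1) by blast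
  have "x \<noteq> 0" using assms(4) by auto
  then have nz: "p \<noteq> 0" "k \<noteq> 0" using k by auto
  then have "degree k = 0" using assms(3) k by (simp add: degree_mult_eq)
  then obtain c where "k = [:c:]" by (auto elim: degree_eq_zeroE)
  with k assms show ?thesis by simp
qed

lemma sum_monoms_const: "degree c < d \<Longrightarrow> (\<Sum>i<d. [:coeff c i:] * monom 1 i) = (c :: 'a::comm_ring_1 poly)"
proof -
  assume "degree c < d"
  then obtain d' where "d = Suc d'" "degree c \<le> d'" by (cases d) auto
  then show ?thesis
    using poly_as_sum_of_monoms'[of c d'] by (simp add: lessThan_Suc_atMost smult_monom)
qed

context drinfeld
begin

text \<open>Frobenius fixes \<open>\<bbbF>\<close>, so on \<open>\<bbbF>[T]\<close> the twisted
  action is ordinary multiplication.\<close>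

lemma LOG_const_mult: "LOG (map_poly (\<lambda>c. [:c:]) U * x) = emb (map_poly (\<lambda>c. [:c:]) U) * LOG x"
proof (induction U)
  case (pCons c U)
  have U: "map_poly (\<lambda>c. [:c:]) (pCons c U) = pCons [:c:] (map_poly (\<lambda>c. [:c:]) U)"
    by (auto simp: poly_eq_iff coeff_map_poly coeff_pCons split: nat.splits)
  show ?case
    by (simp add: U twisted_log_add twisted_log_smult twisted_log_shift pCons.IH emb_pCons distrib_right mult.assoc)
qed auto

text \<open>Here the value type \<open>'f poly\<close> stands for \<open>\<bbbF>[T]\<close>: the
  variable is \<open>T\<close>, not \<open>t\<close>.\<close>

definition action_entry :: "'f poly \<Rightarrow> nat \<Rightarrow> nat \<Rightarrow> 'f poly" where
  "action_entry p i j = map_poly (\<lambda>c. coeff c i) (residue_T_action \<phi> p [:monom 1 j:])"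

lemma residue_T_action_eq: "residue_T_action \<phi> p x = map_poly (\<lambda>c. c mod p) (act_t x)"
  by (simp add: residue_T_action_def act_t_def)

lemma residue_char_det_eq:
  "residue_char_det \<phi> p = det (mat (degree p) (degree p) (\<lambda>(i, j).
     (if i = j then [:[:0, 1:]:] else 0) - map_poly (\<lambda>c. [:c:]) (action_entry p i j)))"
proof -
  have "map_poly (\<lambda>c. [:coeff c i:]) R = map_poly (\<lambda>c. [:c:]) (map_poly (\<lambda>c. coeff c i) R)"
    for R :: "'f poly poly" and i
    by (auto simp: poly_eq_iff coeff_map_poly)
  then show ?thesis
    unfolding residue_char_det_def action_entry_def by simp
qed

lemma residue_char_det_swap:
  "residue_char_det \<phi> p = swap_vars (char_poly (mat (degree p) (degree p) (\<lambda>(i, j). action_entry p i j)))"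
proof -
  interpret comm_ring_hom "swap_vars :: 'f poly poly \<Rightarrow> _" by (rule comm_ring_hom_swap_vars)
  have lin: "swap_vars ((if i = j then [:0, 1:] else 0) + [:- a:]) =
      (if i = j then [:[:0, 1 :: 'f:]:] else 0) - map_poly (\<lambda>c. [:c:]) a" for i j :: nat and a :: "'f poly"
    by (rule poly_poly_eqI) (auto simp: coeff_swap_vars coeff_map_poly coeff_pCons split: nat.splits)
  let ?M = "mat (degree p) (degree p) (\<lambda>(i, j). action_entry p i j)"
  have m: "mat (degree p) (degree p) (\<lambda>(i, j).
     (if i = j then [:[:0, 1:]:] else 0) - map_poly (\<lambda>c. [:c:]) (action_entry p i j)) =
     map_mat swap_vars (char_poly_matrix ?M)"
  proof (rule eq_matI)
    fix i j assume ij: "i < dim_row (map_mat swap_vars (char_poly_matrix ?M))"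
      "j < dim_col (map_mat swap_vars (char_poly_matrix ?M))"
    then have "char_poly_matrix ?M $$ (i, j) =
        (if i = j then [:0, 1:] else 0) + [:- action_entry p i j:]"
      by (auto simp: char_poly_matrix_def)
    then show "mat (degree p) (degree p) (\<lambda>(i, j).
       (if i = j then [:[:0, 1:]:] else 0) - map_poly (\<lambda>c. [:c:]) (action_entry p i j)) $$ (i, j) =
       map_mat swap_vars (char_poly_matrix ?M) $$ (i, j)"
      using ij lin[of i j] by (simp add: char_poly_matrix_def)
  qed (simp_all add: char_poly_matrix_def)
  show ?thesis
    unfolding residue_char_det_eq m char_poly_def by (rule hom_det)
qed

text \<open>In the variable \<open>t\<close> the determinant is a characteristic polynomial over
  \<open>\<bbbF>[T]\<close>, hence monic of degree \<open>degree p\<close>. Read off by powers of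
  \<open>T\<close>, this gives the local factors residue \<open>1\<close> at infinity.\<close>

lemma coeff_residue_char_det:
  "degree (coeff (residue_char_det \<phi> p) n) \<le> degree p"
  "coeff (coeff (residue_char_det \<phi> p) n) (degree p) = (if n = 0 then 1 else 0)"
proof -
  define X where "X = char_poly (mat (degree p) (degree p) (\<lambda>(i, j). action_entry p i j))"
  have X: "degree X = degree p" "coeff X (degree p) = 1"
    using degree_monic_char_poly[of "mat (degree p) (degree p) (\<lambda>(i, j). action_entry p i j)" "degree p"]
    by (auto simp: X_def)
  have c: "coeff (coeff (residue_char_det \<phi> p) n) i = coeff (coeff X i) n" for i
    by (simp add: residue_char_det_swap X_def coeff_swap_vars)
  show "degree (coeff (residue_char_det \<phi> p) n) \<le> degree p"
    by (rule degree_le) (use X in \<open>auto simp: c coeff_eq_0\<close>)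
  show "coeff (coeff (residue_char_det \<phi> p) n) (degree p) = (if n = 0 then 1 else 0)"
    by (simp add: c X)
qed

text \<open>
  Cayley--Hamilton, by the adjugate argument applied to the module \<open>K[[T]]\<close> modulo the
  logarithms of multiples of \<open>p\<close>.
\<close>

lemma char_det_annihilates:
  assumes "degree p > 0"
  shows "\<exists>y. [:p:] dvd y \<and> LOG y = emb (residue_char_det \<phi> p) * LOG 1"
proof -
  let ?d = "degree p"
  define C where "C = mat ?d ?d (\<lambda>(i, j).
     (if i = j then [:[:0, 1:]:] else 0) - map_poly (\<lambda>c. [:c:]) (action_entry p i j))"
  define Q where "Q = residue_char_det \<phi> p"
  define e where "e i = [:monom 1 i :: 'f poly:]" for i
  define z where "z j = act_t (e j) - residue_T_action \<phi> p (e j)" for j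
  have C: "C \<in> carrier_mat ?d ?d" by (simp add: C_def)
  have nz: "p \<noteq> 0" using assms by auto
  have z_dvd: "[:p:] dvd z j" for j
    by (simp add: const_poly_dvd_iff z_def residue_T_action_eq coeff_map_poly minus_mod_eq_mult_div)
  have res: "(\<Sum>i<?d. map_poly (\<lambda>c. [:c:]) (action_entry p i j) * e i) = residue_T_action \<phi> p (e j)"
    for j
  proof (rule poly_eqI)
    fix n
    let ?c = "coeff (residue_T_action \<phi> p (e j)) n"
    have "degree ?c < ?d"
      using degree_mod_less[of p "coeff (act_t (e j)) n"] nz assms
      by (auto simp: residue_T_action_eq coeff_map_poly)
    then show "coeff (\<Sum>i<?d. map_poly (\<lambda>c. [:c:]) (action_entry p i j) * e i) n = ?c"
      using sum_monoms_const[of ?c ?d]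
      by (simp add: coeff_sum e_def action_entry_def coeff_map_poly mult.commute)
  qed
  \<comment> \<open>Reduction modulo \<open>p\<close> changes \<open>act_t (e j)\<close> by
    \<open>z j\<close>, so each of these combinations of the \<open>LOG (e i)\<close> is the
    logarithm of a multiple of \<open>p\<close>.\<close>
  have row: "(\<Sum>i<?d. emb (C $$ (i, j)) * LOG (e i)) = LOG (z j)" if "j < ?d" for j
  proof -
    have "(\<Sum>i<?d. emb (C $$ (i, j)) * LOG (e i)) =
        (\<Sum>i<?d. (if i = j then fps_const (to_fract [:0, 1:]) * LOG (e i) else 0) -
                 LOG (map_poly (\<lambda>c. [:c:]) (action_entry p i j) * e i))"
      using that by (intro sum.cong) (auto simp: C_def emb_diff LOG_const_mult emb_const left_diff_distrib)
    also have "\<dots> = fps_const (to_fract [:0, 1:]) * LOG (e j) - LOG (residue_T_action \<phi> p (e j))"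
      using that by (simp add: sum_subtractf res flip: twisted_log_sum)
    finally show ?thesis by (simp add: z_def twisted_log_diff LOG_act_t)
  qed
  \<comment> \<open>Weighting the relations by column \<open>0\<close> of the adjugate isolates
    \<open>Q * LOG (e 0)\<close>, and \<open>e 0 = 1\<close>.\<close>
  have "\<exists>y. \<forall>j. LOG (y j) = emb (adj_mat C $$ (j, 0)) * LOG (z j) \<and> [:p:] dvd y j"
    using ex_act z_dvd by (intro choice) blast
  then obtain y where y: "\<And>j. LOG (y j) = emb (adj_mat C $$ (j, 0)) * LOG (z j)"
    "\<And>j. [:p:] dvd y j" by blast
  have entry: "(\<Sum>j<?d. C $$ (i, j) * adj_mat C $$ (j, 0)) = (if i = 0 then Q else 0)" if "i < ?d" for i
  proof -
    have "(C * adj_mat C) $$ (i, 0) = (\<Sum>j<?d. C $$ (i, j) * adj_mat C $$ (j, 0))"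
      using that assms C adj_mat(1)[OF C] by (simp add: scalar_prod_def atLeast0LessThan)
    moreover have "(C * adj_mat C) $$ (i, 0) = (if i = 0 then Q else 0)"
      using that assms by (simp add: adj_mat(2)[OF C] Q_def residue_char_det_eq flip: C_def)
    ultimately show ?thesis by simp
  qed
  have "LOG (\<Sum>j<?d. y j) = (\<Sum>j<?d. emb (adj_mat C $$ (j, 0)) * (\<Sum>i<?d. emb (C $$ (i, j)) * LOG (e i)))"
    by (simp add: twisted_log_sum y row)
  also have "\<dots> = (\<Sum>i<?d. emb (\<Sum>j<?d. C $$ (i, j) * adj_mat C $$ (j, 0)) * LOG (e i))"
    by (simp add: emb_sum emb_mult sum_distrib_left sum_distrib_right mult_ac) (rule sum.swap)
  also have "\<dots> = (\<Sum>i<?d. if i = 0 then emb Q * LOG (e i) else 0)"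
    by (intro sum.cong) (auto simp: entry)
  also have "\<dots> = emb Q * LOG 1"
    using assms by (simp add: e_def one_pCons)
  finally have "LOG (\<Sum>j<?d. y j) = emb Q * LOG 1" .
  moreover have "[:p:] dvd (\<Sum>j<?d. y j)" by (intro dvd_sum y)
  ultimately show ?thesis unfolding Q_def by blast
qed

text \<open>At \<open>T = 0\<close> the twisted model is multiplication by \<open>t\<close>, whose
  characteristic polynomial on \<open>A/p\<close> is \<open>p\<close>. Here divisibility by
  \<open>p\<close> comes from the annihilation, since the logarithm preserves the constant term in
  \<open>T\<close>; comparing monic polynomials of equal degree does the rest.\<close>

lemma coeff_0_residue_char_det:
  assumes "degree p > 0" "lead_coeff p = 1"
  shows "coeff (residue_char_det \<phi> p) 0 = p"
proof (rule eq_of_dvd_monic)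
  obtain y where y: "[:p:] dvd y" "LOG y = emb (residue_char_det \<phi> p) * LOG 1"
    using char_det_annihilates assms by blast
  have "to_fract (coeff y 0) = fps_nth (LOG y) 0" by (simp add: twisted_log_nth_0)
  also have "\<dots> = to_fract (coeff (residue_char_det \<phi> p) 0)"
    by (simp add: y twisted_log_nth_0)
  finally have "coeff y 0 = coeff (residue_char_det \<phi> p) 0" by simp
  then show "p dvd coeff (residue_char_det \<phi> p) 0"
    using y(1) by (metis const_poly_dvd_iff)
qed (use assms coeff_residue_char_det[of p 0] in auto)

end

section \<open>Values at infinity\<close>

text \<open>\<open>has_infty_value x c\<close> says that \<open>x\<close> is regular at the place \<open>\<infinity>\<close> of \<open>K\<close>, with residue \<open>c\<close>.\<close>

definition has_infty_value :: "'f::field poly fract \<Rightarrow> 'f \<Rightarrow> bool" where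
  "has_infty_value x c \<longleftrightarrow> (\<exists>a b. b \<noteq> 0 \<and> x = to_fract a / to_fract b \<and> degree a \<le> degree b \<and>
     coeff a (degree b) = c * lead_coeff b)"

text \<open>Coefficients at degree bounds, which may vanish, are multiplicative; leading
  coefficients would force case distinctions.\<close>

lemma coeff_mult_le:
  assumes "degree a \<le> m" "degree b \<le> n"
  shows "coeff (a * b) (m + n) = coeff a m * coeff (b :: 'a::comm_ring_1 poly) n"
proof -
  have "coeff (a * b) (m + n) = (\<Sum>i\<le>m + n. coeff a i * coeff b (m + n - i))"
    by (rule coeff_mult)
  also have "\<dots> = (\<Sum>i\<in>{m}. coeff a i * coeff b (m + n - i))"
  proof (intro sum.mono_neutral_right ballI)
    fix i assume "i \<in> {..m + n} - {m}"
    then have "i > m \<or> m + n - i > n" by auto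
    then show "coeff a i * coeff b (m + n - i) = 0"
      using assms by (auto simp: coeff_eq_0)
  qed auto
  finally show ?thesis by simp
qed

lemma coeff_power_le:
  assumes "degree a \<le> m"
  shows "degree (a ^ k) \<le> k * m \<and> coeff (a ^ k) (k * m) = coeff (a :: 'a::comm_ring_1 poly) m ^ k"
proof (induction k)
  case (Suc k)
  have "degree (a * a ^ k) \<le> m + k * m"
    using assms Suc degree_mult_le[of a "a ^ k"] by simp
  then show ?case
    using coeff_mult_le[of a m "a ^ k" "k * m"] assms Suc by simp
qed simp

lemma has_infty_value_add:
  assumes "has_infty_value x c" "has_infty_value y d"
  shows "has_infty_value (x + y) (c + d)"
proof -
  obtain a b where 1: "b \<noteq> 0" "x = to_fract a / to_fract b" "degree a \<le> degree b"
     "coeff a (degree b) = c * lead_coeff b"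
    using assms(1) by (auto simp: has_infty_value_def)
  obtain a' b' where 2: "b' \<noteq> 0" "y = to_fract a' / to_fract b'" "degree a' \<le> degree b'"
     "coeff a' (degree b') = d * lead_coeff b'"
    using assms(2) by (auto simp: has_infty_value_def)
  have d: "degree (b * b') = degree b + degree b'" using 1 2 by (simp add: degree_mult_eq)
  have "x + y = to_fract (a * b' + b * a') / to_fract (b * b')"
    using 1 2 by (simp add: field_simps)
  moreover have "degree (a * b' + b * a') \<le> degree b + degree b'"
    using 1 2 degree_mult_le[of a b'] degree_mult_le[of b a'] by (intro degree_add_le) auto
  moreover have "coeff (a * b' + b * a') (degree b + degree b') = (c + d) * lead_coeff (b * b')"
    using coeff_mult_le[OF 1(3) order.refl[of "degree b'"]] coeff_mult_le[OF order.refl[of "degree b"] 2(3)]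
    by (simp add: 1(4) 2(4) lead_coeff_mult distrib_right distrib_left mult_ac)
  ultimately show ?thesis
    unfolding has_infty_value_def using 1(1) 2(1) d by (intro exI[of _ "a * b' + b * a'"] exI[of _ "b * b'"]) auto
qed

lemma has_infty_value_mult:
  assumes "has_infty_value x c" "has_infty_value y d"
  shows "has_infty_value (x * y) (c * d)"
proof -
  obtain a b where 1: "b \<noteq> 0" "x = to_fract a / to_fract b" "degree a \<le> degree b"
     "coeff a (degree b) = c * lead_coeff b"
    using assms(1) by (auto simp: has_infty_value_def)
  obtain a' b' where 2: "b' \<noteq> 0" "y = to_fract a' / to_fract b'" "degree a' \<le> degree b'"
     "coeff a' (degree b') = d * lead_coeff b'"
    using assms(2) by (auto simp: has_infty_value_def)
  have d: "degree (b * b') = degree b + degree b'" using 1 2 by (simp add: degree_mult_eq)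
  have "x * y = to_fract (a * a') / to_fract (b * b')"
    by (simp add: 1(2) 2(2))
  moreover have "degree (a * a') \<le> degree b + degree b'"
    using 1 2 degree_mult_le[of a a'] by auto
  moreover have "coeff (a * a') (degree b + degree b') = (c * d) * lead_coeff (b * b')"
    using coeff_mult_le[OF 1(3) 2(3)] by (simp add: 1(4) 2(4) lead_coeff_mult mult_ac)
  ultimately show ?thesis
    unfolding has_infty_value_def using 1(1) 2(1) d by (intro exI[of _ "a * a'"] exI[of _ "b * b'"]) auto
qed

lemma has_infty_value_const: "has_infty_value (to_fract [:c:]) c"
  unfolding has_infty_value_def by (intro exI[of _ "[:c:]"] exI[of _ 1]) auto

lemma has_infty_value_0: "has_infty_value 0 0" and has_infty_value_1: "has_infty_value 1 1"
  using has_infty_value_const[of 0] has_infty_value_const[of 1] by (simp_all flip: one_pCons)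

lemma has_infty_value_sum:
  "(\<And>i. i \<in> I \<Longrightarrow> has_infty_value (f i) (c i)) \<Longrightarrow> has_infty_value (sum f I) (sum c I)"
  by (induction I rule: infinite_finite_induct) (auto simp: has_infty_value_0 has_infty_value_add)

lemma has_infty_value_polyD:
  assumes "has_infty_value (to_fract a) c" shows "a = [:c:]"
proof -
  obtain x y where *: "y \<noteq> 0" "to_fract a = to_fract x / to_fract y" "degree x \<le> degree y"
     "coeff x (degree y) = c * lead_coeff y"
    using assms by (auto simp: has_infty_value_def)
  then have "to_fract (a * y) = to_fract x" by simp
  then have x: "x = a * y" by (simp only: to_fract_eq_iff)
  have "degree a = 0"
    using * x by (cases "a = 0") (auto simp: degree_mult_eq)
  then obtain e where "a = [:e:]" by (auto elim: degree_eq_zeroE)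
  then show ?thesis using * x by auto
qed

section \<open>Residues at infinity of power series\<close>

definition fps_infty_value :: "'f::field poly fract fps \<Rightarrow> 'f fps \<Rightarrow> bool" where
  "fps_infty_value F f \<longleftrightarrow> (\<forall>n. has_infty_value (fps_nth F n) (fps_nth f n))"

lemma fps_infty_value_mult:
  "fps_infty_value F f \<Longrightarrow> fps_infty_value G g \<Longrightarrow> fps_infty_value (F * G) (f * g)"
  by (auto simp: fps_infty_value_def fps_mult_nth intro!: has_infty_value_sum has_infty_value_mult)

lemma fps_infty_value_1: "fps_infty_value 1 1"
  by (auto simp: fps_infty_value_def has_infty_value_0 has_infty_value_1)

lemma fps_infty_value_prod_1:
  "(\<And>i. i \<in> I \<Longrightarrow> fps_infty_value (F i) 1) \<Longrightarrow> fps_infty_value (prod F I) 1"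
proof (induction I rule: infinite_finite_induct)
  case (insert i I)
  then show ?case using fps_infty_value_mult[of "F i" 1 "prod F I" 1] by simp
qed (auto simp: fps_infty_value_1)

text \<open>Every quotient in the recursion for \<open>l_n\<close> is regular at infinity by
  smallness, and its residue turns the recursion into the one for the coefficients of the inverse
  series of \<open>u\<close>.\<close>

lemma log_coeff_infty_value:
  fixes g :: "nat \<Rightarrow> 'f::finite_field poly"
  assumes small: "\<And>i. i > 0 \<Longrightarrow> degree (g i) \<le> CARD('f) ^ i"
    and u: "\<And>i. i > 0 \<Longrightarrow> fps_nth u i = coeff (g i) (CARD('f) ^ i)" "fps_nth u 0 = 1"
  shows "has_infty_value (log_coeff g n) (fps_nth (inverse u) n)"
proof (induction n rule: less_induct)
  case (less n)
  show ?case
  proof (cases "n = 0")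
    case True
    then show ?thesis by (simp add: has_infty_value_1 u)
  next
    case False
    let ?q = "CARD('f)"
    \<comment> \<open>The sign comes from the top coefficient \<open>-1\<close> of the bracket. The
      top coefficient of \<open>g (n - i)\<close> lies in \<open>\<bbbF>\<close>, so the power
      \<open>q^i\<close> leaves it unchanged.\<close>
    have quot: "has_infty_value (to_fract ((frob ^^ i) (g (n - i))) / to_fract (carlitz_bracket n))
        (- fps_nth u (n - i))" if "i < n" for i
    proof -
      have qn: "?q ^ i * ?q ^ (n - i) = ?q ^ n"
        using that by (simp flip: power_add)
      have "degree ((frob ^^ i) (g (n - i))) \<le> ?q ^ n"
        "coeff ((frob ^^ i) (g (n - i))) (?q ^ n) = coeff (g (n - i)) (?q ^ (n - i))"
        using coeff_power_le[OF small[of "n - i"], of "?q ^ i"] that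
        by (simp_all add: frob_funpow qn finite_field_power_card_power_eq_same)
      then show ?thesis
        unfolding has_infty_value_def
        using False that carlitz_bracket_nz[of n, where 'f = 'f] carlitz_bracket_coeffs[of n, where 'f = 'f]
        by (intro exI[of _ "(frob ^^ i) (g (n - i))"] exI[of _ "carlitz_bracket n"])
           (simp_all add: u(1))
    qed
    have "log_coeff g n = (\<Sum>i<n. log_coeff g i *
        (to_fract ((frob ^^ i) (g (n - i))) / to_fract (carlitz_bracket n)))"
      using False by (subst log_coeff.simps) (simp add: sum_divide_distrib)
    moreover have "has_infty_value \<dots> (\<Sum>i<n. fps_nth (inverse u) i * (- fps_nth u (n - i)))"
      using less quot by (intro has_infty_value_sum has_infty_value_mult) auto
    moreover have "(\<Sum>i<n. fps_nth (inverse u) i * (- fps_nth u (n - i))) = fps_nth (inverse u) n"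
    proof -
      have "0 = fps_nth (inverse u * u) n"
        using False u by (simp add: inverse_mult_eq_1)
      also have "\<dots> = (\<Sum>i<n. fps_nth (inverse u) i * fps_nth u (n - i)) + fps_nth (inverse u) n"
        by (simp add: fps_mult_nth atLeast0AtMost u flip: lessThan_Suc_atMost)
      finally show ?thesis by (simp add: sum_negf neg_eq_iff_add_eq_0)
    qed
    ultimately show ?thesis by simp
  qed
qed

section \<open>Places\<close>

lemma place_prime: "place p \<Longrightarrow> prime_elem p"
  by (simp add: place_def field_poly_irreducible_imp_prime)

lemma place_degree_pos: "place p \<Longrightarrow> degree p > 0"
proof (rule ccontr)
  assume p: "place p" "\<not> degree p > 0"
  then have "p = 1" by (auto simp: place_def elim!: degree_eq_zeroE)
  with p show False by (simp add: place_def)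
qed

lemma place_nz: "place p \<Longrightarrow> p \<noteq> 0"
  using place_degree_pos by force

lemma place_dvd_place:
  assumes "place p" "place p'" "p dvd p'"
  shows "p = p'"
proof -
  obtain k where k: "p' = p * k" using assms by blast
  have "\<not> p dvd 1" using assms(1) by (auto simp: place_def irreducible_def)
  then have "k dvd 1" using assms k by (auto simp: place_def dest: irreducibleD)
  then have "degree k = 0" by (simp add: poly_dvd_1)
  then obtain c where c: "k = [:c:]" by (auto elim: degree_eq_zeroE)
  have "lead_coeff p' = lead_coeff p * c" by (simp add: k c lead_coeff_mult)
  then have "c = 1" using assms(1,2) by (simp add: place_def)
  then show ?thesis by (simp add: k c)
qed

lemma ex_place_dvd:
  assumes "degree (f :: 'f::finite_field poly) > 0"
  shows "\<exists>p. place p \<and> p dvd f"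
proof -
  obtain p k where "irreducible p" "f = p * k" "lead_coeff p = 1"
    using irreducible_monic_factor[OF assms] by blast
  then show ?thesis unfolding place_def by (intro exI[of _ p]) simp
qed

lemma place_dvd_prod:
  assumes "place p" "finite S" "\<And>p'. p' \<in> S \<Longrightarrow> place p'" "p dvd \<Prod>S"
  shows "p \<in> S"
  using assms(2-4)
proof (induction S)
  case empty
  then have "p dvd 1" by simp
  then show ?case using place_prime[OF assms(1)] unfolding prime_elem_def by blast
next
  case (insert p' S)
  then have "p dvd p' \<or> p dvd \<Prod>S"
    using place_prime[OF assms(1)] by (simp add: prime_elem_dvd_mult_iff)
  then show ?case using insert place_dvd_place[OF assms(1), of p'] by auto
qed

lemma prod_places_dvd:
  assumes "finite S" "\<And>p. p \<in> S \<Longrightarrow> place p" "\<And>p. p \<in> S \<Longrightarrow> p dvd x"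
  shows "\<Prod>S dvd (x :: 'f::finite_field poly)"
  using assms
proof (induction S)
  case (insert p S)
  then have "\<Prod>S dvd x" by auto
  then obtain k where k: "x = \<Prod>S * k" by blast
  have "\<not> p dvd \<Prod>S" using place_dvd_prod[of p S] insert by auto
  then have "p dvd k"
    using insert.prems(2)[of p] k place_prime[OF insert.prems(1)[of p]] by (auto simp: prime_elem_dvd_mult_iff)
  then show ?case using insert.hyps by (auto simp: k mult.commute intro: mult_dvd_mono)
qed auto

text \<open>Serves to show that a bracket divides \<open>\<Prod>S\<close> once \<open>S\<close>
  contains its prime factors.\<close>

lemma squarefree_dvd_prod:
  assumes "finite S" "f \<noteq> 0"
    and "\<And>p. place p \<Longrightarrow> p dvd f \<Longrightarrow> p \<in> S \<and> \<not> p * p dvd f"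
  shows "(f :: 'f::finite_field poly) dvd \<Prod>S"
  using assms
proof (induction "degree f" arbitrary: f S rule: less_induct)
  case less
  show ?case
  proof (cases "degree f = 0")
    case True
    then have "f dvd 1" using less by (auto simp: is_unit_iff_degree)
    then show ?thesis by (meson dvd_trans one_dvd)
  next
    case False
    then obtain p where p: "place p" "p dvd f" using ex_place_dvd by blast
    then obtain k where k: "f = p * k" by blast
    have "p dvd k \<Longrightarrow> p * p dvd f" unfolding k by (rule mult_dvd_mono) auto
    then have pS: "p \<in> S" and pk: "\<not> p dvd k" using less(4)[OF p] by auto
    have "k \<noteq> 0" using less k by auto
    then have "degree k < degree f"
      using place_degree_pos[OF p(1)] place_nz[OF p(1)] k by (simp add: degree_mult_eq)
    moreover have "s \<in> S - {p} \<and> \<not> s * s dvd k" if s: "place s" "s dvd k" for s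
    proof -
      have "s dvd f" "s * s dvd k \<Longrightarrow> s * s dvd f" using s k by auto
      then show ?thesis using less(4)[of s] s pk by auto
    qed
    ultimately have "k dvd \<Prod>(S - {p})" using less(1,2) \<open>k \<noteq> 0\<close> by auto
    then show ?thesis using pS less(2) by (auto simp: k prod.remove intro: mult_dvd_mono)
  qed
qed

text \<open>Translation by \<open>1\<close> permutes the field, so the sum of all elements is
  unchanged although \<open>q\<close> ones are added to it.\<close>

lemma of_nat_card_field: "of_nat CARD('f) = (0 :: 'f::finite_field)"
proof -
  have "(\<Sum>c\<in>UNIV. c) = (\<Sum>c\<in>UNIV. c + (1 :: 'f))"
    by (rule sum.reindex_bij_witness[of _ "\<lambda>c. c + 1" "\<lambda>c. c - 1"]) auto
  then show ?thesis by (simp add: sum.distrib)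
qed

text \<open>The derivative of \<open>t - t^(q^n)\<close> is \<open>1\<close>, because
  \<open>q = 0\<close> in \<open>\<bbbF>\<close>, and a double factor would divide it.\<close>

lemma carlitz_bracket_squarefree:
  assumes "place p" "n > 0"
  shows "\<not> p * p dvd (carlitz_bracket n :: 'f::finite_field poly)"
proof
  assume "p * p dvd carlitz_bracket n"
  then obtain k where k: "carlitz_bracket n = p * p * k" by blast
  have "pderiv (carlitz_bracket n :: 'f poly) = 1"
    using assms by (simp add: pderiv_diff pderiv_power pderiv_pCons of_nat_card_field power_0_left one_pCons)
  moreover have "p dvd pderiv (p * p * k)"
    by (simp add: pderiv_mult algebra_simps)
  ultimately have "p dvd 1" by (simp flip: k)
  then show False using place_prime[OF assms(1)] unfolding prime_elem_def by blast
qed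

section \<open>The class formula\<close>

abbreviation emb_const :: "'f::finite_field poly \<Rightarrow> 'f poly fract fps" where
  "emb_const U \<equiv> emb (map_poly (\<lambda>c. [:c:]) U)"

definition integral_fract :: "'a::idom fract \<Rightarrow> bool" where
  "integral_fract x \<longleftrightarrow> x \<in> range to_fract"

lemma integral_fract_to_fract [simp]: "integral_fract (to_fract a)"
  by (simp add: integral_fract_def)

lemma integral_fract_mult: "integral_fract x \<Longrightarrow> integral_fract y \<Longrightarrow> integral_fract (x * y)"
  unfolding integral_fract_def by (metis (no_types, lifting) image_iff UNIV_I to_fract_mult)

lemma integral_fract_sum: "(\<And>i. i \<in> I \<Longrightarrow> integral_fract (f i)) \<Longrightarrow> integral_fract (sum f I)"
proof (induction I rule: infinite_finite_induct)
  case (insert i I)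
  then have "integral_fract (f i)" "integral_fract (sum f I)" by auto
  then obtain a b where "f i = to_fract a" "sum f I = to_fract b"
    unfolding integral_fract_def by blast
  then show ?case using insert by (simp flip: to_fract_add)
qed (auto simp: integral_fract_def intro: range_eqI[of _ _ 0])

lemma to_fract_power: "to_fract (a ^ n) = to_fract a ^ n"
  by (induction n) simp_all

text \<open>Each step of the recursion divides by one bracket, so \<open>n\<close> factors
  \<open>h\<close> clear the denominator of \<open>l_n\<close>.\<close>

lemma log_coeff_integral:
  assumes "\<And>k. 0 < k \<Longrightarrow> k \<le> N \<Longrightarrow> carlitz_bracket k dvd h" and "n \<le> N"
  shows "integral_fract (log_coeff g n * to_fract h ^ n)"
  using assms(2)
proof (induction n rule: less_induct)
  case (less n)
  show ?case
  proof (cases "n = 0")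
    case True
    then show ?thesis using integral_fract_to_fract[of 1] by simp
  next
    case False
    then obtain k where k: "h = carlitz_bracket n * k"
      using assms(1)[of n] less by auto
    have b: "to_fract (carlitz_bracket n :: 'a poly) \<noteq> 0"
      using carlitz_bracket_nz[of n, where 'f = 'a] False by simp
    have "log_coeff g n * to_fract h ^ n =
      (\<Sum>i<n. log_coeff g i * to_fract ((frob ^^ i) (g (n - i)))) / to_fract (carlitz_bracket n) *
      (to_fract h ^ (n - 1) * to_fract h)"
      using False by (subst log_coeff.simps) (simp flip: power_Suc2)
    also have "\<dots> = (\<Sum>i<n. log_coeff g i * to_fract ((frob ^^ i) (g (n - i)))) *
       to_fract h ^ (n - 1) * (to_fract (carlitz_bracket n * k) / to_fract (carlitz_bracket n))"
      by (simp flip: k)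
    also have "to_fract (carlitz_bracket n * k) / to_fract (carlitz_bracket n) = to_fract k"
      using b by simp
    \<comment> \<open>Of the \<open>n\<close> factors, one has cancelled the bracket,
      \<open>i\<close> go to \<open>l_i\<close>, and \<open>n - 1 - i\<close> are left over.\<close>
    also have "(\<Sum>i<n. log_coeff g i * to_fract ((frob ^^ i) (g (n - i)))) *
       to_fract h ^ (n - 1) * to_fract k =
       (\<Sum>i<n. (log_coeff g i * to_fract h ^ i) *
         to_fract ((frob ^^ i) (g (n - i)) * h ^ (n - 1 - i) * k))"
    proof -
      have "to_fract h ^ (n - 1) = to_fract h ^ i * to_fract h ^ (n - 1 - i)" if "i < n" for i
        using that by (simp flip: power_add)
      then show ?thesis
        unfolding sum_distrib_right by (intro sum.cong refl) (simp add: to_fract_power mult_ac)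
    qed
    finally have "log_coeff g n * to_fract h ^ n = (\<Sum>i<n. (log_coeff g i * to_fract h ^ i) *
         to_fract ((frob ^^ i) (g (n - i)) * h ^ (n - 1 - i) * k))" .
    then show ?thesis
      using less by (simp only:) (intro integral_fract_sum integral_fract_mult[OF less.IH integral_fract_to_fract], auto)
  qed
qed

text \<open>On a multiple of \<open>h\<close> the term of index \<open>m\<close> carries
  \<open>h^(q^m)\<close>, and \<open>q^m \<ge> m + 1\<close> provides \<open>m\<close> factors for
  the denominator of \<open>l_m\<close> and one for the division by \<open>h\<close>.\<close>

lemma twisted_log_nth_integral:
  fixes h :: "'f::finite_field poly"
  assumes "\<And>k. 0 < k \<Longrightarrow> k \<le> N \<Longrightarrow> carlitz_bracket k dvd h" and "n \<le> N" and "[:h:] dvd y" and "h \<noteq> 0"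
  shows "integral_fract (fps_nth (twisted_log g y) n / to_fract h)"
proof -
  obtain w where w: "y = Polynomial.smult h w" using assms(3) by auto
  have "fps_nth (twisted_log g y) n / to_fract h =
     (\<Sum>m\<le>n. log_coeff g m * to_fract h ^ m * to_fract (h ^ (CARD('f) ^ m - 1 - m) * (frob ^^ m) (coeff w (n - m))))"
    unfolding twisted_log_nth sum_divide_distrib
  proof (intro sum.cong refl)
    fix m
    have "m < CARD('f) ^ m"
      using card_field_ge_2[where 'f = 'f] by (intro power_gt_expt) auto
    then have "CARD('f) ^ m = 1 + m + (CARD('f) ^ m - 1 - m)" by simp
    then have "(frob ^^ m) h = h * h ^ m * h ^ (CARD('f) ^ m - 1 - m)"
      unfolding frob_funpow by (metis power_add power_one_right)
    then show "log_coeff g m * to_fract ((frob ^^ m) (coeff y (n - m))) / to_fract h =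
       log_coeff g m * to_fract h ^ m * to_fract (h ^ (CARD('f) ^ m - 1 - m) * (frob ^^ m) (coeff w (n - m)))"
      using assms(4) by (simp add: w frob_pow_mult to_fract_power)
  qed
  then show ?thesis
    using assms(2)
    by (simp only:) (intro integral_fract_sum
        integral_fract_mult[OF log_coeff_integral[OF assms(1)] integral_fract_to_fract], auto)
qed

context drinfeld
begin

text \<open>
  For a small model this is the ratio of the \<open>L\<close>-series to the logarithm of \<open>1\<close>; its zero at
  \<open>T = 1\<close> is responsible for the zeros of the local \<open>L\<close>-series in part (2).
\<close>

definition u_poly :: "'f poly" where
  "u_poly = 1 + (\<Sum>i\<in>{1..r}. monom (coeff (g i) (CARD('f) ^ i)) i)"

lemma coeff_u_poly: "coeff u_poly i = (if i = 0 then 1 else coeff (g i) (CARD('f) ^ i))"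
proof -
  have "g i = 0" if "i > r"
    using that model by (intro coeff_eq_0) (simp add: drinfeld_model_def)
  then show ?thesis
    by (auto simp: u_poly_def coeff_sum coeff_1)
qed

lemma local_factor_eq: "local_factor \<phi> p = fps_const (inverse (to_fract p)) * emb (residue_char_det \<phi> p)"
  by (simp add: local_factor_def emb_def)

lemma local_factor_infty:
  assumes "place p" shows "fps_infty_value (local_factor \<phi> p) 1"
  unfolding fps_infty_value_def
proof
  fix n
  show "has_infty_value (fps_nth (local_factor \<phi> p) n) (fps_nth 1 n)"
    unfolding has_infty_value_def
    using place_nz[OF assms] assms coeff_residue_char_det[of p n]
    by (intro exI[of _ "coeff (residue_char_det \<phi> p) n"] exI[of _ p])
       (auto simp: local_factor_eq place_def divide_inverse mult.commute)
qed

lemma local_factor_nth_0: "place p \<Longrightarrow> fps_nth (local_factor \<phi> p) 0 = 1"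
  using coeff_0_residue_char_det[of p] place_degree_pos[of p] place_nz[of p]
  by (simp add: local_factor_eq place_def)

text \<open>For each \<open>p\<close> in \<open>S\<close>, \<open>y\<close> arises by letting the
  other determinants act on the multiple of \<open>p\<close> furnished by Cayley--Hamilton;
  injectivity of the logarithm identifies the two. Divisibility by distinct places then
  combines.\<close>

lemma prod_annihilates:
  assumes "finite S" "\<And>p. p \<in> S \<Longrightarrow> place p"
  shows "\<exists>y. [:\<Prod>S:] dvd y \<and> LOG y = emb (\<Prod>p\<in>S. residue_char_det \<phi> p) * LOG 1"
proof -
  obtain y where y: "LOG y = emb (\<Prod>p\<in>S. residue_char_det \<phi> p) * LOG 1"
    using ex_act[of "\<Prod>p\<in>S. residue_char_det \<phi> p" 1] by blast
  have "[:p:] dvd y" if pS: "p \<in> S" for p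
  proof -
    obtain z where z: "[:p:] dvd z" "LOG z = emb (residue_char_det \<phi> p) * LOG 1"
      using char_det_annihilates[OF place_degree_pos[OF assms(2)[OF pS]]] by blast
    obtain x where x: "LOG x = emb (\<Prod>p\<in>S - {p}. residue_char_det \<phi> p) * LOG z" "[:p:] dvd x"
      using ex_act[of "\<Prod>p\<in>S - {p}. residue_char_det \<phi> p" z] z(1) by blast
    have "LOG x = LOG y"
      using pS assms(1) by (simp add: x y z prod.remove emb_mult mult_ac)
    then have "x = y" by (rule twisted_log_inj)
    then show ?thesis using x(2) by simp
  qed
  then have "\<Prod>S dvd coeff y n" for n
    using assms by (intro prod_places_dvd) (auto simp: const_poly_dvd_iff)
  then have "[:\<Prod>S:] dvd y"
    by (simp add: const_poly_dvd_iff)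
  then show ?thesis using y by blast
qed

text \<open>The places that can divide denominators of \<open>l_n\<close> for
  \<open>n \<le> N\<close>; finiteness makes them available in all large finite subproducts of the
  Euler product.\<close>

definition bracket_places :: "nat \<Rightarrow> 'f poly set" where
  "bracket_places N = {p. place p \<and> (\<exists>k\<in>{1..N}. p dvd carlitz_bracket k)}"

lemma finite_bracket_places: "finite (bracket_places N)"
proof (rule finite_subset)
  show "bracket_places N \<subseteq> {p. degree p \<le> CARD('f) ^ N}"
  proof safe
    fix p :: "'f poly" assume "p \<in> bracket_places N"
    then obtain k where k: "k \<in> {1..N}" "p dvd carlitz_bracket k" by (auto simp: bracket_places_def)
    then have "degree p \<le> CARD('f) ^ k"
      using dvd_imp_degree_le[OF k(2)] carlitz_bracket_nz[of k, where 'f = 'f]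
        carlitz_bracket_coeffs(1)[of k, where 'f = 'f] by auto
    also have "\<dots> \<le> CARD('f) ^ N"
      using k card_field_ge_2[where 'f = 'f] by (intro power_increasing) auto
    finally show "degree p \<le> CARD('f) ^ N" .
  qed
  have "{p :: 'f poly. degree p \<le> CARD('f) ^ N} \<subseteq>
      Poly ` {xs. set xs \<subseteq> UNIV \<and> length xs \<le> Suc (CARD('f) ^ N)}"
  proof safe
    fix p :: "'f poly" assume "degree p \<le> CARD('f) ^ N"
    then have "length (coeffs p) \<le> Suc (CARD('f) ^ N)"
      by (auto simp: length_coeffs_degree coeffs_def)
    then show "p \<in> Poly ` {xs. set xs \<subseteq> UNIV \<and> length xs \<le> Suc (CARD('f) ^ N)}"
      by (intro image_eqI[of _ _ "coeffs p"]) auto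
  qed
  then show "finite {p :: 'f poly. degree p \<le> CARD('f) ^ N}"
    by (rule finite_subset) (rule finite_imageI, rule finite_lists_length_le, rule finite)
qed

text \<open>
  Up to degree \<open>N\<close> in \<open>T\<close>, the coefficients on the left are integral: the denominators of the
  logarithm are products of brackets, which divide \<open>\<Prod>S\<close>. Being regular at \<open>\<infinity>\<close> as well, they
  are constants, equal to their residues there.
\<close>

lemma prod_local_factor_nth:
  assumes small: "small_model r \<phi>"
    and S: "finite S" "\<And>p. p \<in> S \<Longrightarrow> place p" "bracket_places N \<subseteq> S" and n: "n \<le> N"
  shows "fps_nth ((\<Prod>p\<in>S. local_factor \<phi> p) * LOG 1) n =
    to_fract [:fps_nth (inverse (fps_of_poly u_poly)) n:]"
proof -
  define h where "h = \<Prod>S"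
  have h0: "h \<noteq> 0" using S place_nz by (auto simp: h_def)
  have dvd: "carlitz_bracket k dvd h" if "0 < k" "k \<le> N" for k
    unfolding h_def
  proof (rule squarefree_dvd_prod[OF S(1)])
    show "carlitz_bracket k \<noteq> 0" using carlitz_bracket_nz that by blast
    fix p :: "'f poly" assume p: "place p" "p dvd carlitz_bracket k"
    then have "p \<in> bracket_places N" unfolding bracket_places_def using that by auto
    then show "p \<in> S \<and> \<not> p * p dvd carlitz_bracket k"
      using S(3) carlitz_bracket_squarefree[OF p(1) that(1)] by auto
  qed
  obtain y where y: "[:h:] dvd y" "LOG y = emb (\<Prod>p\<in>S. residue_char_det \<phi> p) * LOG 1"
    using prod_annihilates[OF S(1,2)] unfolding h_def by blast
  have "(\<Prod>p\<in>S. fps_const (inverse (to_fract p))) = fps_const (inverse (to_fract h))"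
    unfolding h_def using S(1) by (induction S rule: finite_induct) auto
  then have prod: "(\<Prod>p\<in>S. local_factor \<phi> p) * LOG 1 = fps_const (inverse (to_fract h)) * LOG y"
    by (simp add: local_factor_eq prod.distrib y emb_prod mult.assoc)
  have "integral_fract (fps_nth (LOG y) n / to_fract h)"
    using dvd n y(1) h0 by (rule twisted_log_nth_integral)
  then obtain a where a: "fps_nth ((\<Prod>p\<in>S. local_factor \<phi> p) * LOG 1) n = to_fract a"
    unfolding prod by (auto simp: integral_fract_def divide_inverse mult.commute)
  have log_1: "LOG 1 = Abs_fps (log_coeff g)"
  proof (rule fps_ext)
    fix m
    have "fps_nth (LOG 1) m = (\<Sum>i\<in>{m}. log_coeff g i * to_fract ((frob ^^ i) (coeff 1 (m - i))))"
      unfolding twisted_log_nth by (intro sum.mono_neutral_right) (auto simp: coeff_1)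
    then show "fps_nth (LOG 1) m = fps_nth (Abs_fps (log_coeff g)) m"
      by (simp add: frob_funpow)
  qed
  have "fps_infty_value (LOG 1) (inverse (fps_of_poly u_poly))"
    unfolding fps_infty_value_def log_1
  proof
    fix m
    have gi: "degree (g i) \<le> CARD('f) ^ i" if "i > 0" for i
    proof (cases "i \<le> r")
      case True
      then show ?thesis using small that by (simp add: small_model_def)
    next
      case False
      then have "g i = 0" using model by (intro coeff_eq_0) (simp add: drinfeld_model_def)
      then show ?thesis by simp
    qed
    show "has_infty_value (fps_nth (Abs_fps (log_coeff g)) m) (fps_nth (inverse (fps_of_poly u_poly)) m)"
      using log_coeff_infty_value[of g "fps_of_poly u_poly" m, OF gi] by (simp add: coeff_u_poly)
  qed
  moreover have "fps_infty_value (\<Prod>p\<in>S. local_factor \<phi> p) 1"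
    using S by (intro fps_infty_value_prod_1 local_factor_infty)
  ultimately have "fps_infty_value ((\<Prod>p\<in>S. local_factor \<phi> p) * LOG 1) (1 * inverse (fps_of_poly u_poly))"
    by (intro fps_infty_value_mult)
  then have "has_infty_value (to_fract a) (fps_nth (inverse (fps_of_poly u_poly)) n)"
    unfolding fps_infty_value_def by (simp flip: a)
  then have "a = [:fps_nth (inverse (fps_of_poly u_poly)) n:]" by (rule has_infty_value_polyD)
  then show ?thesis using a by simp
qed

lemma emb_const_nth: "fps_nth (emb_const U) n = to_fract [:coeff U n:]"
  by (simp add: coeff_map_poly)

text \<open>If \<open>S\<close> contains the bracket places for \<open>n\<close>, the product
  \<open>P\<close> of its local factors satisfies \<open>P log(1) = 1/u\<close> up to degree
  \<open>n\<close>. Hence \<open>1/P\<close> and \<open>u log(1)\<close> agree there, which is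
  \<open>T\<close>-adic convergence.\<close>

theorem L_series_eq:
  assumes small: "small_model r \<phi>"
  shows "L_series \<phi> = emb_const u_poly * LOG 1"
proof -
  let ?W = "emb_const u_poly * LOG 1"
  let ?F = "finite_subsets_at_top {p. place p} :: 'f poly set filter"
  have agree: "fps_nth (\<Prod>p\<in>S. inverse (local_factor \<phi> p)) n = fps_nth ?W n"
    if S: "finite S" "S \<subseteq> {p. place p}" "bracket_places n \<subseteq> S" for S n
  proof -
    let ?P = "\<Prod>p\<in>S. local_factor \<phi> p" and ?I = "\<Prod>p\<in>S. inverse (local_factor \<phi> p)"
    have one: "?I * ?P = 1"
    proof -
      have "?I * ?P = (\<Prod>p\<in>S. inverse (local_factor \<phi> p) * local_factor \<phi> p)"
        by (rule prod.distrib[symmetric])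
      also have "\<dots> = 1"
      proof (rule prod.neutral, safe)
        fix p assume "p \<in> S"
        then have "fps_nth (local_factor \<phi> p) 0 \<noteq> 0" using S(2) local_factor_nth_0 by auto
        then show "inverse (local_factor \<phi> p) * local_factor \<phi> p = 1" by (rule inverse_mult_eq_1)
      qed
      finally show ?thesis .
    qed
    have PW: "fps_nth (?P * ?W) m = fps_nth 1 m" if "m \<le> n" for m
    proof -
      let ?u = "fps_of_poly u_poly"
      have "fps_nth (emb_const u_poly * (?P * LOG 1)) m =
          (\<Sum>i\<le>m. to_fract [:coeff u_poly i:] * to_fract [:fps_nth (inverse ?u) (m - i):])"
        unfolding fps_mult_nth[of "emb_const u_poly"] emb_const_nth atLeast0AtMost
        using S that by (intro sum.cong refl arg_cong2[where f = "(*)"] prod_local_factor_nth[OF small]) auto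
      also have "\<dots> = (\<Sum>i\<le>m. to_fract [:coeff u_poly i * fps_nth (inverse ?u) (m - i):])"
        by (simp add: mult.commute flip: to_fract_mult)
      also have "\<dots> = to_fract [:\<Sum>i\<le>m. coeff u_poly i * fps_nth (inverse ?u) (m - i):]"
        by (simp add: poly_eq_iff coeff_sum coeff_pCons split: nat.splits flip: to_fract_sum)
      also have "(\<Sum>i\<le>m. coeff u_poly i * fps_nth (inverse ?u) (m - i)) = fps_nth (?u * inverse ?u) m"
        by (simp add: fps_mult_nth atLeast0AtMost)
      also have "?u * inverse ?u = 1"
        by (rule inverse_mult_eq_1') (simp add: coeff_u_poly)
      finally show ?thesis by (auto simp: mult_ac simp flip: one_pCons)
    qed
    have "fps_nth ?W n = fps_nth (?I * (?P * ?W)) n"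
      by (simp add: one flip: mult.assoc)
    also have "\<dots> = fps_nth (?I * 1) n"
      unfolding fps_mult_nth[of ?I] by (intro sum.cong refl arg_cong2[where f = "(*)"] PW) auto
    finally show ?thesis by simp
  qed
  have "((\<lambda>S. \<Prod>p\<in>S. inverse (local_factor \<phi> p)) \<longlongrightarrow> ?W) ?F"
  proof (rule tendsto_fpsI)
    fix n
    have "finite (bracket_places n)" "bracket_places n \<subseteq> {p. place p}"
      using finite_bracket_places by (auto simp: bracket_places_def)
    then show "\<forall>\<^sub>F S in ?F. fps_nth (\<Prod>p\<in>S. inverse (local_factor \<phi> p)) n = fps_nth ?W n"
      unfolding eventually_finite_subsets_at_top
      by (intro exI[of _ "bracket_places n"]) (auto intro!: agree)
  qed
  then show ?thesis
    unfolding L_series_def by (rule tendsto_Lim[OF finite_subsets_at_top_neq_bot])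
qed

end

section \<open>The valuation at a place\<close>

lemma prime_elem_dvd_prodD:
  assumes "prime_elem p" "finite S" "p dvd prod f S"
  shows "\<exists>s\<in>S. p dvd f s"
  using assms(2,3)
proof (induction S)
  case empty
  then show ?case using assms(1) unfolding prime_elem_def by simp
next
  case (insert s S)
  then show ?case using assms(1) by (auto simp: prime_elem_dvd_mult_iff)
qed

lemma place_power_decompose:
  assumes "place p" "(a :: 'f::finite_field poly) \<noteq> 0"
  obtains n c where "a = p ^ n * c" "\<not> p dvd c"
proof -
  have "\<exists>n c. a = p ^ n * c \<and> \<not> p dvd c"
    using assms(2)
  proof (induction "degree a" arbitrary: a rule: less_induct)
    case less
    show ?case
    proof (cases "p dvd a")
      case False
      then show ?thesis by (intro exI[of _ 0] exI[of _ a]) simp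
    next
      case True
      then obtain k where k: "a = p * k" by blast
      then have "k \<noteq> 0" "degree k < degree a"
        using less(2) place_degree_pos[OF assms(1)] place_nz[OF assms(1)] by (auto simp: degree_mult_eq)
      then obtain n c where "k = p ^ n * c" "\<not> p dvd c" using less(1) by blast
      then show ?thesis by (intro exI[of _ "Suc n"] exI[of _ c]) (simp add: k)
    qed
  qed
  then show ?thesis using that by blast
qed

text \<open>The coefficient of \<open>T^N\<close> in \<open>p^(-1) log(p w)\<close>, so that the
  value at \<open>T = 1\<close> can be compared with \<open>w(1)\<close> directly.\<close>

definition log_term ::
    "'f::finite_field poly \<Rightarrow> (nat \<Rightarrow> 'f poly) \<Rightarrow> 'f poly poly \<Rightarrow> nat \<Rightarrow> 'f poly fract" where
  "log_term p g w N = fps_nth (twisted_log g (Polynomial.smult p w)) N / to_fract p"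

context
  fixes p :: "'f::finite_field poly"
  assumes p: "place p"
begin

section \<open>The ultrametric valuation on \<open>K\<close>\<close>

lemma to_fract_place_nz: "to_fract p \<noteq> 0"
  using place_nz[OF p] by simp

lemma not_dvd_1: "\<not> p dvd 1"
  using place_prime[OF p] unfolding prime_elem_def by blast

lemma padic_val_eqI:
  assumes "\<not> p dvd a" "\<not> p dvd b"
  shows "padic_val p (to_fract p powi v * (to_fract a / to_fract b)) = ereal (of_int v)"
  using padic_val_unique[OF p assms] by (simp add: Fract_conv_to_fract)

lemma padic_val_repr:
  assumes "x \<noteq> 0"
  obtains v a b where "\<not> p dvd a" "\<not> p dvd b"
    "x = to_fract p powi v * (to_fract a / to_fract b)" "padic_val p x = ereal (of_int v)"
proof -
  obtain a b where ab: "x = to_fract a / to_fract b" "b \<noteq> 0"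
    by (cases x) (auto simp: Fract_conv_to_fract)
  with assms have "a \<noteq> 0" by auto
  obtain m c where c: "a = p ^ m * c" "\<not> p dvd c" using place_power_decompose[OF p \<open>a \<noteq> 0\<close>] .
  obtain n d where d: "b = p ^ n * d" "\<not> p dvd d" using place_power_decompose[OF p ab(2)] .
  have "x = to_fract p powi (int m - int n) * (to_fract c / to_fract d)"
    using to_fract_place_nz by (simp add: ab c d to_fract_power power_int_diff)
  then show ?thesis
    by (intro that[OF c(2) d(2)]) (simp_all only: padic_val_eqI[OF c(2) d(2)])
qed

lemma padic_val_0 [simp]: "padic_val p 0 = \<infinity>"
  by (simp add: padic_val_def)

text \<open>Leaving the numerator \<open>a\<close> unrestricted covers zero and turns the
  ultrametric and product estimates into computations with a common denominator.\<close>

lemma padic_val_ge_iff: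
  "ereal (of_int v) \<le> padic_val p x \<longleftrightarrow>
     (\<exists>a b. \<not> p dvd b \<and> x = to_fract p powi v * (to_fract a / to_fract b))" (is "?L \<longleftrightarrow> ?R")
proof (cases "x = 0")
  case True
  have ?R by (rule exI[of _ 0], rule exI[of _ 1]) (use True place_degree_pos[OF p] in auto)
  then show ?thesis using True by simp
next
  case False
  show ?thesis
  proof
    assume L: ?L
    obtain w a b where w: "\<not> p dvd a" "\<not> p dvd b"
      "x = to_fract p powi w * (to_fract a / to_fract b)" "padic_val p x = ereal (of_int w)"
      using padic_val_repr[OF False] .
    then have "v \<le> w" using L by simp
    then have "w = v + int (nat (w - v))" by simp
    then have "to_fract p powi w = to_fract p powi v * to_fract p ^ nat (w - v)"
      using to_fract_place_nz by (metis power_int_add power_int_of_nat)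
    then have "x = to_fract p powi v * (to_fract (p ^ nat (w - v) * a) / to_fract b)"
      using w(3) by (simp add: to_fract_power)
    then show ?R using w(2) by blast
  next
    assume ?R
    then obtain a b where ab: "\<not> p dvd b" "x = to_fract p powi v * (to_fract a / to_fract b)" by blast
    with False have "a \<noteq> 0" by auto
    then obtain n c where c: "a = p ^ n * c" "\<not> p dvd c" using place_power_decompose[OF p] by blast
    have "x = to_fract p powi (v + int n) * (to_fract c / to_fract b)"
      using to_fract_place_nz by (simp add: ab c to_fract_power power_int_add)
    then show ?L using padic_val_eqI[OF c(2) ab(1)] by simp
  qed
qed

lemma padic_val_ge_mono: "v \<le> w \<Longrightarrow> ereal (of_int w) \<le> padic_val p x \<Longrightarrow> ereal (of_int v) \<le> padic_val p x"
  by (erule order.trans[rotated]) simp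

lemma padic_val_int_or_infty: "padic_val p x = \<infinity> \<or> (\<exists>v::int. padic_val p x = ereal (of_int v))"
  by (cases "x = 0") (auto elim: padic_val_repr)

lemma padic_val_eq_infty_iff: "padic_val p x = \<infinity> \<longleftrightarrow> x = 0"
  by (cases "x = 0") (auto elim: padic_val_repr)

lemma padic_val_add_ge_int:
  assumes "ereal (of_int v) \<le> padic_val p x" "ereal (of_int v) \<le> padic_val p y"
  shows "ereal (of_int v) \<le> padic_val p (x + y)"
proof -
  obtain a b where 1: "\<not> p dvd b" "x = to_fract p powi v * (to_fract a / to_fract b)"
    using assms(1) padic_val_ge_iff by blast
  obtain c d where 2: "\<not> p dvd d" "y = to_fract p powi v * (to_fract c / to_fract d)"
    using assms(2) padic_val_ge_iff by blast
  have "b \<noteq> 0" "d \<noteq> 0" using 1 2 by auto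
  then have "x + y = to_fract p powi v * (to_fract (a * d + c * b) / to_fract (b * d))"
    unfolding 1 2 by (simp add: add_divide_distrib distrib_left)
  moreover have "\<not> p dvd b * d"
    using 1 2 place_prime[OF p] by (simp add: prime_elem_dvd_mult_iff)
  ultimately show ?thesis using padic_val_ge_iff by blast
qed

lemma padic_val_add: "min (padic_val p x) (padic_val p y) \<le> padic_val p (x + y)"
proof -
  consider "padic_val p x = \<infinity>" | "padic_val p y = \<infinity>"
    | v w :: int where "padic_val p x = ereal (of_int v)" "padic_val p y = ereal (of_int w)"
    using padic_val_int_or_infty by blast
  then show ?thesis
  proof cases
    case 3
    have "ereal (of_int (min v w)) \<le> padic_val p (x + y)"
      by (rule padic_val_add_ge_int) (auto simp: 3)
    then show ?thesis by (simp add: 3 min_def split: if_splits)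
  qed (auto simp: padic_val_eq_infty_iff)
qed

lemma padic_val_uminus [simp]: "padic_val p (- x) = padic_val p x"
proof (cases "x = 0")
  case False
  then obtain v a b where *: "\<not> p dvd a" "\<not> p dvd b"
    "x = to_fract p powi v * (to_fract a / to_fract b)" "padic_val p x = ereal (of_int v)"
    using padic_val_repr by blast
  have "- x = to_fract p powi v * (to_fract (- a) / to_fract b)" by (simp add: *(3))
  then show ?thesis using padic_val_eqI[of "- a" b v] * by simp
qed simp

lemma padic_val_diff: "min (padic_val p x) (padic_val p y) \<le> padic_val p (x - y)"
  using padic_val_add[of x "- y"] by simp

lemma padic_val_minus_commute: "padic_val p (x - y) = padic_val p (y - x)"
  using padic_val_uminus[of "x - y"] by simp

lemma padic_val_eq_of_close:
  assumes "padic_val p x < padic_val p (y - x)"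
  shows "padic_val p y = padic_val p x"
proof (rule antisym)
  have "min (padic_val p x) (padic_val p (y - x)) \<le> padic_val p y"
    using padic_val_add[of x "y - x"] by simp
  then show "padic_val p x \<le> padic_val p y"
    using assms by (simp add: min_def split: if_splits)
  have "min (padic_val p y) (padic_val p (y - x)) \<le> padic_val p x"
    using padic_val_diff[of y "y - x"] by simp
  then show "padic_val p y \<le> padic_val p x"
    using assms by (auto simp: min_def split: if_splits)
qed

lemma padic_val_sum_ge:
  "(\<And>i. i \<in> I \<Longrightarrow> m \<le> padic_val p (f i)) \<Longrightarrow> m \<le> padic_val p (sum f I)"
proof (induction I rule: infinite_finite_induct)
  case (insert i I)
  then have "m \<le> min (padic_val p (f i)) (padic_val p (sum f I))" by auto
  then show ?case using insert(1,2) order.trans[OF _ padic_val_add[of "f i" "sum f I"]] by simp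
qed auto

lemma padic_val_mult_ge:
  assumes "ereal (of_int v) \<le> padic_val p x" "ereal (of_int w) \<le> padic_val p y"
  shows "ereal (of_int (v + w)) \<le> padic_val p (x * y)"
proof -
  obtain a b where 1: "\<not> p dvd b" "x = to_fract p powi v * (to_fract a / to_fract b)"
    using assms(1) padic_val_ge_iff by blast
  obtain c d where 2: "\<not> p dvd d" "y = to_fract p powi w * (to_fract c / to_fract d)"
    using assms(2) padic_val_ge_iff by blast
  have "x * y = to_fract p powi (v + w) * (to_fract (a * c) / to_fract (b * d))"
    unfolding 1 2 using to_fract_place_nz by (simp add: power_int_add)
  moreover have "\<not> p dvd b * d"
    using 1 2 place_prime[OF p] by (simp add: prime_elem_dvd_mult_iff)
  ultimately show ?thesis using padic_val_ge_iff by blast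
qed

lemma padic_val_to_fract_ge_iff: "ereal (of_int (int n)) \<le> padic_val p (to_fract a) \<longleftrightarrow> p ^ n dvd a"
proof
  assume "p ^ n dvd a"
  then obtain c where "a = p ^ n * c" by blast
  then have "to_fract a = to_fract p powi int n * (to_fract c / to_fract 1)"
    by (simp add: to_fract_power)
  then show "ereal (of_int (int n)) \<le> padic_val p (to_fract a)"
    using padic_val_ge_iff not_dvd_1 by blast
next
  assume L: "ereal (of_int (int n)) \<le> padic_val p (to_fract a)"
  show "p ^ n dvd a"
  proof (cases "a = 0")
    case False
    then obtain m c where c: "a = p ^ m * c" "\<not> p dvd c" using place_power_decompose[OF p] by blast
    then have "to_fract a = to_fract p powi int m * (to_fract c / to_fract 1)"
      by (simp add: to_fract_power)
    then have "padic_val p (to_fract a) = ereal (of_int (int m))"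
      using padic_val_eqI[OF c(2) not_dvd_1, of "int m"] by simp
    then have "n \<le> m" using L by simp
    then show ?thesis by (simp add: c le_imp_power_dvd)
  qed simp
qed

lemma padic_val_to_fract_ge_0: "0 \<le> padic_val p (to_fract a)"
  using padic_val_to_fract_ge_iff[of 0 a] by (simp add: zero_ereal_def)

lemma padic_val_divide_unit:
  assumes "ereal (of_int v) \<le> padic_val p x" "\<not> p dvd b"
  shows "ereal (of_int v) \<le> padic_val p (x / to_fract b)"
proof -
  have "ereal (of_int 0) \<le> padic_val p (1 / to_fract b)"
    unfolding padic_val_ge_iff using assms(2) by (intro exI[of _ 1] exI[of _ b]) simp
  then show ?thesis using padic_val_mult_ge[OF assms(1), of 0 "1 / to_fract b"] by simp
qed

lemma padic_val_divide_squarefree: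
  assumes "ereal (of_int v) \<le> padic_val p x" "\<not> p * p dvd b"
  shows "ereal (of_int (v - 1)) \<le> padic_val p (x / to_fract b)"
proof (cases "p dvd b")
  case False
  then have "ereal (of_int v) \<le> padic_val p (x / to_fract b)"
    using padic_val_divide_unit assms by blast
  then show ?thesis by (rule order.trans[rotated]) simp
next
  case True
  then obtain c where c: "b = p * c" by blast
  then have "\<not> p dvd c" using assms(2) by auto
  moreover have "ereal (of_int (- 1)) \<le> padic_val p (1 / to_fract p)"
    unfolding padic_val_ge_iff using not_dvd_1
    by (intro exI[of _ 1] exI[of _ 1]) (simp add: power_int_minus divide_inverse)
  then have "ereal (of_int (v + - 1)) \<le> padic_val p (x * (1 / to_fract p))"
    by (rule padic_val_mult_ge[OF assms(1)])
  ultimately have "ereal (of_int (v + - 1)) \<le> padic_val p (x * (1 / to_fract p) / to_fract c)"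
    using padic_val_divide_unit by blast
  then show ?thesis by (simp add: c)
qed

section \<open>Convergence of the twisted logarithm at a place\<close>

text \<open>By \<open>prod_translates\<close> all prime factors of \<open>t - t^q\<close> are
  linear.\<close>

lemma place_not_dvd_bracket_1:
  assumes "degree p > 1" shows "\<not> p dvd carlitz_bracket 1"
proof
  assume "p dvd carlitz_bracket 1"
  then have "p dvd [:0, 1:] ^ CARD('f) - [:0, 1:]" by (simp add: dvd_diff_commute)
  then have "p dvd (\<Prod>c\<in>UNIV. [:0, 1:] - [:c:])" by (subst prod_translates)
  then have "\<exists>c\<in>UNIV. p dvd [:0, 1:] - [:c:]"
    by (intro prime_elem_dvd_prodD[OF place_prime[OF p]]) simp_all
  then obtain c where "p dvd [:0, 1:] - [:c:]" by blast
  then show False using assms dvd_imp_degree_le[of p "[:- c, 1:]"] by simp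
qed

text \<open>Bounds the exponent of \<open>p\<close> in the denominator of \<open>l_n\<close>. The
  saving of one for nonlinear \<open>p\<close> is what rescues \<open>q = 2\<close>.\<close>

definition log_denom_exp :: "nat \<Rightarrow> nat" where
  "log_denom_exp n = (if degree p > 1 then n - 1 else n)"

text \<open>Brackets are squarefree, so each step of the recursion costs at most one factor
  \<open>p\<close>; the first costs none when \<open>degree p > 1\<close>.\<close>

lemma padic_val_log_coeff: "ereal (of_int (- int (log_denom_exp n))) \<le> padic_val p (log_coeff g n)"
proof (induction n rule: less_induct)
  case (less n)
  show ?case
  proof (cases "n = 0")
    case True
    then show ?thesis using padic_val_to_fract_ge_0[of 1] by (simp add: log_denom_exp_def zero_ereal_def)
  next
    case False
    define s where "s = (\<Sum>i<n. log_coeff g i * to_fract ((frob ^^ i) (g (n - i))))"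
    have s: "ereal (of_int (- int (log_denom_exp (n - 1)))) \<le> padic_val p s"
      unfolding s_def
    proof (rule padic_val_sum_ge)
      fix i assume i: "i \<in> {..<n}"
      have "ereal (of_int (- int (log_denom_exp i) + 0)) \<le>
          padic_val p (log_coeff g i * to_fract ((frob ^^ i) (g (n - i))))"
        using less[of i] i padic_val_to_fract_ge_0 by (intro padic_val_mult_ge) (auto simp: zero_ereal_def)
      moreover have "log_denom_exp i \<le> log_denom_exp (n - 1)" using i by (auto simp: log_denom_exp_def)
      ultimately show "ereal (of_int (- int (log_denom_exp (n - 1)))) \<le>
          padic_val p (log_coeff g i * to_fract ((frob ^^ i) (g (n - i))))"
        by (elim order.trans[rotated]) simp
    qed
    have l: "log_coeff g n = s / to_fract (carlitz_bracket n)"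
      using False by (subst log_coeff.simps) (simp add: s_def)
    show ?thesis
    proof (cases "n = 1 \<and> degree p > 1")
      case True
      then have "ereal (of_int (- int (log_denom_exp (n - 1)))) \<le>
          padic_val p (s / to_fract (carlitz_bracket n))"
        using place_not_dvd_bracket_1 by (intro padic_val_divide_unit[OF s]) auto
      then show ?thesis unfolding l using True by (simp add: log_denom_exp_def)
    next
      case other: False
      have "- int (log_denom_exp n) = - int (log_denom_exp (n - 1)) - 1"
        using other \<open>n \<noteq> 0\<close> by (auto simp: log_denom_exp_def)
      then show ?thesis
        using padic_val_divide_squarefree[OF s carlitz_bracket_squarefree[OF p, of n]] \<open>n \<noteq> 0\<close>
        by (simp add: l)
    qed
  qed
qed

context
  assumes card: "CARD('f) = 2 \<longrightarrow> degree p > 1"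
begin

text \<open>For \<open>q = 2\<close> and \<open>deg p = 1\<close> the following fails at \<open>n = 1\<close>.\<close>

lemma log_denom_exp_bound: "n + log_denom_exp n \<le> CARD('f) ^ n - 1"
proof (cases "CARD('f) = 2")
  case True
  have "2 * n \<le> 2 ^ n"
  proof (cases n)
    case (Suc m)
    moreover have "Suc m \<le> 2 ^ m" by (rule Suc_leI) (rule less_exp)
    ultimately show ?thesis by simp
  qed simp
  then show ?thesis using True card by (cases n) (auto simp: log_denom_exp_def)
next
  case False
  then have "CARD('f) \<ge> 3" using card_field_ge_2[where 'f = 'f] by simp
  then have "3 ^ n \<le> CARD('f) ^ n" by (intro power_mono) auto
  moreover have "2 * n + 1 \<le> 3 ^ n" by (induction n) auto
  ultimately show ?thesis by (auto simp: log_denom_exp_def)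
qed

lemma padic_val_log_coeff_power:
  "ereal (of_int (int n)) \<le> padic_val p (log_coeff g n * to_fract (p ^ (CARD('f) ^ n - 1)))"
proof -
  have "ereal (of_int (int (CARD('f) ^ n - 1))) \<le> padic_val p (to_fract (p ^ (CARD('f) ^ n - 1)))"
    unfolding padic_val_to_fract_ge_iff by simp
  then have "ereal (of_int (- int (log_denom_exp n) + int (CARD('f) ^ n - 1))) \<le>
      padic_val p (log_coeff g n * to_fract (p ^ (CARD('f) ^ n - 1)))"
    by (rule padic_val_mult_ge[OF padic_val_log_coeff])
  moreover have "int n \<le> - int (log_denom_exp n) + int (CARD('f) ^ n - 1)"
    using log_denom_exp_bound[of n] by linarith
  ultimately show ?thesis by (elim order.trans[rotated]) (simp only: ereal_less_eq of_int_le_iff)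
qed

context
  fixes g :: "nat \<Rightarrow> 'f poly" and w :: "'f poly poly"
begin

text \<open>What becomes of \<open>l_n\<close> in \<open>p^(-1) log(p w)\<close>:
  \<open>\<tau>^n\<close> turns \<open>p\<close> into \<open>p^(q^n)\<close>, and the division
  removes one factor.\<close>

private definition B :: "nat \<Rightarrow> 'f poly fract" where
  "B n = log_coeff g n * to_fract (p ^ (CARD('f) ^ n - 1))"

private lemma B_0: "B 0 = 1"
  by (simp add: B_def)

private lemma val_B_mult: "ereal (of_int (int n)) \<le> padic_val p (B n * to_fract a)"
  using padic_val_mult_ge[OF padic_val_log_coeff_power[of n g], of 0 "to_fract a"] padic_val_to_fract_ge_0[of a]
  by (simp add: B_def zero_ereal_def)

private lemma log_term_eq: "log_term p g w N = (\<Sum>n\<le>N. B n * to_fract ((frob ^^ n) (coeff w (N - n))))"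
  unfolding log_term_def twisted_log_nth sum_divide_distrib
proof (intro sum.cong refl)
  fix n
  have "CARD('f) ^ n = Suc (CARD('f) ^ n - 1)" using zero_less_card_finite[where 'a = 'f] by simp
  then have "(frob ^^ n) p = p * p ^ (CARD('f) ^ n - 1)"
    unfolding frob_funpow by (metis power_Suc)
  then show "log_coeff g n * to_fract ((frob ^^ n) (coeff (Polynomial.smult p w) (N - n))) / to_fract p =
      B n * to_fract ((frob ^^ n) (coeff w (N - n)))"
    using to_fract_place_nz by (simp add: frob_pow_mult B_def)
qed

text \<open>A nonzero term needs \<open>N - n \<le> degree w\<close>, so \<open>n\<close>, a lower
  bound for the valuation of \<open>B n\<close>, grows with \<open>N\<close>.\<close>

lemma padic_val_log_term: "ereal (of_int (int N - int (degree w))) \<le> padic_val p (log_term p g w N)"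
  unfolding log_term_eq
proof (rule padic_val_sum_ge)
  fix n assume "n \<in> {..N}"
  show "ereal (of_int (int N - int (degree w))) \<le> padic_val p (B n * to_fract ((frob ^^ n) (coeff w (N - n))))"
  proof (cases "N - n > degree w")
    case True
    then show ?thesis by (simp add: coeff_eq_0)
  next
    case False
    then have "int N - int (degree w) \<le> int n" by linarith
    then show ?thesis using val_B_mult by (rule padic_val_ge_mono)
  qed
qed

private lemma sum_coeffs: "M > degree w \<Longrightarrow> (\<Sum>j<M. coeff w j) = poly w 1"
  unfolding poly_altdef by (intro sum.mono_neutral_cong_right) (auto simp: coeff_eq_0)

private lemma sum_log_term:
  "(\<Sum>N<M. log_term p g w N) = (\<Sum>n<M. B n * to_fract ((frob ^^ n) (\<Sum>j<M - n. coeff w j)))"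
proof (cases M)
  case (Suc M')
  have "(\<Sum>N<M. log_term p g w N) = (\<Sum>n\<le>M'. \<Sum>j\<le>M' - n. B n * to_fract ((frob ^^ n) (coeff w j)))"
    unfolding sum_triangle by (simp add: Suc log_term_eq lessThan_Suc_atMost)
  also have "\<dots> = (\<Sum>n<M. B n * to_fract ((frob ^^ n) (\<Sum>j<M - n. coeff w j)))"
    by (simp add: Suc lessThan_Suc_atMost frob_pow_sum sum_distrib_left Suc_diff_le)
  finally show ?thesis .
qed simp

text \<open>Summed by powers of \<open>\<tau>\<close>, the term \<open>n = 0\<close> is exactly
  \<open>w(1)\<close>. For \<open>n \<ge> 1\<close> a complete inner sum gives \<open>B n\<close>
  times the \<open>q^n\<close>-th power of \<open>w(1)\<close>, of valuation at least
  \<open>n + m\<close>; a truncated one forces \<open>n \<ge> M - degree w\<close>, hence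
  \<open>n > m + 1\<close>.\<close>

lemma padic_val_partial_sum:
  assumes "p ^ m dvd poly w 1" "M > degree w + m + 1"
  shows "ereal (of_int (int (m + 1))) \<le> padic_val p ((\<Sum>N<M. log_term p g w N) - to_fract (poly w 1))"
proof -
  let ?x = "poly w 1"
  let ?f = "\<lambda>n. B n * to_fract ((frob ^^ n) (\<Sum>j<M - n. coeff w j))"
  have "(\<Sum>n<M. ?f n) = ?f 0 + (\<Sum>n\<in>{..<M} - {0}. ?f n)"
    using assms by (intro sum.remove) auto
  moreover have "?f 0 = to_fract ?x" using assms by (simp add: B_0 sum_coeffs)
  ultimately have eq: "(\<Sum>N<M. log_term p g w N) - to_fract ?x = (\<Sum>n\<in>{..<M} - {0}. ?f n)"
    unfolding sum_log_term by simp
  show ?thesis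
    unfolding eq
  proof (rule padic_val_sum_ge)
    fix n assume n: "n \<in> {..<M} - {0}"
    show "ereal (of_int (int (m + 1))) \<le> padic_val p (?f n)"
    proof (cases "M - n > degree w")
      case True
      have "ereal (of_int (int m)) \<le> padic_val p (to_fract ((frob ^^ n) ?x))"
        unfolding padic_val_to_fract_ge_iff using frob_pow_dvd[OF assms(1)] .
      then have "ereal (of_int (int n + int m)) \<le> padic_val p (?f n)"
        unfolding sum_coeffs[OF True] B_def by (rule padic_val_mult_ge[OF padic_val_log_coeff_power])
      moreover have "int (m + 1) \<le> int n + int m" using n by auto
      ultimately show ?thesis by (elim order.trans[rotated]) (simp only: ereal_less_eq of_int_le_iff)
    next
      case False
      then have "int (m + 1) \<le> int n" using assms by linarith
      then show ?thesis using val_B_mult by (rule padic_val_ge_mono)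
    qed
  qed
qed

text \<open>If \<open>w(1)\<close> has finite valuation \<open>m\<close>, late partial sums differ
  from it by valuation at least \<open>m + 1\<close> and so share its valuation; if
  \<open>w(1) = 0\<close>, every \<open>m\<close> is admissible.\<close>

lemma padic_val_partial_sums_tendsto:
  "(\<lambda>M. padic_val p (\<Sum>N<M. log_term p g w N)) \<longlonglongrightarrow> padic_val p (to_fract (poly w 1))"
proof (cases "poly w 1 = 0")
  case True
  show ?thesis
    unfolding True to_fract_0 padic_val_0 tendsto_PInfty
  proof
    fix c :: real
    obtain m where m: "c < real m" using reals_Archimedean2 by blast
    have "ereal c < padic_val p (\<Sum>N<M. log_term p g w N)" if "M > degree w + m + 1" for M
    proof -
      have "ereal c < ereal (of_int (int (m + 1)))" using m by simp
      also have "\<dots> \<le> padic_val p (\<Sum>N<M. log_term p g w N)"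
        using padic_val_partial_sum[of m M] that True by simp
      finally show ?thesis .
    qed
    then show "\<forall>\<^sub>F M in sequentially. ereal c < padic_val p (\<Sum>N<M. log_term p g w N)"
      by (rule eventually_mono[OF eventually_gt_at_top])
  qed
next
  case False
  then obtain m c where c: "poly w 1 = p ^ m * c" "\<not> p dvd c" using place_power_decompose[OF p] by blast
  then have "to_fract (poly w 1) = to_fract p powi int m * (to_fract c / to_fract 1)"
    by (simp add: to_fract_power)
  then have v: "padic_val p (to_fract (poly w 1)) = ereal (of_int (int m))"
    using padic_val_eqI[OF c(2) not_dvd_1, of "int m"] by simp
  have "padic_val p (\<Sum>N<M. log_term p g w N) = padic_val p (to_fract (poly w 1))" if "M > degree w + m + 1" for M
  proof (rule padic_val_eq_of_close)
    have "ereal (of_int (int m)) < ereal (of_int (int (m + 1)))" by simp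
    also have "\<dots> \<le> padic_val p ((\<Sum>N<M. log_term p g w N) - to_fract (poly w 1))"
      using padic_val_partial_sum[of m M] that c by simp
    finally show "padic_val p (to_fract (poly w 1)) < padic_val p ((\<Sum>N<M. log_term p g w N) - to_fract (poly w 1))"
      by (simp add: v)
  qed
  then show ?thesis
    by (intro tendsto_eventually) (rule eventually_mono[OF eventually_gt_at_top])
qed

end

end

end

section \<open>The completion at a place\<close>

lemma tendsto_infty_iff_ge: "(f \<longlongrightarrow> \<infinity>) F \<longleftrightarrow> (\<forall>M::real. \<forall>\<^sub>F x in F. ereal M \<le> f x)"
proof safe
  fix M :: real
  assume "(f \<longlongrightarrow> \<infinity>) F"
  then have "\<forall>\<^sub>F x in F. ereal M < f x" unfolding tendsto_PInfty by blast
  then show "\<forall>\<^sub>F x in F. ereal M \<le> f x" by (rule eventually_mono) simp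
next
  assume *: "\<forall>M::real. \<forall>\<^sub>F x in F. ereal M \<le> f x"
  show "(f \<longlongrightarrow> \<infinity>) F"
    unfolding tendsto_PInfty
  proof
    fix M :: real
    have "\<forall>\<^sub>F x in F. ereal (M + 1) \<le> f x" using * by blast
    then show "\<forall>\<^sub>F x in F. ereal M < f x"
      by (rule eventually_mono) (rule less_le_trans[of _ "ereal (M + 1)"], auto)
  qed
qed

lemma tendsto_infty_min:
  fixes f :: "'a \<Rightarrow> ereal"
  assumes "(f \<longlongrightarrow> \<infinity>) F" "(h \<longlongrightarrow> \<infinity>) F" "\<And>x. min (f x) (h x) \<le> k x"
  shows "(k \<longlongrightarrow> \<infinity>) F"
  unfolding tendsto_infty_iff_ge
proof
  fix M :: real
  have "\<forall>\<^sub>F x in F. ereal M \<le> f x \<and> ereal M \<le> h x"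
    using assms(1,2) unfolding tendsto_infty_iff_ge by (simp add: eventually_conj)
  then show "\<forall>\<^sub>F x in F. ereal M \<le> k x"
    by (rule eventually_mono) (use assms(3) in \<open>meson min.boundedI order.trans\<close>)
qed

abbreviation partial_sums :: "(nat \<Rightarrow> 'a::comm_monoid_add) \<Rightarrow> nat \<Rightarrow> 'a" where
  "partial_sums x \<equiv> \<lambda>N. \<Sum>n<N. x n"

definition completion_class :: "'f::finite_field poly \<Rightarrow> (nat \<Rightarrow> 'f poly fract) \<Rightarrow> (nat \<Rightarrow> 'f poly fract) set" where
  "completion_class p X = null_seqs p +>\<^bsub>cauchy_ring p\<^esub> X"

context
  fixes p :: "'f::finite_field poly"
  assumes p: "place p"
begin

private abbreviation (input) "cv \<equiv> completion_val p"
private abbreviation (input) "R \<equiv> completion p"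
private abbreviation (input) "cls \<equiv> completion_class p"
private abbreviation (input) "val \<equiv> padic_val p"

lemma padic_cauchy_diff:
  assumes "padic_cauchy p X" "padic_cauchy p Y"
  shows "padic_cauchy p (\<lambda>n. X n - Y n)"
  unfolding padic_cauchy_def
proof
  fix M :: real
  obtain N1 where N1: "\<And>m n. m \<ge> N1 \<Longrightarrow> n \<ge> N1 \<Longrightarrow> ereal M \<le> val (X m - X n)"
    using assms(1) unfolding padic_cauchy_def by blast
  obtain N2 where N2: "\<And>m n. m \<ge> N2 \<Longrightarrow> n \<ge> N2 \<Longrightarrow> ereal M \<le> val (Y m - Y n)"
    using assms(2) unfolding padic_cauchy_def by blast
  have "ereal M \<le> val (X m - Y m - (X n - Y n))" if "m \<ge> max N1 N2" "n \<ge> max N1 N2" for m n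
  proof -
    have "ereal M \<le> min (val (X m - X n)) (val (Y m - Y n))" using that N1 N2 by auto
    also have "\<dots> \<le> val (X m - X n - (Y m - Y n))" by (rule padic_val_diff[OF p])
    finally show ?thesis by (simp add: algebra_simps)
  qed
  then show "\<exists>N. \<forall>m\<ge>N. \<forall>n\<ge>N. ereal M \<le> val (X m - Y m - (X n - Y n))" by blast
qed

lemma padic_cauchy_const [simp]: "padic_cauchy p (\<lambda>_. c)"
  by (simp add: padic_cauchy_def padic_val_0[OF p])

lemma padic_cauchy_uminus: "padic_cauchy p X \<Longrightarrow> padic_cauchy p (\<lambda>n. - X n)"
  using padic_cauchy_diff[OF padic_cauchy_const[of 0]] by simp

lemma padic_cauchy_add:
  assumes "padic_cauchy p X" "padic_cauchy p Y" shows "padic_cauchy p (\<lambda>n. X n + Y n)"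
  using padic_cauchy_diff[OF assms(1) padic_cauchy_uminus[OF assms(2)]] by simp

lemma null_seqs_diff: "X \<in> null_seqs p \<Longrightarrow> Y \<in> null_seqs p \<Longrightarrow> (\<lambda>n. X n - Y n) \<in> null_seqs p"
  unfolding null_seqs_def by (auto intro: tendsto_infty_min padic_val_diff[OF p])

lemma null_seqs_0: "(\<lambda>_. 0) \<in> null_seqs p"
  by (simp add: null_seqs_def padic_val_0[OF p])

lemma null_seqs_uminus: "X \<in> null_seqs p \<Longrightarrow> (\<lambda>n. - X n) \<in> null_seqs p"
  using null_seqs_diff[OF null_seqs_0] by simp

lemma null_seqs_add: "X \<in> null_seqs p \<Longrightarrow> Y \<in> null_seqs p \<Longrightarrow> (\<lambda>n. X n + Y n) \<in> null_seqs p"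
  using null_seqs_diff[OF _ null_seqs_uminus] by fastforce

lemma null_seqs_cauchy:
  assumes "X \<in> null_seqs p" shows "padic_cauchy p X"
  unfolding padic_cauchy_def
proof
  fix M :: real
  obtain N where N: "\<And>n. n \<ge> N \<Longrightarrow> ereal M \<le> val (X n)"
    using assms unfolding null_seqs_def tendsto_infty_iff_ge eventually_sequentially by blast
  have "ereal M \<le> val (X m - X n)" if "m \<ge> N" "n \<ge> N" for m n
    using padic_val_diff[OF p, of "X m" "X n"] N[OF that(1)] N[OF that(2)]
    by (meson min.boundedI order.trans)
  then show "\<exists>N. \<forall>m\<ge>N. \<forall>n\<ge>N. ereal M \<le> val (X m - X n)" by blast
qed

text \<open>Multiplication by \<open>T - 1\<close> and evaluation at \<open>T = 1\<close> are formed
  from sums and differences of coefficients, so the completion is handled as an abelian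
  group.\<close>

lemma abelian_group_cauchy_ring: "abelian_group (cauchy_ring p)"
proof (rule abelian_groupI)
  fix X assume "X \<in> carrier (cauchy_ring p)"
  then show "\<exists>Y\<in>carrier (cauchy_ring p). Y \<oplus>\<^bsub>cauchy_ring p\<^esub> X = \<zero>\<^bsub>cauchy_ring p\<^esub>"
    by (intro bexI[of _ "\<lambda>n. - X n"]) (auto simp: cauchy_ring_def padic_cauchy_uminus)
qed (auto simp: cauchy_ring_def padic_cauchy_add add_ac)

lemma abelian_subgroup_null_seqs: "abelian_subgroup (null_seqs p) (cauchy_ring p)"
proof (rule abelian_subgroupI3)
  interpret abelian_group "cauchy_ring p" by (rule abelian_group_cauchy_ring)
  have "\<ominus>\<^bsub>cauchy_ring p\<^esub> X = (\<lambda>n. - X n)" if "X \<in> null_seqs p" for X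
    using null_seqs_cauchy that
    by (intro minus_equality) (auto simp: cauchy_ring_def padic_cauchy_uminus)
  moreover have "null_seqs p \<noteq> {}" using null_seqs_0 by blast
  ultimately have "subgroup (null_seqs p) (add_monoid (cauchy_ring p))"
    by (intro add.subgroupI)
       (auto simp: null_seqs_cauchy null_seqs_uminus null_seqs_add cauchy_ring_def a_inv_def)
  then show "additive_subgroup (null_seqs p) (cauchy_ring p)"
    by (rule additive_subgroup.intro)
qed (rule abelian_group_cauchy_ring)

lemma mem_completion_class:
  "Y \<in> cls X \<longleftrightarrow> (\<lambda>n. Y n - X n) \<in> null_seqs p"
proof
  assume "Y \<in> cls X"
  then obtain Z where "Z \<in> null_seqs p" "Y = (\<lambda>n. Z n + X n)"
    by (auto simp: completion_class_def a_r_coset_def' cauchy_ring_def)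
  then show "(\<lambda>n. Y n - X n) \<in> null_seqs p" by simp
next
  assume "(\<lambda>n. Y n - X n) \<in> null_seqs p"
  then show "Y \<in> cls X"
    by (auto simp: completion_class_def a_r_coset_def' cauchy_ring_def intro!: bexI[of _ "\<lambda>n. Y n - X n"])
qed

lemma completion_class_eq_iff: "cls X = cls Y \<longleftrightarrow> (\<lambda>n. X n - Y n) \<in> null_seqs p"
proof
  assume "cls X = cls Y"
  moreover have "X \<in> cls X" by (simp add: mem_completion_class null_seqs_0)
  ultimately show "(\<lambda>n. X n - Y n) \<in> null_seqs p" by (simp add: mem_completion_class)
next
  assume *: "(\<lambda>n. X n - Y n) \<in> null_seqs p"
  show "cls X = cls Y"
  proof (rule Set.set_eqI, rule iffI)
    fix Z assume "Z \<in> cls X"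
    then show "Z \<in> cls Y" using null_seqs_add[OF _ *] by (fastforce simp: mem_completion_class)
  next
    fix Z assume "Z \<in> cls Y"
    then show "Z \<in> cls X" using null_seqs_diff[OF _ *] by (fastforce simp: mem_completion_class)
  qed
qed

lemma carrier_completion: "carrier R = cls ` {X. padic_cauchy p X}"
  by (auto simp: completion_def FactRing_def A_RCOSETS_def' completion_class_def cauchy_ring_def)

lemma completion_class_closed [simp]: "padic_cauchy p X \<Longrightarrow> cls X \<in> carrier R"
  by (simp add: carrier_completion)

lemma completion_cases:
  assumes "\<xi> \<in> carrier R" obtains X where "padic_cauchy p X" "\<xi> = cls X"
  using assms by (auto simp: carrier_completion)

lemma completion_class_add:
  "padic_cauchy p X \<Longrightarrow> padic_cauchy p Y \<Longrightarrow> cls X \<oplus>\<^bsub>R\<^esub> cls Y = cls (\<lambda>n. X n + Y n)"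
  using abelian_subgroup.a_rcos_sum[OF abelian_subgroup_null_seqs, of X Y]
  by (simp add: completion_def FactRing_def completion_class_def cauchy_ring_def)

lemma completion_zero: "\<zero>\<^bsub>R\<^esub> = cls (\<lambda>_. 0)"
proof -
  have "null_seqs p = cls (\<lambda>_. 0)" by (auto simp: mem_completion_class)
  then show ?thesis by (simp add: completion_def FactRing_def)
qed

lemma abelian_group_completion: "abelian_group R"
proof (rule abelian_groupI)
  fix x y z assume "x \<in> carrier R" "y \<in> carrier R" "z \<in> carrier R"
  then obtain X Y Z where *: "padic_cauchy p X" "padic_cauchy p Y" "padic_cauchy p Z"
    "x = cls X" "y = cls Y" "z = cls Z" by (elim completion_cases)
  then show "x \<oplus>\<^bsub>R\<^esub> y \<oplus>\<^bsub>R\<^esub> z = x \<oplus>\<^bsub>R\<^esub> (y \<oplus>\<^bsub>R\<^esub> z)"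
    by (simp add: completion_class_add padic_cauchy_add add.assoc)
next
  fix x y assume "x \<in> carrier R" "y \<in> carrier R"
  then obtain X Y where *: "padic_cauchy p X" "padic_cauchy p Y" "x = cls X" "y = cls Y"
    by (elim completion_cases)
  then show "x \<oplus>\<^bsub>R\<^esub> y \<in> carrier R" "x \<oplus>\<^bsub>R\<^esub> y = y \<oplus>\<^bsub>R\<^esub> x"
    by (simp_all add: completion_class_add padic_cauchy_add add.commute)
next
  fix x assume "x \<in> carrier R"
  then obtain X where *: "padic_cauchy p X" "x = cls X" by (elim completion_cases)
  then show "\<zero>\<^bsub>R\<^esub> \<oplus>\<^bsub>R\<^esub> x = x" by (simp add: completion_zero completion_class_add)
  have "cls (\<lambda>n. - X n) \<oplus>\<^bsub>R\<^esub> x = \<zero>\<^bsub>R\<^esub>"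
    using * by (simp add: completion_zero completion_class_add padic_cauchy_uminus)
  then show "\<exists>y\<in>carrier R. y \<oplus>\<^bsub>R\<^esub> x = \<zero>\<^bsub>R\<^esub>"
    using * padic_cauchy_uminus by (intro bexI[of _ "cls (\<lambda>n. - X n)"]) auto
qed (simp add: completion_zero)

interpretation abelian_group R by (rule abelian_group_completion)

lemma completion_class_uminus: "padic_cauchy p X \<Longrightarrow> \<ominus>\<^bsub>R\<^esub> cls X = cls (\<lambda>n. - X n)"
  by (intro minus_equality) (simp_all add: completion_zero completion_class_add padic_cauchy_uminus)

lemma completion_class_diff:
  "padic_cauchy p X \<Longrightarrow> padic_cauchy p Y \<Longrightarrow> cls X \<ominus>\<^bsub>R\<^esub> cls Y = cls (\<lambda>n. X n - Y n)"
  by (simp add: a_minus_def completion_class_uminus completion_class_add padic_cauchy_uminus)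

lemma to_completion_eq: "to_completion p x = cls (\<lambda>_. x)"
  by (simp add: to_completion_def completion_class_def)

lemma finsum_to_completion:
  "(\<Oplus>\<^bsub>R\<^esub>n\<in>{..<N}. to_completion p (x n)) = to_completion p (partial_sums x N)"
  by (induction N) (simp_all add: to_completion_eq completion_zero lessThan_Suc completion_class_add add.commute)

text \<open>Outside the null sequences some \<open>X k\<close> beyond the Cauchy threshold has
  valuation below the bound for the differences; all later terms inherit its valuation.\<close>

lemma padic_cauchy_dichotomy:
  assumes "padic_cauchy p X"
  shows "X \<in> null_seqs p \<or> (\<exists>v::real. \<forall>\<^sub>F n in sequentially. val (X n) = ereal v)"
proof (cases "X \<in> null_seqs p")
  case False
  then obtain M :: real where M: "\<not> (\<forall>\<^sub>F n in sequentially. ereal M \<le> val (X n))"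
    unfolding null_seqs_def tendsto_infty_iff_ge by auto
  obtain N where N: "\<And>m n. m \<ge> N \<Longrightarrow> n \<ge> N \<Longrightarrow> ereal M \<le> val (X m - X n)"
    using assms unfolding padic_cauchy_def by blast
  obtain k where k: "k \<ge> N" "val (X k) < ereal M"
    using M unfolding eventually_sequentially by (auto simp: not_le)
  have "val (X n) = val (X k)" if "n \<ge> N" for n
    using k N[OF that k(1)] by (intro padic_val_eq_of_close[OF p]) auto
  moreover obtain v :: int where "val (X k) = ereal (of_int v)"
    using padic_val_int_or_infty[OF p, of "X k"] k by auto
  ultimately show ?thesis unfolding eventually_sequentially by auto
qed simp

text \<open>Representatives differ by a null sequence, whose valuations eventually exceed the
  stationary valuation of \<open>X\<close>, or else all representatives are null. So the limit does
  not depend on the choice.\<close>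

lemma completion_val_class:
  assumes X: "padic_cauchy p X" and v: "(\<lambda>n. val (X n)) \<longlonglongrightarrow> v"
  shows "cv (cls X) = v"
  unfolding completion_val_def
proof (rule the_equality)
  have lim: "(\<lambda>n. val (Y n)) \<longlonglongrightarrow> v" if "Y \<in> cls X" for Y
  proof -
    define Z where "Z n = Y n - X n" for n
    have Z: "(\<lambda>n. val (Z n)) \<longlonglongrightarrow> \<infinity>"
      using that by (simp add: mem_completion_class null_seqs_def Z_def)
    from padic_cauchy_dichotomy[OF X] show ?thesis
    proof
      assume "X \<in> null_seqs p"
      then have inf: "(\<lambda>n. val (X n)) \<longlonglongrightarrow> \<infinity>" by (simp add: null_seqs_def)
      then have "v = \<infinity>" using LIMSEQ_unique[OF v] by simp
      moreover have "(\<lambda>n. val (Y n)) \<longlonglongrightarrow> \<infinity>"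
        using tendsto_infty_min[OF inf Z] padic_val_add[OF p, of "X n" "Z n" for n] by (simp add: Z_def)
      ultimately show ?thesis by simp
    next
      assume "\<exists>c::real. \<forall>\<^sub>F n in sequentially. val (X n) = ereal c"
      then obtain c :: real where c: "\<forall>\<^sub>F n in sequentially. val (X n) = ereal c" by blast
      have "\<forall>\<^sub>F n in sequentially. ereal c < val (Z n)"
        using Z unfolding tendsto_PInfty by blast
      with c have "\<forall>\<^sub>F n in sequentially. val (X n) = val (Y n)"
      proof eventually_elim
        case (elim n)
        then have "val (X n) < val (Y n - X n)" by (simp add: Z_def)
        then show ?case by (rule padic_val_eq_of_close[OF p, symmetric])
      qed
      with v show ?thesis by (rule Lim_transform_eventually)
    qed
  qed
  then show "\<forall>Y\<in>cls X. (\<lambda>n. val (Y n)) \<longlonglongrightarrow> v" by blast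
  fix w assume "\<forall>Y\<in>cls X. (\<lambda>n. val (Y n)) \<longlonglongrightarrow> w"
  moreover have "X \<in> cls X" by (simp add: mem_completion_class null_seqs_0)
  ultimately show "w = v" using LIMSEQ_unique[OF _ v] by simp
qed

lemma completion_val_tendsto:
  assumes "padic_cauchy p X" shows "(\<lambda>n. val (X n)) \<longlonglongrightarrow> cv (cls X)"
proof -
  from padic_cauchy_dichotomy[OF assms] have "\<exists>v. (\<lambda>n. val (X n)) \<longlonglongrightarrow> v"
  proof (elim disjE exE)
    assume "X \<in> null_seqs p"
    then show ?thesis by (intro exI[of _ \<infinity>]) (simp add: null_seqs_def)
  next
    fix v :: real assume "\<forall>\<^sub>F n in sequentially. val (X n) = ereal v"
    then show ?thesis by (intro exI[of _ "ereal v"] tendsto_eventually)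
  qed
  then show ?thesis using completion_val_class[OF assms] by auto
qed

lemma completion_val_to_completion [simp]: "cv (to_completion p x) = val x"
  unfolding to_completion_eq by (rule completion_val_class) auto

lemma completion_val_diff:
  assumes "\<xi> \<in> carrier R" "\<eta> \<in> carrier R"
  shows "min (cv \<xi>) (cv \<eta>) \<le> cv (\<xi> \<ominus>\<^bsub>R\<^esub> \<eta>)"
proof -
  obtain X Y where *: "padic_cauchy p X" "padic_cauchy p Y" "\<xi> = cls X" "\<eta> = cls Y"
    using assms by (elim completion_cases)
  show ?thesis
    unfolding *(3,4) completion_class_diff[OF *(1,2)]
  proof (rule tendsto_le[OF sequentially_bot])
    show "(\<lambda>n. val (X n - Y n)) \<longlonglongrightarrow> cv (cls (\<lambda>n. X n - Y n))"
      by (intro completion_val_tendsto padic_cauchy_diff *)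
    show "(\<lambda>n. min (val (X n)) (val (Y n))) \<longlonglongrightarrow> min (cv (cls X)) (cv (cls Y))"
      by (intro tendsto_min completion_val_tendsto *)
  qed (simp add: padic_val_diff[OF p])
qed

lemma completion_val_infty_iff: "\<xi> \<in> carrier R \<Longrightarrow> cv \<xi> = \<infinity> \<longleftrightarrow> \<xi> = \<zero>\<^bsub>R\<^esub>"
proof -
  assume "\<xi> \<in> carrier R"
  then obtain X where X: "padic_cauchy p X" "\<xi> = cls X" by (elim completion_cases)
  have "cv \<xi> = \<infinity> \<longleftrightarrow> X \<in> null_seqs p"
  proof
    assume "cv \<xi> = \<infinity>"
    then show "X \<in> null_seqs p"
      using completion_val_tendsto[OF X(1)] by (simp add: X(2) null_seqs_def)
  next
    assume "X \<in> null_seqs p"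
    then show "cv \<xi> = \<infinity>"
      unfolding X(2) null_seqs_def by (intro completion_val_class[OF X(1)]) simp
  qed
  then show ?thesis using completion_class_eq_iff[of X "\<lambda>_. 0"] by (simp add: X completion_zero)
qed

section \<open>Evaluation of Tate series at \<open>T = 1\<close>\<close>

lemma tate_eval_1_eqI:
  assumes s: "s \<in> carrier R" and f: "\<And>n. f n \<in> carrier R"
    and lim: "(\<lambda>N. cv (s \<ominus>\<^bsub>R\<^esub> (\<Oplus>\<^bsub>R\<^esub>n\<in>{..<N}. f n))) \<longlonglongrightarrow> \<infinity>"
  shows "tate_eval_1 p f = s"
  unfolding tate_eval_1_def
proof (rule the_equality)
  show "s \<in> carrier R \<and> (\<lambda>N. cv (s \<ominus>\<^bsub>R\<^esub> (\<Oplus>\<^bsub>R\<^esub>n\<in>{..<N}. f n))) \<longlonglongrightarrow> \<infinity>"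
    using s lim by blast
  fix s' assume s': "s' \<in> carrier R \<and> (\<lambda>N. cv (s' \<ominus>\<^bsub>R\<^esub> (\<Oplus>\<^bsub>R\<^esub>n\<in>{..<N}. f n))) \<longlonglongrightarrow> \<infinity>"
  let ?S = "\<lambda>N. \<Oplus>\<^bsub>R\<^esub>n\<in>{..<N}. f n"
  have eq: "s' \<ominus>\<^bsub>R\<^esub> s = (s' \<ominus>\<^bsub>R\<^esub> S) \<ominus>\<^bsub>R\<^esub> (s \<ominus>\<^bsub>R\<^esub> S)" if S: "S \<in> carrier R" for S
  proof -
    obtain X where X: "padic_cauchy p X" "s = cls X" using completion_cases[OF s] .
    obtain X' where X': "padic_cauchy p X'" "s' = cls X'" using completion_cases[OF conjunct1[OF s']] .
    obtain Y where Y: "padic_cauchy p Y" "S = cls Y" using completion_cases[OF S] .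
    show ?thesis by (simp add: X X' Y completion_class_diff padic_cauchy_diff)
  qed
  have "(\<lambda>N::nat. cv (s' \<ominus>\<^bsub>R\<^esub> s)) \<longlonglongrightarrow> \<infinity>"
  proof (rule tendsto_infty_min[OF conjunct2[OF s'] lim])
    fix N
    have S: "?S N \<in> carrier R" using f by (intro finsum_closed) auto
    show "min (cv (s' \<ominus>\<^bsub>R\<^esub> ?S N)) (cv (s \<ominus>\<^bsub>R\<^esub> ?S N)) \<le> cv (s' \<ominus>\<^bsub>R\<^esub> s)"
      unfolding eq[OF S] using s s' S by (intro completion_val_diff minus_closed) auto
  qed
  then have "cv (s' \<ominus>\<^bsub>R\<^esub> s) = \<infinity>" by (simp add: LIMSEQ_const_iff)
  then have zero: "s' \<ominus>\<^bsub>R\<^esub> s = \<zero>\<^bsub>R\<^esub>" using s s' completion_val_infty_iff by simp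
  obtain X where X: "padic_cauchy p X" "s = cls X" using completion_cases[OF s] .
  obtain X' where X': "padic_cauchy p X'" "s' = cls X'" using completion_cases[OF conjunct1[OF s']] .
  have "cls (\<lambda>n. X' n - X n) = cls (\<lambda>_. 0)"
    using zero by (simp add: X X' completion_class_diff completion_zero)
  then show "s' = s" by (simp add: X X' completion_class_eq_iff)
qed

text \<open>Terms tending to zero suffice for convergence by the ultrametric inequality. For
  coefficients in \<open>K\<close> the sequence of partial sums itself represents the value.\<close>

lemma tate_eval_1_to_completion:
  assumes "(\<lambda>n. val (x n)) \<longlonglongrightarrow> \<infinity>"
  shows "padic_cauchy p (partial_sums x)"
    and "tate_eval_1 p (\<lambda>n. to_completion p (x n)) = cls (partial_sums x)"
proof -
  have tail: "\<exists>N0. \<forall>m\<ge>N0. \<forall>n\<ge>N0. ereal M \<le> val (partial_sums x m - partial_sums x n)" for M :: real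
  proof -
    obtain N where N: "\<And>n. n \<ge> N \<Longrightarrow> ereal M \<le> val (x n)"
      using assms unfolding tendsto_infty_iff_ge eventually_sequentially by blast
    have *: "ereal M \<le> val (partial_sums x m - partial_sums x n)" if "N \<le> n" "n \<le> m" for m n
    proof -
      have "partial_sums x m - partial_sums x n = sum x {n..<m}"
        using that by (simp add: sum_diff_nat_ivl lessThan_atLeast0)
      then show ?thesis using that N padic_val_sum_ge[OF p, of "{n..<m}" "ereal M" x] by simp
    qed
    have "ereal M \<le> val (partial_sums x m - partial_sums x n)" if "N \<le> n" "N \<le> m" for m n
      using *[of n m] *[of m n] that padic_val_minus_commute[OF p] by (metis nle_le)
    then show ?thesis by blast
  qed
  then show cauchy: "padic_cauchy p (partial_sums x)" unfolding padic_cauchy_def by blast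
  show "tate_eval_1 p (\<lambda>n. to_completion p (x n)) = cls (partial_sums x)"
  proof (rule tate_eval_1_eqI)
    show "cls (partial_sums x) \<in> carrier R" using cauchy by simp
    show "to_completion p (x n) \<in> carrier R" for n by (simp add: to_completion_eq)
    show "(\<lambda>N. cv (cls (partial_sums x) \<ominus>\<^bsub>R\<^esub> (\<Oplus>\<^bsub>R\<^esub>n\<in>{..<N}. to_completion p (x n)))) \<longlonglongrightarrow> \<infinity>"
      unfolding tendsto_infty_iff_ge
    proof
      fix M :: real
      obtain N where N: "\<And>m n. m \<ge> N \<Longrightarrow> n \<ge> N \<Longrightarrow> ereal M \<le> val (partial_sums x m - partial_sums x n)"
        using tail[of M] by blast
      have "ereal M \<le> cv (cls (partial_sums x) \<ominus>\<^bsub>R\<^esub> (\<Oplus>\<^bsub>R\<^esub>n\<in>{..<k}. to_completion p (x n)))"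
        if "k \<ge> N" for k
      proof -
        have "(\<lambda>n. val (partial_sums x n - partial_sums x k)) \<longlonglongrightarrow> cv (cls (\<lambda>n. partial_sums x n - partial_sums x k))"
          by (intro completion_val_tendsto padic_cauchy_diff cauchy padic_cauchy_const)
        then have "ereal M \<le> cv (cls (\<lambda>n. partial_sums x n - partial_sums x k))"
          by (rule tendsto_lowerbound)
             (use N that in \<open>auto simp: eventually_sequentially intro!: exI[of _ N]\<close>)
        then show ?thesis
          unfolding finsum_to_completion unfolding to_completion_eq
          by (simp add: completion_class_diff cauchy)
      qed
      then show "\<forall>\<^sub>F k in sequentially.
          ereal M \<le> cv (cls (partial_sums x) \<ominus>\<^bsub>R\<^esub> (\<Oplus>\<^bsub>R\<^esub>n\<in>{..<k}. to_completion p (x n)))"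
        unfolding eventually_sequentially by blast
    qed
  qed
qed

section \<open>Multiplication by \<open>T - 1\<close> and uniqueness of the special value\<close>

private abbreviation (input) "TT \<equiv> times_T_minus_1 R"

lemma times_T_minus_1_0: "TT f 0 = \<zero>\<^bsub>R\<^esub> \<ominus>\<^bsub>R\<^esub> f 0"
  and times_T_minus_1_Suc: "TT f (Suc n) = f n \<ominus>\<^bsub>R\<^esub> f (Suc n)"
  by (simp_all add: times_T_minus_1_def)

lemma times_T_minus_1_closed: "(\<And>n. f n \<in> carrier R) \<Longrightarrow> TT f n \<in> carrier R"
  by (simp add: times_T_minus_1_def)

lemma times_T_minus_1_funpow_closed: "(\<And>n. f n \<in> carrier R) \<Longrightarrow> (TT ^^ k) f n \<in> carrier R"
  by (induction k arbitrary: n) (auto intro: times_T_minus_1_closed)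

lemma completion_diff_cancel:
  assumes "a \<in> carrier R" "x \<in> carrier R" "y \<in> carrier R" "a \<ominus>\<^bsub>R\<^esub> x = a \<ominus>\<^bsub>R\<^esub> y"
  shows "x = y"
proof -
  have *: "a \<ominus>\<^bsub>R\<^esub> (a \<ominus>\<^bsub>R\<^esub> z) = z" if z: "z \<in> carrier R" for z
  proof -
    obtain X where X: "padic_cauchy p X" "a = cls X" using completion_cases[OF assms(1)] .
    obtain Z where Z: "padic_cauchy p Z" "z = cls Z" using completion_cases[OF z] .
    show ?thesis by (simp add: X Z completion_class_diff padic_cauchy_diff)
  qed
  have "a \<ominus>\<^bsub>R\<^esub> (a \<ominus>\<^bsub>R\<^esub> x) = a \<ominus>\<^bsub>R\<^esub> (a \<ominus>\<^bsub>R\<^esub> y)" by (simp only: assms(4))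
  then show ?thesis by (simp only: *[OF assms(2)] *[OF assms(3)])
qed

text \<open>The constant term of \<open>T - 1\<close> is \<open>-1\<close>, so the coefficients can
  be recovered one after another.\<close>

lemma times_T_minus_1_inj:
  assumes f: "\<And>n. f n \<in> carrier R" "\<And>n. f' n \<in> carrier R" and eq: "TT f = TT f'"
  shows "f = f'"
proof
  fix n
  show "f n = f' n"
  proof (induction n)
    case 0
    have "\<zero>\<^bsub>R\<^esub> \<ominus>\<^bsub>R\<^esub> f 0 = \<zero>\<^bsub>R\<^esub> \<ominus>\<^bsub>R\<^esub> f' 0"
      using fun_cong[OF eq, of 0] by (simp only: times_T_minus_1_0)
    then show ?case by (rule completion_diff_cancel[OF zero_closed f])
  next
    case (Suc n)
    have "f n \<ominus>\<^bsub>R\<^esub> f (Suc n) = f n \<ominus>\<^bsub>R\<^esub> f' (Suc n)"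
      using fun_cong[OF eq, of "Suc n"] by (simp only: times_T_minus_1_Suc Suc)
    then show ?case by (rule completion_diff_cancel[OF f(1) f])
  qed
qed

lemma times_T_minus_1_funpow_inj:
  assumes "\<And>n. f n \<in> carrier R" "\<And>n. f' n \<in> carrier R" "(TT ^^ k) f = (TT ^^ k) f'"
  shows "f = f'"
  using assms(3)
proof (induction k)
  case (Suc k)
  then have "TT ((TT ^^ k) f) = TT ((TT ^^ k) f')" by simp
  then have "(TT ^^ k) f = (TT ^^ k) f'"
    by (rule times_T_minus_1_inj[rotated 2]) (intro times_T_minus_1_funpow_closed assms)+
  then show ?case by (rule Suc.IH)
qed simp

lemma times_T_minus_1_tate:
  assumes "f \<in> tate_algebra p" shows "TT f \<in> tate_algebra p"
proof -
  have f: "\<And>n. f n \<in> carrier R" "(\<lambda>n. cv (f n)) \<longlonglongrightarrow> \<infinity>" using assms by (auto simp: tate_algebra_def)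
  have "(\<lambda>n. cv (f (Suc n))) \<longlonglongrightarrow> \<infinity>" using f(2) by (rule LIMSEQ_Suc)
  then have "(\<lambda>n. cv (TT f (Suc n))) \<longlonglongrightarrow> \<infinity>"
    by (rule tendsto_infty_min[OF f(2)]) (simp add: times_T_minus_1_def completion_val_diff f)
  then have "(\<lambda>n. cv (TT f n)) \<longlonglongrightarrow> \<infinity>" by (rule LIMSEQ_imp_Suc)
  then show ?thesis using times_T_minus_1_closed f(1) by (simp add: tate_algebra_def)
qed

text \<open>The partial sums of \<open>(T - 1) f\<close> at \<open>T = 1\<close> telescope to minus
  the last coefficient of \<open>f\<close>, which tends to zero.\<close>

lemma tate_eval_1_times_T_minus_1:
  assumes "f \<in> tate_algebra p" shows "tate_eval_1 p (TT f) = \<zero>\<^bsub>R\<^esub>"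
proof (rule tate_eval_1_eqI)
  have f: "\<And>n. f n \<in> carrier R" "(\<lambda>n. cv (f n)) \<longlonglongrightarrow> \<infinity>" using assms by (auto simp: tate_algebra_def)
  show "TT f n \<in> carrier R" for n using f by (intro times_T_minus_1_closed)
  have tele: "\<zero>\<^bsub>R\<^esub> \<ominus>\<^bsub>R\<^esub> (\<Oplus>\<^bsub>R\<^esub>n\<in>{..<Suc N}. TT f n) = f N" for N
  proof (induction N)
    case 0
    obtain X where "padic_cauchy p X" "f 0 = cls X" using completion_cases[OF f(1)] .
    then show ?case
      using f by (simp add: times_T_minus_1_def lessThan_Suc completion_zero completion_class_diff
          completion_class_add padic_cauchy_diff padic_cauchy_uminus)
  next
    case (Suc N)
    let ?S = "\<Oplus>\<^bsub>R\<^esub>n\<in>{..<Suc N}. TT f n"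
    have S: "?S \<in> carrier R" using f by (intro finsum_closed) (auto intro: times_T_minus_1_closed)
    have step: "(\<Oplus>\<^bsub>R\<^esub>n\<in>{..<Suc (Suc N)}. TT f n) = TT f (Suc N) \<oplus>\<^bsub>R\<^esub> ?S"
      unfolding lessThan_Suc[of "Suc N"] using f by (intro finsum_insert) (auto intro: times_T_minus_1_closed)
    obtain X where X: "padic_cauchy p X" "f (Suc N) = cls X" using completion_cases[OF f(1)] .
    obtain Y where Y: "padic_cauchy p Y" "?S = cls Y" using completion_cases[OF S] .
    obtain Z where Z: "padic_cauchy p Z" "f N = cls Z" using completion_cases[OF f(1)] .
    note * = X Y Z
    have "cls (\<lambda>n. - Y n) = cls Z"
      using Suc.IH * by (simp add: completion_zero completion_class_diff)
    then have "(\<lambda>n. - Y n - Z n) \<in> null_seqs p" by (simp add: completion_class_eq_iff)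
    then have "cls (\<lambda>n. 0 - (Z n - X n + Y n)) = cls X"
      unfolding completion_class_eq_iff by (simp add: algebra_simps)
    then show ?case
      unfolding step using *
      by (simp add: times_T_minus_1_def completion_zero completion_class_diff completion_class_add
          padic_cauchy_add padic_cauchy_diff)
  qed
  have "(\<lambda>N. cv (\<zero>\<^bsub>R\<^esub> \<ominus>\<^bsub>R\<^esub> (\<Oplus>\<^bsub>R\<^esub>n\<in>{..<Suc N}. TT f n))) \<longlonglongrightarrow> \<infinity>"
    unfolding tele by (rule f(2))
  then show "(\<lambda>N. cv (\<zero>\<^bsub>R\<^esub> \<ominus>\<^bsub>R\<^esub> (\<Oplus>\<^bsub>R\<^esub>n\<in>{..<N}. TT f n))) \<longlonglongrightarrow> \<infinity>"
    by (rule LIMSEQ_imp_Suc)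
qed simp

text \<open>In two factorizations with nonzero value at \<open>T = 1\<close> the exponents agree:
  cancelling the smaller power would leave a surplus factor \<open>T - 1\<close>, which vanishes
  there. Then the cofactors agree too.\<close>

lemma special_value_1_eqI:
  assumes g: "g \<in> tate_algebra p" and f: "f = (TT ^^ k) g" and s: "tate_eval_1 p g \<noteq> \<zero>\<^bsub>R\<^esub>"
  shows "special_value_1 p f = tate_eval_1 p g"
  unfolding special_value_1_def
proof (rule the_equality)
  show "\<exists>k h. h \<in> tate_algebra p \<and> f = (TT ^^ k) h \<and> tate_eval_1 p g = tate_eval_1 p h \<and>
      tate_eval_1 p g \<noteq> \<zero>\<^bsub>R\<^esub>"
    by (intro exI[of _ k] exI[of _ g] conjI g f s refl)
  have le: "l \<le> m"
    if "g1 \<in> tate_algebra p" "g2 \<in> tate_algebra p" "(TT ^^ m) g1 = (TT ^^ l) g2" "tate_eval_1 p g1 \<noteq> \<zero>\<^bsub>R\<^esub>"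
    for l m g1 g2
  proof (rule ccontr)
    assume "\<not> l \<le> m"
    then obtain j where j: "l = m + Suc j" using less_imp_Suc_add[of m l] by auto
    have c: "\<And>n. g1 n \<in> carrier R" "\<And>n. g2 n \<in> carrier R" using that by (auto simp: tate_algebra_def)
    have "(TT ^^ m) g1 = (TT ^^ m) ((TT ^^ Suc j) g2)"
      using that(3) unfolding j funpow_add by simp
    then have "g1 = (TT ^^ Suc j) g2"
      by (rule times_T_minus_1_funpow_inj[rotated 2]) (intro times_T_minus_1_funpow_closed c)+
    moreover have "(TT ^^ j) g2 \<in> tate_algebra p"
      using that(2) by (induction j) (auto intro: times_T_minus_1_tate)
    ultimately show False using tate_eval_1_times_T_minus_1 that(4) by simp
  qed
  fix s' assume "\<exists>k h. h \<in> tate_algebra p \<and> f = (TT ^^ k) h \<and> s' = tate_eval_1 p h \<and> s' \<noteq> \<zero>\<^bsub>R\<^esub>"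
  then obtain l h where h: "h \<in> tate_algebra p" "f = (TT ^^ l) h" "s' = tate_eval_1 p h" "s' \<noteq> \<zero>\<^bsub>R\<^esub>"
    by blast
  have "l = k"
    using le[of g h k l] le[of h g l k] g h f s by (intro antisym) auto
  then have "(TT ^^ k) h = (TT ^^ k) g" using h(2) f by simp
  then have "h = g"
    by (rule times_T_minus_1_funpow_inj[rotated 2]) (use h(1) g in \<open>auto simp: tate_algebra_def\<close>)
  then show "s' = tate_eval_1 p g" by (simp add: h)
qed

lemma times_T_minus_1_to_completion:
  "TT (\<lambda>n. to_completion p (fps_nth F n)) = (\<lambda>n. to_completion p (fps_nth ((fps_X - 1) * F) n))"
  by (rule ext) (simp add: times_T_minus_1_def to_completion_eq completion_zero completion_class_diff left_diff_distrib
      split: nat.split)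

lemma times_T_minus_1_funpow_to_completion:
  "(TT ^^ k) (\<lambda>n. to_completion p (fps_nth F n)) = (\<lambda>n. to_completion p (fps_nth ((fps_X - 1) ^ k * F) n))"
  by (induction k) (simp_all add: times_T_minus_1_to_completion mult.assoc)

end

section \<open>Wieferich places\<close>

context drinfeld
begin

lemma ev_dvd: "h dvd x \<Longrightarrow> h dvd ev a x"
  unfolding skew_act_def by (intro dvd_sum dvd_mult frob_pow_dvd)

lemma ev_uminus: "ev (- a) x = - ev a x"
  using ev_add_left[of a "- a" x] by (simp add: eq_neg_iff_add_eq_0 add.commute)

text \<open>The difference consists of multiples of \<open>y^(q^i)\<close> with
  \<open>i \<ge> 1\<close>, and \<open>m q^i \<ge> 2 m \<ge> m + 1\<close> because
  \<open>m > 0\<close>.\<close>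

lemma ev_t_cong:
  assumes "p ^ m dvd y" "m > 0"
  shows "p ^ (m + 1) dvd ev [:0, 1:] y - [:0, 1:] * y"
proof -
  let ?D = "degree (\<phi> [:0, 1:])"
  have "ev [:0, 1:] y = g 0 * y + (\<Sum>i\<in>{..?D} - {0}. g i * y ^ CARD('f) ^ i)"
    unfolding skew_act_frob by (subst sum.remove[of _ 0]) auto
  moreover have "p ^ (m + 1) dvd (\<Sum>i\<in>{..?D} - {0}. g i * y ^ CARD('f) ^ i)"
  proof (intro dvd_sum dvd_mult)
    fix i assume "i \<in> {..?D} - {0}"
    then have "2 \<le> CARD('f) ^ i" by (intro card_field_power_ge_2) auto
    then have "m + 1 \<le> m * CARD('f) ^ i"
      using assms(2) mult_le_mono2[of 2 "CARD('f) ^ i" m] by linarith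
    then have "p ^ (m + 1) dvd (p ^ m) ^ (CARD('f) ^ i)"
      by (simp only: le_imp_power_dvd flip: power_mult)
    also have "\<dots> dvd y ^ CARD('f) ^ i" using assms(1) by (rule dvd_power_same)
    finally show "p ^ (m + 1) dvd y ^ CARD('f) ^ i" .
  qed
  ultimately show ?thesis by (simp add: g_0)
qed

lemma ev_cong:
  assumes "p ^ m dvd s" "m > 0"
  shows "p ^ (m + 1) dvd ev a s - a * s"
proof (induction a)
  case (pCons c a)
  have "ev (pCons c a) s - pCons c a * s =
    (ev [:0, 1:] (ev a s) - [:0, 1:] * ev a s) + [:0, 1:] * (ev a s - a * s)"
    unfolding ev_pCons[of c a] by (simp add: algebra_simps)
  then show ?case
    using ev_t_cong[OF ev_dvd[OF assms(1)] assms(2)] pCons.IH by (simp only: dvd_add dvd_mult)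
qed simp

text \<open>Multiples of \<open>p\<close> are stable under \<open>\<phi>\<close>, so division with
  remainder by an element of least degree stays in the transporter.\<close>

lemma ev_ideal_generator:
  assumes "a0 \<noteq> 0" "p dvd ev a0 x"
  shows "\<exists>b. b \<noteq> 0 \<and> p dvd ev b x \<and> (\<forall>a. p dvd ev a x \<longrightarrow> b dvd a)"
proof -
  obtain b where b: "b \<noteq> 0 \<and> p dvd ev b x" "\<And>a. a \<noteq> 0 \<and> p dvd ev a x \<Longrightarrow> degree b \<le> degree a"
    using assms arg_min_natI[of "\<lambda>b. b \<noteq> 0 \<and> p dvd ev b x" a0 degree]
      arg_min_nat_le[of "\<lambda>b. b \<noteq> 0 \<and> p dvd ev b x" _ degree] by blast
  have "b dvd a" if "p dvd ev a x" for a
  proof (rule ccontr)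
    assume "\<not> b dvd a"
    then have nz: "a mod b \<noteq> 0" by (simp add: dvd_eq_mod_eq_0)
    have "a mod b = a + - ((a div b) * b)" by (simp add: minus_div_mult_eq_mod)
    then have "ev (a mod b) x = ev a x - ev (a div b) (ev b x)"
      by (simp only: ev_add_left ev_uminus ev_mult) simp
    then have "p dvd ev (a mod b) x"
      using that b(1) ev_dvd by (simp add: dvd_diff)
    then have "degree b \<le> degree (a mod b)" using b(2) nz by blast
    then show False using degree_mod_less[of b a] b(1) nz by simp
  qed
  then show ?thesis using b(1) by blast
qed

text \<open>Write \<open>a0 = e b\<close> with \<open>b\<close> the generator. As \<open>p\<close>
  does not divide \<open>e\<close>, the congruence \<open>ev_cong\<close> shows that
  \<open>\<phi>_e\<close> keeps the exact power of \<open>p\<close> in \<open>\<phi>_b(1)\<close>;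
  so \<open>a0\<close> detects the same powers as \<open>b\<close>.\<close>

lemma transporter_eq_iff:
  assumes p: "place p" and a0: "lead_coeff a0 = 1" "degree a0 = degree p" "p dvd ev a0 1"
  shows "transporter \<phi> 1 (principal_ideal (p ^ (c + 1))) = transporter \<phi> 1 (principal_ideal p) \<longleftrightarrow>
    p ^ (c + 1) dvd ev a0 1"
proof
  assume "transporter \<phi> 1 (principal_ideal (p ^ (c + 1))) = transporter \<phi> 1 (principal_ideal p)"
  moreover have "a0 \<in> transporter \<phi> 1 (principal_ideal p)"
    using a0 by (simp add: transporter_def principal_ideal_def)
  ultimately have "a0 \<in> transporter \<phi> 1 (principal_ideal (p ^ (c + 1)))" by simp
  then show "p ^ (c + 1) dvd ev a0 1" by (simp add: transporter_def principal_ideal_def)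
next
  assume dvd: "p ^ (c + 1) dvd ev a0 1"
  have nz: "a0 \<noteq> 0" using a0(1) by auto
  obtain b where b: "b \<noteq> 0" "p dvd ev b 1" "\<And>a. p dvd ev a 1 \<Longrightarrow> b dvd a"
    using ev_ideal_generator[OF nz a0(3)] by blast
  obtain e where e: "a0 = e * b" using b(3)[OF a0(3)] by (metis dvd_def mult.commute)
  have e0: "e \<noteq> 0" using nz e by auto
  have pe: "\<not> p dvd e"
  proof
    assume "p dvd e"
    \<comment> \<open>Since \<open>a0\<close> has degree \<open>degree p\<close>, this leaves degree
      zero for \<open>b\<close>; then \<open>\<phi>_b(1)\<close> is a nonzero constant, which
      \<open>p\<close> cannot divide.\<close>
    then have "degree p \<le> degree e" using e0 dvd_imp_degree_le by blast
    then have "degree b = 0" using a0(2) e b(1) e0 by (simp add: degree_mult_eq)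
    then obtain k where k: "b = [:k:]" by (auto elim: degree_eq_zeroE)
    then have "p dvd [:k:]" using b(2) by (simp add: ev_const)
    then show False using k b(1) place_degree_pos[OF p] dvd_imp_degree_le[of p "[:k:]"] by simp
  qed
  define s where "s = ev b 1"
  have s: "p ^ (c + 1) dvd s"
  proof (cases "s = 0")
    case False
    then obtain m s' where s': "s = p ^ m * s'" "\<not> p dvd s'" using place_power_decompose[OF p] by blast
    have "m > 0" using b(2) s' by (cases m) (auto simp flip: s_def)
    show ?thesis
    proof (rule ccontr)
      assume "\<not> p ^ (c + 1) dvd s"
      then have "\<not> c + 1 \<le> m" using s'(1) by (metis dvd_mult2 le_imp_power_dvd)
      then have "p ^ (m + 1) dvd p ^ (c + 1)" by (intro le_imp_power_dvd) simp
      then have "p ^ (m + 1) dvd ev e s"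
        using dvd unfolding e ev_mult s_def by (rule dvd_trans)
      moreover have "p ^ (m + 1) dvd ev e s - e * s"
        using s' \<open>m > 0\<close> by (intro ev_cong) auto
      ultimately have "p ^ (m + 1) dvd e * s"
        by (metis dvd_diff_right_iff)
      then have "p ^ m * p dvd p ^ m * (e * s')" by (simp add: s'(1) mult_ac)
      then have "p dvd e * s'" using place_nz[OF p] by simp
      then show False using pe s'(2) place_prime[OF p] by (simp add: prime_elem_dvd_mult_iff)
    qed
  qed simp
  have "p ^ (c + 1) dvd ev a 1" if "p dvd ev a 1" for a
  proof -
    obtain f where "a = f * b" using b(3)[OF \<open>p dvd ev a 1\<close>] by (metis dvd_def mult.commute)
    then have "ev a 1 = ev f s" by (simp add: ev_mult s_def)
    then show ?thesis using ev_dvd[OF s] by simp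
  qed
  moreover have "p dvd ev a 1" if "p ^ (c + 1) dvd ev a 1" for a
    using that by (rule dvd_trans[rotated]) simp
  ultimately show "transporter \<phi> 1 (principal_ideal (p ^ (c + 1))) = transporter \<phi> 1 (principal_ideal p)"
    unfolding transporter_def principal_ideal_def by blast
qed

text \<open>The characteristic polynomial of \<open>\<phi>_t\<close> on \<open>A/p\<close>, the
  analogue of the order of the group of points of a reduction.\<close>

definition norm_poly :: "'f poly \<Rightarrow> 'f poly" where
  "norm_poly p = poly (residue_char_det \<phi> p) 1"

lemma norm_poly_monic:
  assumes "degree p > 0"
  shows "degree (norm_poly p) = degree p" "lead_coeff (norm_poly p) = 1"
proof -
  let ?Q = "residue_char_det \<phi> p"
  have sum: "norm_poly p = (\<Sum>i\<le>degree ?Q. coeff ?Q i)"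
    by (simp add: norm_poly_def poly_altdef)
  have "degree (norm_poly p) \<le> degree p"
    unfolding sum by (intro degree_sum_le) (auto simp: coeff_residue_char_det)
  moreover have c: "coeff (norm_poly p) (degree p) = 1"
    unfolding sum by (simp add: coeff_sum coeff_residue_char_det)
  ultimately show "degree (norm_poly p) = degree p" using le_degree[of "norm_poly p" "degree p"] by simp
  then show "lead_coeff (norm_poly p) = 1" using c by simp
qed

text \<open>Cayley--Hamilton supplies divisibility by \<open>p\<close>, and \<open>ex_act\<close>
  the value at \<open>T = 1\<close>; injectivity of the logarithm merges the two. \<open>V\<close>
  will be the cofactor of the power of \<open>T - 1\<close> in \<open>u\<close>, and acts by
  multiplication at \<open>T = 1\<close>.\<close>

lemma annihilated_eval:
  assumes "degree p > 0"
  shows "\<exists>w. LOG (Polynomial.smult p w) = emb_const V * (emb (residue_char_det \<phi> p) * LOG 1) \<and>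
    p * poly w 1 = Polynomial.smult (poly V 1) (ev (norm_poly p) 1)"
proof -
  obtain y where y: "[:p:] dvd y" "LOG y = emb (residue_char_det \<phi> p) * LOG 1"
    using char_det_annihilates[OF assms] by blast
  obtain y' where y': "LOG y' = emb (residue_char_det \<phi> p) * LOG 1" "poly y' 1 = ev (norm_poly p) (poly 1 1)"
    using ex_act[of "residue_char_det \<phi> p" 1] unfolding norm_poly_def by blast
  have "LOG y = LOG y'" by (simp add: y y')
  then have "y = y'" by (rule twisted_log_inj)
  then have y1: "poly y 1 = ev (norm_poly p) 1" using y'(2) by simp
  obtain z where z: "LOG z = emb_const V * LOG y" "[:p:] dvd z"
    "poly z 1 = ev (poly (map_poly (\<lambda>c. [:c:]) V) 1) (poly y 1)"
    using ex_act[of "map_poly (\<lambda>c. [:c:]) V" y] y(1) by blast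
  have V1: "poly (map_poly (\<lambda>c. [:c:]) V) 1 = [:poly V 1:]"
  proof (induction V)
    case (pCons a V)
    have "map_poly (\<lambda>c. [:c:]) (pCons a V) = pCons [:a:] (map_poly (\<lambda>c. [:c:]) V)"
      by (auto simp: poly_eq_iff coeff_map_poly coeff_pCons split: nat.splits)
    then show ?case using pCons.IH by simp
  qed simp
  from z(2) obtain w where w: "z = Polynomial.smult p w" by auto
  have "LOG (Polynomial.smult p w) = emb_const V * (emb (residue_char_det \<phi> p) * LOG 1)"
    using z(1) unfolding w y(2) .
  moreover have "p * poly w 1 = Polynomial.smult (poly V 1) (ev (norm_poly p) 1)"
    using z(3) unfolding V1 ev_const y1 w by simp
  ultimately show ?thesis by blast
qed

lemma wieferich_exponent_val:
  assumes p: "place p" and z: "p * z = Polynomial.smult c (ev (norm_poly p) 1)" "c \<noteq> 0"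
  shows "ereal_of_enat (wieferich_exponent \<phi> 1 p) = padic_val p (to_fract z)"
    and "wieferich \<phi> 1 p \<longleftrightarrow> padic_val p (to_fract z) > 0"
proof -
  have unit: "h dvd ev (norm_poly p) 1 \<longleftrightarrow> h dvd p * z" for h
    using z by (simp add: dvd_smult_iff)
  have key: "transporter \<phi> 1 (principal_ideal (p ^ (n + 1))) = transporter \<phi> 1 (principal_ideal p) \<longleftrightarrow>
      p ^ n dvd z" for n
  proof -
    have "transporter \<phi> 1 (principal_ideal (p ^ (n + 1))) = transporter \<phi> 1 (principal_ideal p) \<longleftrightarrow>
        p ^ (n + 1) dvd ev (norm_poly p) 1"
      using norm_poly_monic[OF place_degree_pos[OF p]] unit[of p] by (intro transporter_eq_iff p) auto
    \<comment> \<open>The factor \<open>p\<close> split off in \<open>p * z\<close> absorbs the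
      shift from \<open>n\<close> to \<open>n + 1\<close> in the exponent.\<close>
    also have "\<dots> \<longleftrightarrow> p * p ^ n dvd p * z" by (simp add: unit)
    also have "\<dots> \<longleftrightarrow> p ^ n dvd z" using place_nz[OF p] by simp
    finally show ?thesis .
  qed
  have set: "wieferich_exponent \<phi> 1 p = Sup (enat ` {n. p ^ n dvd z})"
    unfolding wieferich_exponent_def key ..
  show "ereal_of_enat (wieferich_exponent \<phi> 1 p) = padic_val p (to_fract z)"
  proof (cases "z = 0")
    case True
    have "Sup (range enat) = \<infinity>"
    proof (rule ccontr)
      assume "Sup (range enat) \<noteq> \<infinity>"
      then obtain k where k: "Sup (range enat) = enat k" by auto
      have "enat (Suc k) \<le> Sup (range enat)" by (rule Sup_upper) simp
      then show False unfolding k by simp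
    qed
    then show ?thesis using True by (simp add: set padic_val_0[OF p])
  next
    case False
    then obtain m d where d: "z = p ^ m * d" "\<not> p dvd d" using place_power_decompose[OF p] by blast
    have v: "padic_val p (to_fract z) = ereal (of_int (int m))"
      using padic_val_eqI[OF p d(2) not_dvd_1[OF p], of "int m"] by (simp add: d(1) to_fract_power)
    have "p ^ n dvd z \<longleftrightarrow> n \<le> m" for n
      unfolding padic_val_to_fract_ge_iff[OF p, symmetric] v by simp
    then have "{n. p ^ n dvd z} = {..m}" by auto
    moreover have "Sup (enat ` {..m}) = enat m"
      by (rule Sup_eqI) auto
    ultimately show ?thesis by (simp add: set v)
  qed
  have "wieferich \<phi> 1 p \<longleftrightarrow> p ^ 1 dvd z"
    using key[of 1] by (auto simp: wieferich_def numeral_2_eq_2)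
  also have "\<dots> \<longleftrightarrow> ereal (of_int (int 1)) \<le> padic_val p (to_fract z)"
    by (rule padic_val_to_fract_ge_iff[OF p, symmetric])
  also have "\<dots> \<longleftrightarrow> padic_val p (to_fract z) > 0"
    using padic_val_int_or_infty[OF p, of "to_fract z"] by (auto simp: one_ereal_def zero_ereal_def)
  finally show "wieferich \<phi> 1 p \<longleftrightarrow> padic_val p (to_fract z) > 0" .
qed

section \<open>The special value\<close>

text \<open>The class formula gives \<open>L_p = p^(-1) Q_p u log(1)\<close>. Splitting off
  \<open>(T - 1)^k\<close> leaves a series to which the convergence results for
  \<open>log_term\<close> apply.\<close>

lemma L_tate_eq:
  assumes "small_model r \<phi>" "place p" and u: "u_poly = [:- 1, 1:] ^ k * V"
    and w: "LOG (Polynomial.smult p w) = emb_const V * (emb (residue_char_det \<phi> p) * LOG 1)"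
  shows "L_tate \<phi> p = (times_T_minus_1 (completion p) ^^ k) (\<lambda>n. to_completion p (log_term p g w n))"
proof -
  define F where "F = fps_const (inverse (to_fract p)) * LOG (Polynomial.smult p w)"
  have emb_const_mult: "emb_const (U * U') = emb_const U * emb_const U'" for U U' :: "'f poly"
  proof -
    have "map_poly (\<lambda>c. [:c:]) (U * U') = map_poly (\<lambda>c. [:c:]) U * map_poly (\<lambda>c. [:c:]) U'"
      by (rule poly_poly_eqI) (simp add: coeff_map_poly coeff_mult coeff_sum coeff_pCons
          sum_distrib_left mult_ac split: nat.split)
    then show ?thesis by (simp add: emb_mult)
  qed
  have "emb_const ([:- 1, 1 :: 'f:] ^ k) = (fps_X - 1) ^ k"
  proof (induction k)
    case (Suc k)
    have "[:- 1 :: 'f:] = - 1" by (simp add: one_pCons)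
    then have "to_fract [:- 1 :: 'f:] = - 1" by simp
    then have "emb_const [:- 1, 1:] = fps_X - (1 :: 'f poly fract fps)"
      by (intro fps_ext) (auto simp: coeff_map_poly coeff_pCons split: nat.splits simp flip: one_pCons)
    then show ?case using Suc by (simp only: power_Suc emb_const_mult)
  qed (simp add: map_poly_1')
  then have "L_series_at \<phi> p = (fps_X - 1) ^ k * F"
    by (simp add: L_series_at_def L_series_eq[OF assms(1)] local_factor_eq u emb_const_mult F_def w mult_ac)
  moreover have "fps_nth F n = log_term p g w n" for n
    by (simp add: F_def log_term_def divide_inverse mult.commute)
  ultimately show ?thesis
    unfolding L_tate_def using times_T_minus_1_funpow_to_completion[OF assms(2), of k F] by simp
qed

lemma log_term_tate:
  assumes p: "place p" and card: "CARD('f) = 2 \<longrightarrow> degree p > 1"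
  shows "(\<lambda>n. to_completion p (log_term p g w n)) \<in> tate_algebra p"
    and "completion_val p (tate_eval_1 p (\<lambda>n. to_completion p (log_term p g w n))) = padic_val p (to_fract (poly w 1))"
    and "tate_eval_1 p (\<lambda>n. to_completion p (log_term p g w n)) \<in> carrier (completion p)"
proof -
  have lim: "(\<lambda>n. padic_val p (log_term p g w n)) \<longlonglongrightarrow> \<infinity>"
    unfolding tendsto_infty_iff_ge
  proof
    fix M :: real
    obtain k :: nat where k: "M \<le> real k" using real_arch_simple by blast
    have "ereal M \<le> padic_val p (log_term p g w n)" if "n \<ge> k + degree w" for n
    proof -
      have "M \<le> of_int (int n - int (degree w))" using k that by simp
      then have "ereal M \<le> ereal (of_int (int n - int (degree w)))" by simp
      also have "\<dots> \<le> padic_val p (log_term p g w n)" by (rule padic_val_log_term[OF p card])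
      finally show ?thesis .
    qed
    then show "\<forall>\<^sub>F n in sequentially. ereal M \<le> padic_val p (log_term p g w n)"
      unfolding eventually_sequentially by blast
  qed
  then show "(\<lambda>n. to_completion p (log_term p g w n)) \<in> tate_algebra p"
    using completion_class_closed[OF p padic_cauchy_const[OF p]]
    by (simp add: tate_algebra_def completion_val_to_completion[OF p] to_completion_eq[OF p, symmetric])
  note T = tate_eval_1_to_completion[OF p lim]
  show "tate_eval_1 p (\<lambda>n. to_completion p (log_term p g w n)) \<in> carrier (completion p)"
    unfolding T(2) by (rule completion_class_closed[OF p T(1)])
  show "completion_val p (tate_eval_1 p (\<lambda>n. to_completion p (log_term p g w n))) = padic_val p (to_fract (poly w 1))"
    unfolding T(2) by (rule completion_val_class[OF p T(1) padic_val_partial_sums_tendsto[OF p card]])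
qed

lemma very_small_imp_small: "very_small_model r \<phi> \<Longrightarrow> small_model r \<phi>"
  by (auto simp: very_small_model_def small_model_def intro: less_imp_le)

lemma u_poly_very_small:
  assumes "very_small_model r \<phi>" shows "u_poly = 1"
proof -
  have "(\<Sum>i\<in>{1..r}. monom (coeff (g i) (CARD('f) ^ i)) i) = 0"
    using assms by (intro sum.neutral) (auto simp: very_small_model_def coeff_eq_0)
  then show ?thesis by (simp add: u_poly_def)
qed

text \<open>Here \<open>u = 1\<close>, so \<open>k = 0\<close> and \<open>V = 1\<close>. If
  \<open>w(1) = 0\<close>, both sides are infinite.\<close>

lemma L_value_val:
  assumes "very_small_model r \<phi>" and p: "place p" and card: "CARD('f) = 2 \<longrightarrow> degree p > 1"
  shows "completion_val p (L_value \<phi> p) = ereal_of_enat (wieferich_exponent \<phi> 1 p) \<and>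
    (wieferich \<phi> 1 p \<longleftrightarrow> completion_val p (L_value \<phi> p) > 0)"
proof -
  obtain w where w: "LOG (Polynomial.smult p w) = emb_const 1 * (emb (residue_char_det \<phi> p) * LOG 1)"
    "p * poly w 1 = Polynomial.smult (poly 1 1) (ev (norm_poly p) 1)"
    using annihilated_eval[OF place_degree_pos[OF p]] by blast
  have "L_tate \<phi> p = (\<lambda>n. to_completion p (log_term p g w n))"
    using L_tate_eq[OF very_small_imp_small[OF assms(1)] p, of 0 1 w] w(1) u_poly_very_small[OF assms(1)]
    by simp
  then have "completion_val p (L_value \<phi> p) = padic_val p (to_fract (poly w 1))"
    unfolding L_value_def by (simp add: log_term_tate(2)[OF p card])
  then show ?thesis
    using wieferich_exponent_val[OF p w(2)] by simp
qed

text \<open>With \<open>k\<close> the order of \<open>u\<close> at \<open>T = 1\<close>,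
  \<open>V(1)\<close> is nonzero. As \<open>1\<close> is not torsion and \<open>norm_poly p\<close>
  is monic, \<open>w(1)\<close> is nonzero as well, so \<open>k\<close> is the exact exponent in the
  special value.\<close>

lemma L_special_value_val:
  assumes "small_model r \<phi>" "\<not> torsion_point \<phi> 1"
    and p: "place p" and card: "CARD('f) = 2 \<longrightarrow> degree p > 1"
  shows "completion_val p (L_special_value \<phi> p) = ereal_of_enat (wieferich_exponent \<phi> 1 p) \<and>
    (wieferich \<phi> 1 p \<longleftrightarrow> completion_val p (L_special_value \<phi> p) > 0)"
proof -
  have "coeff u_poly 0 = 1" by (simp add: coeff_u_poly)
  then have "u_poly \<noteq> 0" by auto
  then obtain V where V: "u_poly = [:- 1, 1:] ^ Polynomial.order 1 u_poly * V" "\<not> [:- 1, 1:] dvd V"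
    using order_decomp by blast
  have V1: "poly V 1 \<noteq> 0" using V(2) by (simp add: poly_eq_0_iff_dvd)
  obtain w where w: "LOG (Polynomial.smult p w) = emb_const V * (emb (residue_char_det \<phi> p) * LOG 1)"
    "p * poly w 1 = Polynomial.smult (poly V 1) (ev (norm_poly p) 1)"
    using annihilated_eval[OF place_degree_pos[OF p]] by blast
  let ?G = "\<lambda>n. to_completion p (log_term p g w n)"
  have "lead_coeff (norm_poly p) = 1" using norm_poly_monic(2)[OF place_degree_pos[OF p]] .
  then have "norm_poly p \<noteq> 0" by auto
  then have "ev (norm_poly p) 1 \<noteq> 0" using assms(2) by (auto simp: torsion_point_def)
  then have "poly w 1 \<noteq> 0" using w(2) V1 by auto
  then have "padic_val p (to_fract (poly w 1)) \<noteq> \<infinity>" by (simp add: padic_val_eq_infty_iff[OF p])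
  then have nz: "tate_eval_1 p ?G \<noteq> \<zero>\<^bsub>completion p\<^esub>"
    using completion_val_infty_iff[OF p log_term_tate(3)[OF p card, of w]] log_term_tate(2)[OF p card, of w] by auto
  have "L_special_value \<phi> p = tate_eval_1 p ?G"
    unfolding L_special_value_def
    by (rule special_value_1_eqI[OF p log_term_tate(1)[OF p card] L_tate_eq[OF assms(1) p V(1) w(1)] nz])
  then have "completion_val p (L_special_value \<phi> p) = padic_val p (to_fract (poly w 1))"
    by (simp add: log_term_tate(2)[OF p card])
  then show ?thesis
    using wieferich_exponent_val[OF p w(2) V1] by simp
qed

end

theorem theoremA:
  fixes \<phi> :: "'f::finite_field poly \<Rightarrow> 'f poly poly" and r :: nat and p :: "'f poly"
  assumes "drinfeld_model r \<phi>" and "place p" and "CARD('f) = 2 \<longrightarrow> degree p > 1"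
  shows "(very_small_model r \<phi> \<longrightarrow>
            completion_val p (L_value \<phi> p) = ereal_of_enat (wieferich_exponent \<phi> 1 p) \<and>
            (wieferich \<phi> 1 p \<longleftrightarrow> completion_val p (L_value \<phi> p) > 0)) \<and>
         (small_model r \<phi> \<and> \<not> torsion_point \<phi> 1 \<longrightarrow>
            completion_val p (L_special_value \<phi> p) = ereal_of_enat (wieferich_exponent \<phi> 1 p) \<and>
            (wieferich \<phi> 1 p \<longleftrightarrow> completion_val p (L_special_value \<phi> p) > 0))"
proof -
  interpret drinfeld \<phi> r by (rule drinfeld.intro) (rule assms(1))
  show ?thesis
    using L_value_val[OF _ assms(2,3)] L_special_value_val[OF _ _ assms(2,3)] by blast
qed

end
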